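(* Let $r>a\ge1$ be coprime integers and let $A_{r,a}$ be the reconstruction algebra associated to $G=\frac1r(1,a)$. The centre of $A_{r,a}$ is $\mathbb{C}[x,y]^{\frac1r(1,a)}$, and furthermore $A_{r,a}$ is a finitely generated module over its centre. Consequently $A_{r,a}$ is a noetherian PI ring.
   Context: Ground field $\mathbb{C}$; $pq$ for paths means $p$ followed by $q$. Group. $G=\frac1r(1,a)=\langle\zeta\rangle\le GL(2,\mathbb{C})$, $\zeta=\mathrm{diag}(\varepsilon,\varepsilon^a)$, $\varepsilon$ a primitive $r$-th root of unity, acting on $\mathbb{C}[x,y]$ by $\zeta x=\varepsilon x$, $\zeta y=\varepsilon^a y$. Write $\frac ra=[\alpha_1,\dots,\alpha_n]:=\alpha_1-\frac{1}{\alpha_2-\frac{1}{\alpha_3-\cdots}}$ with all $\alpha_i\ge2$. Reconstruction algebra. $A_{r,a}$ is the path algebra over $\mathbb{C}$ of the following quiver $Q$ modulo the following relations. Put $\gamma=\sum_{i=1}^n(\alpha_i-2)$. If $n=1$: vertices $0,1$; arrows $a_1,a_2:0\to1$; $c_1,c_2:1\to0$; $k_1,\dots,k_{\alpha_1-2}:1\to0$. Relations: $c_2a_1=c_1a_2$, $a_1c_2=a_2c_1$; (if $\alpha_1>2$) $k_1a_1=c_2a_2$, $a_1k_1=a_2c_2$; $k_ta_1=k_{t-1}a_2$, $a_1k_t=a_2k_{t-1}$ for $2\le t\le\alpha_1-2$. If $n\ge2$: vertices $0,1,\dots,n$; clockwise arrows $c_{0n}:0\to n$ and $c_{t,t-1}:t\to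 t-1$ ($1\le t\le n$); anticlockwise arrows $a_{t,t+1}:t\to t+1$ ($0\le t\le n-1$) and $a_{n0}:n\to0$; and for each $1\le i\le n$, $\alpha_i-2$ extra arrows $i\to0$; the extra arrows are labelled $k_1,\dots,k_\gamma$ with weakly increasing tails. Put $k_0:=c_{10}$, $k_{\gamma+1}:=a_{n0}$. Let $l_s$ be the tail of $k_s$, $u_i=\max\{j:l_j=i\}$, $v_i=\min\{j:l_j=i\}$, $V_1=0$, $V_i=\max\{j:l_j<i\}$ for $2\le i\le n$. For $i\ne j$, $C_{ij}$ (resp. $A_{ij}$) is the shortest path from $i$ to $j$ consisting of clockwise (resp. anticlockwise) arrows. Relations: Step 1: if $\alpha_1=2$: $c_{10}a_{01}=a_{12}c_{21}$. If $\alpha_1>2$: $k_sa_{01}=k_{s+1}C_{01}$ and $a_{01}k_s=C_{01}k_{s+1}$ for $0\le s<u_1$; $k_{u_1}a_{01}=a_{12}c_{21}$. Step $t$ ($1<t<n$): if $\alpha_t=2$: $c_{t,t-1}a_{t-1,t}=a_{t,t+1}c_{t+1,t}$. If $\alpha_t>2$: $c_{t,t-1}a_{t-1,t}=k_{v_t}C_{0t}$; $C_{0t}k_{v_t}=A_{0l_{V_t}}k_{V_t}$; $k_sA_{0t}=k_{s+1}C_{0t}$ and $A_{0t}k_s=C_{0t}k_{s+1}$ for $v_t\le s<u_t$; $k_{u_t}A_{0t}=a_{t,t+1}c_{t+1,t}$. Step $n$: if $\alpha_n=2$: $c_{n,n-1}a_{n-1,n}=a_{n0}c_{0n}$; $c_{0n}a_{n0}=A_{0l_{V_n}}k_{V_n}$.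 If $\alpha_n>2$: $c_{n,n-1}a_{n-1,n}=k_{v_n}c_{0n}$; $c_{0n}k_{v_n}=A_{0l_{V_n}}k_{V_n}$; $k_sA_{0n}=k_{s+1}c_{0n}$ and $A_{0n}k_s=c_{0n}k_{s+1}$ for $v_n\le s<u_n$. *)

theory Defs
  imports
    "HOL-Library.Poly_Mapping"
    "HOL-Computational_Algebra.Polynomial"
    "HOL-Algebra.Ideal"
    "HOL-Algebra.QuotRing"
    "HOL-Algebra.Generated_Groups"
    "HOL-Algebra.Algebraic_Closure_Type"
    "Graph_Theory.Arc_Walk"
    "Jordan_Normal_Form.Matrix"
begin

section \<open>Ring-theoretic notions for noncommutative rings\<close>

definition centre :: "('a, 'm) ring_scheme \<Rightarrow> 'a set" where
  "centre R = {z \<in> carrier R. \<forall>x \<in> carrier R. z \<otimes>\<^bsub>R\<^esub> x = x \<otimes>\<^bsub>R\<^esub> z}"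

definition centre_ring :: "('a, 'm) ring_scheme \<Rightarrow> ('a, 'm) ring_scheme" where
  "centre_ring R = R\<lparr>carrier := centre R\<rparr>"

definition finite_over_centre :: "('a, 'm) ring_scheme \<Rightarrow> bool" where
  "finite_over_centre R \<longleftrightarrow>
     (\<exists>S. finite S \<and> S \<subseteq> carrier R \<and>
        (\<forall>x \<in> carrier R. \<exists>z \<in> S \<rightarrow> centre R. x = (\<Oplus>\<^bsub>R\<^esub>s\<in>S. z s \<otimes>\<^bsub>R\<^esub> s)))"

definition left_ideal :: "'a set \<Rightarrow> ('a, 'm) ring_scheme \<Rightarrow> bool" where
  "left_ideal I R \<longleftrightarrow> additive_subgroup I R \<and> (\<forall>x \<in> carrier R. \<forall>i \<in> I. x \<otimes>\<^bsub>R\<^esub> i \<in> I)"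

definition right_ideal :: "'a set \<Rightarrow> ('a, 'm) ring_scheme \<Rightarrow> bool" where
  "right_ideal I R \<longleftrightarrow> additive_subgroup I R \<and> (\<forall>x \<in> carrier R. \<forall>i \<in> I. i \<otimes>\<^bsub>R\<^esub> x \<in> I)"

text \<open>The library's locale \<^locale>\<open>noetherian_ring\<close> concerns two-sided ideals only; over a
  noncommutative ring the one-sided ideals have to be finitely generated.\<close>

definition left_noetherian :: "('a, 'm) ring_scheme \<Rightarrow> bool" where
  "left_noetherian R \<longleftrightarrow> ring R \<and>
     (\<forall>I. left_ideal I R \<longrightarrow>
        (\<exists>S \<subseteq> carrier R. finite S \<and> I = \<Inter>{J. left_ideal J R \<and> S \<subseteq> J}))"

definition right_noetherian :: "('a, 'm) ring_scheme \<Rightarrow> bool" where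
  "right_noetherian R \<longleftrightarrow> ring R \<and>
     (\<forall>I. right_ideal I R \<longrightarrow>
        (\<exists>S \<subseteq> carrier R. finite S \<and> I = \<Inter>{J. right_ideal J R \<and> S \<subseteq> J}))"

definition noetherian :: "('a, 'm) ring_scheme \<Rightarrow> bool" where
  "noetherian R \<longleftrightarrow> left_noetherian R \<and> right_noetherian R"

text \<open>An element of the free ring \<open>\<int>\<langle>x\<^sub>0, x\<^sub>1, \<dots>\<rangle>\<close> is a finitely supported map from words
  (lists of variable indices) to \<open>\<int>\<close>. As usual for polynomial identities, it is called monic if
  some word of maximal length in its support has coefficient 1.\<close>

type_synonym nc_poly = "nat list \<Rightarrow>\<^sub>0 int"

definition nc_monic :: "nc_poly \<Rightarrow> bool" where
  "nc_monic f \<longleftrightarrow>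
     (\<exists>w \<in> Poly_Mapping.keys f. Poly_Mapping.lookup f w = 1 \<and>
        (\<forall>w' \<in> Poly_Mapping.keys f. length w' \<le> length w))"

definition nc_eval :: "('a, 'm) ring_scheme \<Rightarrow> (nat \<Rightarrow> 'a) \<Rightarrow> nc_poly \<Rightarrow> 'a" where
  "nc_eval R \<sigma> f =
     (\<Oplus>\<^bsub>R\<^esub>w \<in> Poly_Mapping.keys f.
        [Poly_Mapping.lookup f w] \<cdot>\<^bsub>R\<^esub> foldr (\<lambda>i x. \<sigma> i \<otimes>\<^bsub>R\<^esub> x) w \<one>\<^bsub>R\<^esub>)"

definition PI_ring :: "('a, 'm) ring_scheme \<Rightarrow> bool" where
  "PI_ring R \<longleftrightarrow> ring R \<and>
     (\<exists>f. nc_monic f \<and> (\<forall>\<sigma>. range \<sigma> \<subseteq> carrier R \<longrightarrow> nc_eval R \<sigma> f = \<zero>\<^bsub>R\<^esub>))"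


section \<open>Path algebras of quivers\<close>

text \<open>A quiver is a \<^typ>\<open>('v, 'e) pre_digraph\<close>. A path is a triple \<open>(u, p, v)\<close> where \<open>p\<close> is the list
  of its arrows in the order in which they are traversed; thus \<open>(v, [], v)\<close> is the trivial path
  at \<open>v\<close>, and the product \<open>pq\<close> is \<open>p\<close> followed by \<open>q\<close>.\<close>

type_synonym ('v, 'e) path_elem = "('v \<times> 'e list \<times> 'v) \<Rightarrow>\<^sub>0 complex"

definition paths :: "('v, 'e) pre_digraph \<Rightarrow> ('v \<times> 'e list \<times> 'v) set" where
  "paths Q = {(u, p, v). pre_digraph.awalk Q u p v}"

definition path_mult :: "('v, 'e) path_elem \<Rightarrow> ('v, 'e) path_elem \<Rightarrow> ('v, 'e) path_elem" where
  "path_mult f g =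
     (\<Sum>(u, p, v) \<in> Poly_Mapping.keys f. \<Sum>(v', q, w) \<in> Poly_Mapping.keys g.
        if v = v'
        then Poly_Mapping.single (u, p @ q, w)
               (Poly_Mapping.lookup f (u, p, v) * Poly_Mapping.lookup g (v', q, w))
        else 0)"

definition path_scalar :: "('v, 'e) pre_digraph \<Rightarrow> complex \<Rightarrow> ('v, 'e) path_elem" where
  "path_scalar Q c = (\<Sum>v \<in> verts Q. Poly_Mapping.single (v, [], v) c)"

definition path_algebra :: "('v, 'e) pre_digraph \<Rightarrow> ('v, 'e) path_elem ring" where
  "path_algebra Q =
     \<lparr>carrier = {f. Poly_Mapping.keys f \<subseteq> paths Q}, monoid.mult = path_mult,
      one = path_scalar Q 1, zero = 0, add = (+)\<rparr>"

definition path_term ::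
    "'v \<times> 'e list \<times> 'v \<Rightarrow> 'v \<times> 'e list \<times> 'v \<Rightarrow> complex \<Rightarrow> ('v, 'e) path_elem" where
  "path_term p q c =
     (if snd (snd p) = fst q
      then Poly_Mapping.single (fst p, fst (snd p) @ fst (snd q), snd (snd q)) c else 0)"

lemma path_term_add: "path_term p q (c + d) = path_term p q c + path_term p q d"
  by (simp add: path_term_def single_add)

lemma path_term_0 [simp]: "path_term p q 0 = 0"
  by (simp add: path_term_def)

lemma path_mult_eq:
  assumes "finite A" "finite B" "Poly_Mapping.keys f \<subseteq> A" "Poly_Mapping.keys g \<subseteq> B"
  shows "path_mult f g =
    (\<Sum>p\<in>A. \<Sum>q\<in>B. path_term p q (Poly_Mapping.lookup f p * Poly_Mapping.lookup g q))"
proof -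
  have "path_mult f g = (\<Sum>p\<in>Poly_Mapping.keys f. \<Sum>q\<in>Poly_Mapping.keys g.
      path_term p q (Poly_Mapping.lookup f p * Poly_Mapping.lookup g q))"
    unfolding path_mult_def path_term_def by (intro sum.cong refl) (auto intro!: sum.cong)
  also have "\<dots> = (\<Sum>p\<in>Poly_Mapping.keys f. \<Sum>q\<in>B.
      path_term p q (Poly_Mapping.lookup f p * Poly_Mapping.lookup g q))"
    using assms by (intro sum.cong refl sum.mono_neutral_left) (auto simp: in_keys_iff)
  also have "\<dots> = (\<Sum>p\<in>A. \<Sum>q\<in>B.
      path_term p q (Poly_Mapping.lookup f p * Poly_Mapping.lookup g q))"
    using assms by (intro sum.mono_neutral_left) (auto simp: in_keys_iff)
  finally show ?thesis .
qed

lemma path_mult_add_left: "path_mult (f + g) h = path_mult f h + path_mult g h"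
proof -
  let ?A = "Poly_Mapping.keys f \<union> Poly_Mapping.keys g" and ?B = "Poly_Mapping.keys h"
  have "Poly_Mapping.keys (f + g) \<subseteq> ?A" by (rule keys_add)
  then show ?thesis
    by (subst (1 2 3) path_mult_eq[of ?A ?B])
       (auto simp: lookup_add distrib_right path_term_add sum.distrib)
qed

lemma path_mult_add_right: "path_mult h (f + g) = path_mult h f + path_mult h g"
proof -
  let ?B = "Poly_Mapping.keys f \<union> Poly_Mapping.keys g" and ?A = "Poly_Mapping.keys h"
  have "Poly_Mapping.keys (f + g) \<subseteq> ?B" by (rule keys_add)
  then show ?thesis
    by (subst (1 2 3) path_mult_eq[of ?A ?B])
       (auto simp: lookup_add distrib_left path_term_add sum.distrib)
qed

lemma path_mult_0 [simp]: "path_mult 0 f = 0" "path_mult f 0 = 0"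
  by (simp_all add: path_mult_def)

lemma path_mult_sum_left: "path_mult (\<Sum>i\<in>I. f i) h = (\<Sum>i\<in>I. path_mult (f i) h)"
  by (induction I rule: infinite_finite_induct) (simp_all add: path_mult_add_left)

lemma path_mult_sum_right: "path_mult h (\<Sum>i\<in>I. f i) = (\<Sum>i\<in>I. path_mult h (f i))"
  by (induction I rule: infinite_finite_induct) (simp_all add: path_mult_add_right)

lemma path_mult_single:
  "path_mult (Poly_Mapping.single p c) (Poly_Mapping.single q d) = path_term p q (c * d)"
  by (subst path_mult_eq[of "{p}" "{q}"]) auto

lemma path_elem_sum:
  "f = (\<Sum>p\<in>Poly_Mapping.keys f. Poly_Mapping.single p (Poly_Mapping.lookup f p))"
proof (rule poly_mapping_eqI)
  fix p
  show "Poly_Mapping.lookup f p =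
    Poly_Mapping.lookup (\<Sum>p\<in>Poly_Mapping.keys f. Poly_Mapping.single p (Poly_Mapping.lookup f p)) p"
    by (simp add: lookup_sum lookup_single when_def in_keys_iff)
qed

lemma path_mult_assoc: "path_mult (path_mult f g) h = path_mult f (path_mult g h)"
proof -
  have *: "path_mult (path_mult (Poly_Mapping.single p c) (Poly_Mapping.single q d))
              (Poly_Mapping.single s e) =
           path_mult (Poly_Mapping.single p c)
              (path_mult (Poly_Mapping.single q d) (Poly_Mapping.single s e))" for p q s c d e
    by (simp add: path_mult_single path_term_def mult.assoc)
  show ?thesis
    by (subst (1 2) path_elem_sum[of f], subst (1 2) path_elem_sum[of g],
        subst (1 2) path_elem_sum[of h])
       (simp only: path_mult_sum_left path_mult_sum_right *)
qed

context fin_digraph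
begin

lemma path_scalar_closed: "path_scalar G c \<in> carrier (path_algebra G)"
proof -
  have "Poly_Mapping.keys (path_scalar G c) \<subseteq> (\<Union>v\<in>verts G. {(v, [], v)})"
    unfolding path_scalar_def by (rule order.trans[OF keys_sum]) (auto split: if_splits)
  then show ?thesis by (auto simp: path_algebra_def paths_def awalk_def)
qed

lemma path_mult_closed:
  assumes "f \<in> carrier (path_algebra G)" "g \<in> carrier (path_algebra G)"
  shows "path_mult f g \<in> carrier (path_algebra G)"
proof -
  have "Poly_Mapping.keys (path_term p q c) \<subseteq> paths G"
    if "p \<in> paths G" "q \<in> paths G" for p q c
    using that by (auto simp: path_term_def paths_def split: if_splits)
  then have "Poly_Mapping.keys (path_mult f g) \<subseteq> paths G"
    using assms
    by (subst path_mult_eq[OF finite_keys finite_keys order.refl order.refl])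
       (fastforce simp: path_algebra_def dest!: subsetD[OF keys_sum])
  then show ?thesis by (simp add: path_algebra_def)
qed

lemma path_scalar_mult:
  assumes "f \<in> carrier (path_algebra G)"
  shows "path_mult (path_scalar G 1) f = f" "path_mult f (path_scalar G 1) = f"
proof -
  have mem: "fst p \<in> verts G" "snd (snd p) \<in> verts G" if "p \<in> Poly_Mapping.keys f" for p
    using that assms by (force simp: path_algebra_def paths_def)+
  have "path_mult (path_scalar G 1) f =
      (\<Sum>p\<in>Poly_Mapping.keys f. \<Sum>w\<in>verts G. path_term (w, [], w) p (Poly_Mapping.lookup f p))"
    unfolding path_scalar_def
    by (subst path_elem_sum[of f])
       (simp add: path_mult_sum_left path_mult_sum_right path_mult_single)
  also have "\<dots> = (\<Sum>p\<in>Poly_Mapping.keys f. Poly_Mapping.single p (Poly_Mapping.lookup f p))"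
    using mem by (intro sum.cong refl) (simp add: path_term_def)
  finally show "path_mult (path_scalar G 1) f = f" using path_elem_sum[of f] by simp
  have "path_mult f (path_scalar G 1) =
      (\<Sum>p\<in>Poly_Mapping.keys f. \<Sum>w\<in>verts G. path_term p (w, [], w) (Poly_Mapping.lookup f p))"
    unfolding path_scalar_def
    by (subst path_elem_sum[of f], subst sum.swap)
       (simp add: path_mult_sum_left path_mult_sum_right path_mult_single)
  also have "\<dots> = (\<Sum>p\<in>Poly_Mapping.keys f. Poly_Mapping.single p (Poly_Mapping.lookup f p))"
    using mem by (intro sum.cong refl) (auto simp: path_term_def eq_commute cong: if_cong)
  finally show "path_mult f (path_scalar G 1) = f" using path_elem_sum[of f] by simp
qed

lemma ring_path_algebra: "ring (path_algebra G)"
proof (rule ringI)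
  show "abelian_group (path_algebra G)"
  proof (rule abelian_groupI)
    fix f assume "f \<in> carrier (path_algebra G)"
    then show "\<exists>g\<in>carrier (path_algebra G). g \<oplus>\<^bsub>path_algebra G\<^esub> f = \<zero>\<^bsub>path_algebra G\<^esub>"
      by (intro bexI[of _ "-f"]) (auto simp: path_algebra_def)
  next
    fix f g assume "f \<in> carrier (path_algebra G)" "g \<in> carrier (path_algebra G)"
    then show "f \<oplus>\<^bsub>path_algebra G\<^esub> g \<in> carrier (path_algebra G)"
      using keys_add[of f g] by (auto simp: path_algebra_def)
  qed (auto simp: path_algebra_def algebra_simps)
  show "monoid (path_algebra G)"
    by (rule monoidI)
       (use path_mult_closed path_scalar_closed path_scalar_mult path_mult_assoc
        in \<open>auto simp: path_algebra_def\<close>)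
qed (auto simp: path_algebra_def path_mult_add_left path_mult_add_right)

end

text \<open>The basis element given by a nonempty list of composable arrows.\<close>

definition path_of :: "('v, 'e) pre_digraph \<Rightarrow> 'e list \<Rightarrow> ('v, 'e) path_elem" where
  "path_of Q p = Poly_Mapping.single (tail Q (hd p), p, head Q (last p)) 1"

text \<open>The ideal generated by the relations \<open>p = q\<close> for \<open>(p, q) \<in> E\<close>.\<close>

definition relation_ideal ::
    "('v, 'e) pre_digraph \<Rightarrow> ('e list \<times> 'e list) set \<Rightarrow> ('v, 'e) path_elem set" where
  "relation_ideal Q E = Idl\<^bsub>path_algebra Q\<^esub> {path_of Q p - path_of Q q | p q. (p, q) \<in> E}"


section \<open>Continued fractions\<close>

fun hj_value :: "nat list \<Rightarrow> rat" where
  "hj_value [] = 0"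
| "hj_value [\<alpha>] = of_nat \<alpha>"
| "hj_value (\<alpha> # \<beta> # \<alpha>s) = of_nat \<alpha> - 1 / hj_value (\<beta> # \<alpha>s)"

definition is_hj_expansion :: "nat \<Rightarrow> nat \<Rightarrow> nat list \<Rightarrow> bool" where
  "is_hj_expansion r a \<alpha>s \<longleftrightarrow>
     \<alpha>s \<noteq> [] \<and> (\<forall>\<alpha> \<in> set \<alpha>s. \<alpha> \<ge> 2) \<and> hj_value \<alpha>s = of_nat r / of_nat a"

definition hj_expansion :: "nat \<Rightarrow> nat \<Rightarrow> nat list" where
  "hj_expansion r a = (THE \<alpha>s. is_hj_expansion r a \<alpha>s)"


lemma hj_value_gt_1:
  assumes "\<alpha>s \<noteq> []" "\<forall>\<alpha> \<in> set \<alpha>s. \<alpha> \<ge> 2"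
  shows "hj_value \<alpha>s > 1"
  using assms
proof (induction \<alpha>s rule: hj_value.induct)
  case (3 \<alpha> \<beta> \<alpha>s)
  then have "hj_value (\<beta> # \<alpha>s) > 1" by simp
  moreover have "(2::rat) \<le> of_nat \<alpha>" using 3(3) by simp
  moreover have "1 / hj_value (\<beta> # \<alpha>s) < 1" using calculation(1) by simp
  ultimately show ?case unfolding hj_value.simps by linarith
qed auto

lemma hj_value_Cons:
  "\<alpha>s \<noteq> [] \<Longrightarrow> hj_value (\<alpha> # \<alpha>s) = of_nat \<alpha> - 1 / hj_value \<alpha>s"
  by (cases \<alpha>s) auto

lemma hj_value_ceiling:
  assumes "\<alpha>s \<noteq> []" "\<forall>\<alpha> \<in> set \<alpha>s. \<alpha> \<ge> 2"
  shows "\<lceil>hj_value \<alpha>s\<rceil> = int (hd \<alpha>s)"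
proof (cases \<alpha>s)
  case (Cons \<alpha> \<beta>s)
  show ?thesis
  proof (cases "\<beta>s = []")
    case False
    then have "hj_value \<beta>s > 1" using hj_value_gt_1 assms Cons by simp
    then have "0 < 1 / hj_value \<beta>s" "1 / hj_value \<beta>s < 1" by auto
    then show ?thesis using Cons False by (simp add: hj_value_Cons ceiling_eq_iff)
  qed (use Cons in simp)
qed (use assms in simp)

lemma hj_value_inj:
  assumes "\<alpha>s \<noteq> []" "\<forall>\<alpha> \<in> set \<alpha>s. \<alpha> \<ge> 2" "\<beta>s \<noteq> []" "\<forall>\<beta> \<in> set \<beta>s. \<beta> \<ge> 2"
    and "hj_value \<alpha>s = hj_value \<beta>s"
  shows "\<alpha>s = \<beta>s"
  using assms
proof (induction \<alpha>s arbitrary: \<beta>s)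
  case (Cons \<alpha> \<alpha>s)
  obtain \<beta> \<beta>s' where \<beta>s: "\<beta>s = \<beta> # \<beta>s'" using Cons.prems by (cases \<beta>s) auto
  have hd: "\<alpha> = \<beta>"
    using hj_value_ceiling[of "\<alpha> # \<alpha>s"] hj_value_ceiling[of \<beta>s] Cons.prems \<beta>s by simp
  have gt: "xs \<noteq> [] \<Longrightarrow> set xs \<subseteq> {2..} \<Longrightarrow> 1 / hj_value xs > 0" for xs
    using hj_value_gt_1[of xs] by fastforce
  have "\<alpha>s = [] \<longleftrightarrow> \<beta>s' = []"
    using Cons.prems gt[of \<alpha>s] gt[of \<beta>s'] \<beta>s hd
    by (cases "\<alpha>s = []"; cases "\<beta>s' = []") (auto simp: hj_value_Cons)
  then show ?case
    using Cons.prems Cons.IH[of \<beta>s'] \<beta>s hd by (cases "\<alpha>s = []") (auto simp: hj_value_Cons)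
qed simp

lemma hj_expansion_exists:
  assumes "r > a" "a \<ge> 1"
  shows "\<exists>\<alpha>s. is_hj_expansion r a \<alpha>s"
  using assms
proof (induction a arbitrary: r rule: less_induct)
  case (less a)
  show ?case
  proof (cases "a dvd r")
    case True
    then obtain m where m: "r = a * m" by blast
    then have "m \<ge> 2" using less.prems by (cases "m = 0"; cases "m = 1") auto
    then have "is_hj_expansion r a [m]" using m less.prems by (simp add: is_hj_expansion_def)
    then show ?thesis by blast
  next
    case False
    define q where "q = r div a + 1"
    define b where "b = a - r mod a"
    have mod: "0 < r mod a" "r mod a < a"
      using False less.prems by (simp_all add: dvd_eq_mod_eq_0)
    have b: "1 \<le> b" "b < a" using mod by (auto simp: b_def)
    have "r div a * a + r mod a = r" by simp
    then have "r div a * a + a = r + (a - r mod a)" using mod by linarith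
    then have qr: "q * a = r + b" by (simp add: q_def b_def)
    have q: "q \<ge> 2" using less.prems by (simp add: q_def Suc_le_eq div_greater_zero_iff)
    obtain \<alpha>s where \<alpha>s: "is_hj_expansion a b \<alpha>s" using less.IH[OF b(2) b(2) b(1)] by blast
    have "of_nat q * of_nat a = (of_nat r + of_nat b :: rat)"
      using qr by (metis of_nat_add of_nat_mult)
    then have "(of_nat q :: rat) - of_nat b / of_nat a = of_nat r / of_nat a"
      using less.prems by (simp add: field_simps)
    then have "is_hj_expansion r a (q # \<alpha>s)"
      using \<alpha>s q by (simp add: is_hj_expansion_def hj_value_Cons)
    then show ?thesis by blast
  qed
qed

lemma is_hj_expansion_hj_expansion:
  assumes "r > a" "a \<ge> 1"
  shows "is_hj_expansion r a (hj_expansion r a)"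
proof -
  have "\<exists>!\<alpha>s. is_hj_expansion r a \<alpha>s"
    using hj_expansion_exists[OF assms] hj_value_inj unfolding is_hj_expansion_def by metis
  then show ?thesis unfolding hj_expansion_def by (rule theI')
qed


section \<open>The reconstruction algebra\<close>

text \<open>For \<open>n \<ge> 2\<close>, \<open>Cw i j\<close> is \<open>c\<^sub>i\<^sub>j\<close> and \<open>Acw i j\<close> is \<open>a\<^sub>i\<^sub>j\<close>; for \<open>n = 1\<close>, \<open>Cw1 m\<close> is \<open>c\<^sub>m\<close> and
  \<open>Acw1 m\<close> is \<open>a\<^sub>m\<close> (\<open>m = 1, 2\<close>). In both cases \<open>Ext s\<close> is \<open>k\<^sub>s\<close> for \<open>1 \<le> s \<le> \<gamma>\<close>.\<close>

datatype arrow = Cw nat nat | Acw nat nat | Cw1 nat | Acw1 nat | Ext nat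

text \<open>In the following, \<open>\<alpha>s = [\<alpha>\<^sub>1, \<dots>, \<alpha>\<^sub>n]\<close>, and \<open>hj_len\<close>, \<open>hj_coef i\<close>, \<open>hj_gamma\<close> are
  \<open>n\<close>, \<open>\<alpha>\<^sub>i\<close>, \<open>\<gamma>\<close>.\<close>

context
  fixes \<alpha>s :: "nat list"
begin

definition hj_len :: nat where "hj_len = length \<alpha>s"

definition hj_coef :: "nat \<Rightarrow> nat" where "hj_coef i = \<alpha>s ! (i - 1)"

definition hj_gamma :: nat where "hj_gamma = (\<Sum>i = 1..hj_len. hj_coef i - 2)"

definition cw_next :: "nat \<Rightarrow> nat" where
  "cw_next i = (if i = 0 then hj_len else i - 1)"

definition acw_next :: "nat \<Rightarrow> nat" where
  "acw_next i = (if i = hj_len then 0 else i + 1)"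

definition ext_tails :: "nat list" where
  "ext_tails = concat (map (\<lambda>i. replicate (hj_coef i - 2) i) [1..<Suc hj_len])"

fun arrow_tail :: "arrow \<Rightarrow> nat" where
  "arrow_tail (Cw i j) = i"
| "arrow_tail (Acw i j) = i"
| "arrow_tail (Cw1 m) = 1"
| "arrow_tail (Acw1 m) = 0"
| "arrow_tail (Ext s) = ext_tails ! (s - 1)"

fun arrow_head :: "arrow \<Rightarrow> nat" where
  "arrow_head (Cw i j) = j"
| "arrow_head (Acw i j) = j"
| "arrow_head (Cw1 m) = 0"
| "arrow_head (Acw1 m) = 1"
| "arrow_head (Ext s) = 0"

definition recon_quiver :: "(nat, arrow) pre_digraph" where
  "recon_quiver =
     \<lparr>verts = {0..hj_len},
      arcs = (if hj_len = 1 then Acw1 ` {1, 2} \<union> Cw1 ` {1, 2}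
              else (\<lambda>i. Cw i (cw_next i)) ` {0..hj_len} \<union> (\<lambda>i. Acw i (acw_next i)) ` {0..hj_len})
             \<union> Ext ` {1..hj_gamma},
      tail = arrow_tail, head = arrow_head\<rparr>"

definition recon_relations_1 :: "(arrow list \<times> arrow list) set" where
  "recon_relations_1 =
     {([Cw1 2, Acw1 1], [Cw1 1, Acw1 2]), ([Acw1 1, Cw1 2], [Acw1 2, Cw1 1])} \<union>
     (if hj_coef 1 > 2
      then {([Ext 1, Acw1 1], [Cw1 2, Acw1 2]), ([Acw1 1, Ext 1], [Acw1 2, Cw1 2])} \<union>
           (\<Union>t \<in> {2..hj_coef 1 - 2}.
              {([Ext t, Acw1 1], [Ext (t - 1), Acw1 2]), ([Acw1 1, Ext t], [Acw1 2, Ext (t - 1)])})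
      else {})"

text \<open>From here on \<open>n \<ge> 2\<close> is intended. \<open>karrow s\<close> is \<open>k\<^sub>s\<close> for \<open>0 \<le> s \<le> \<gamma> + 1\<close>, where
  \<open>k\<^sub>0 = c\<^sub>1\<^sub>0\<close> and \<open>k\<^bsub>\<gamma>+1\<^esub> = a\<^sub>n\<^sub>0\<close>, and \<open>ktail s\<close> is \<open>l\<^sub>s\<close>. The index \<open>j\<close> in
  \<open>u\<^sub>i\<close>, \<open>v\<^sub>i\<close>, \<open>V\<^sub>i\<close> ranges over all of \<open>0, \<dots>, \<gamma> + 1\<close>; so \<open>u\<^sub>n = \<gamma> + 1\<close>, and \<open>V\<^sub>i = 0\<close> if there are no extra arrows at vertices below \<open>i\<close>.\<close>

definition karrow :: "nat \<Rightarrow> arrow" where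
  "karrow s = (if s = 0 then Cw 1 0 else if s = hj_gamma + 1 then Acw hj_len 0 else Ext s)"

definition ktail :: "nat \<Rightarrow> nat" where "ktail s = arrow_tail (karrow s)"

definition uidx :: "nat \<Rightarrow> nat" where "uidx i = Max {j \<in> {0..hj_gamma + 1}. ktail j = i}"

definition vidx :: "nat \<Rightarrow> nat" where "vidx i = Min {j \<in> {0..hj_gamma + 1}. ktail j = i}"

definition Vidx :: "nat \<Rightarrow> nat" where
  "Vidx i = (if i = 1 then 0 else Max {j \<in> {0..hj_gamma + 1}. ktail j < i})"

text \<open>\<open>C\<^sub>i\<^sub>j\<close> and \<open>A\<^sub>i\<^sub>j\<close>: since exactly one clockwise and one anticlockwise arrow start at each
  vertex, the shortest such path follows these arrows until \<open>j\<close> is reached for the first time.\<close>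

definition cw_path :: "nat \<Rightarrow> nat \<Rightarrow> arrow list" where
  "cw_path i j = map (\<lambda>m. Cw ((cw_next ^^ m) i) ((cw_next ^^ Suc m) i))
                     [0..<LEAST m. (cw_next ^^ m) i = j]"

definition acw_path :: "nat \<Rightarrow> nat \<Rightarrow> arrow list" where
  "acw_path i j = map (\<lambda>m. Acw ((acw_next ^^ m) i) ((acw_next ^^ Suc m) i))
                      [0..<LEAST m. (acw_next ^^ m) i = j]"

definition step_first :: "(arrow list \<times> arrow list) set" where
  "step_first =
     (if hj_coef 1 = 2 then {([Cw 1 0, Acw 0 1], [Acw 1 2, Cw 2 1])}
      else (\<Union>s \<in> {0..<uidx 1}.
              {([karrow s, Acw 0 1], [karrow (s + 1)] @ cw_path 0 1),
               ([Acw 0 1, karrow s], cw_path 0 1 @ [karrow (s + 1)])}) \<union>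
           {([karrow (uidx 1), Acw 0 1], [Acw 1 2, Cw 2 1])})"

definition step_middle :: "nat \<Rightarrow> (arrow list \<times> arrow list) set" where
  "step_middle t =
     (if hj_coef t = 2
      then {([Cw t (t - 1), Acw (t - 1) t], [Acw t (t + 1), Cw (t + 1) t])}
      else {([Cw t (t - 1), Acw (t - 1) t], [karrow (vidx t)] @ cw_path 0 t),
            (cw_path 0 t @ [karrow (vidx t)], acw_path 0 (ktail (Vidx t)) @ [karrow (Vidx t)])} \<union>
           (\<Union>s \<in> {vidx t..<uidx t}.
              {([karrow s] @ acw_path 0 t, [karrow (s + 1)] @ cw_path 0 t),
               (acw_path 0 t @ [karrow s], cw_path 0 t @ [karrow (s + 1)])}) \<union>
           {([karrow (uidx t)] @ acw_path 0 t, [Acw t (t + 1), Cw (t + 1) t])})"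

definition step_last :: "(arrow list \<times> arrow list) set" where
  "step_last =
     (let n = hj_len in
      if hj_coef n = 2
      then {([Cw n (n - 1), Acw (n - 1) n], [Acw n 0, Cw 0 n]),
            ([Cw 0 n, Acw n 0], acw_path 0 (ktail (Vidx n)) @ [karrow (Vidx n)])}
      else {([Cw n (n - 1), Acw (n - 1) n], [karrow (vidx n), Cw 0 n]),
            ([Cw 0 n, karrow (vidx n)], acw_path 0 (ktail (Vidx n)) @ [karrow (Vidx n)])} \<union>
           (\<Union>s \<in> {vidx n..<uidx n}.
              {([karrow s] @ acw_path 0 n, [karrow (s + 1), Cw 0 n]),
               (acw_path 0 n @ [karrow s], [Cw 0 n, karrow (s + 1)])}))"

definition recon_relations :: "(arrow list \<times> arrow list) set" where
  "recon_relations =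
     (if hj_len = 1 then recon_relations_1
      else step_first \<union> (\<Union>t \<in> {1<..<hj_len}. step_middle t) \<union> step_last)"

definition recon_ideal :: "(nat, arrow) path_elem set" where
  "recon_ideal = relation_ideal recon_quiver recon_relations"

end

definition reconstruction_algebra :: "nat \<Rightarrow> nat \<Rightarrow> (nat, arrow) path_elem set ring" where
  "reconstruction_algebra r a =
     path_algebra (recon_quiver (hj_expansion r a)) Quot recon_ideal (hj_expansion r a)"

lemma length_ext_tails: "length (ext_tails \<alpha>s) = hj_gamma \<alpha>s"
proof -
  have "sum_list (map (\<lambda>i. hj_coef \<alpha>s i - 2) [1..<Suc (hj_len \<alpha>s)]) = hj_gamma \<alpha>s"
    unfolding hj_gamma_def
    by (subst sum_list_distinct_conv_sum_set) (auto simp: atLeastLessThanSuc_atLeastAtMost simp del: upt_Suc)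
  then show ?thesis by (simp add: ext_tails_def length_concat comp_def del: upt_Suc)
qed

lemma set_ext_tails: "set (ext_tails \<alpha>s) = {i \<in> {1..hj_len \<alpha>s}. hj_coef \<alpha>s i > 2}"
  by (auto simp: ext_tails_def simp del: upt_Suc split: if_splits)

lemma sorted_ext_tails: "sorted (ext_tails \<alpha>s)"
proof -
  have "sorted (concat (map (\<lambda>i. replicate (f i) i) [1..<Suc m]))" for f :: "nat \<Rightarrow> nat" and m
    by (induction m) (auto simp: sorted_append split: if_splits)
  then show ?thesis unfolding ext_tails_def .
qed

lemma recon_quiver_sel [simp]:
  "verts (recon_quiver \<alpha>s) = {0..hj_len \<alpha>s}"
  "tail (recon_quiver \<alpha>s) = arrow_tail \<alpha>s" "head (recon_quiver \<alpha>s) = arrow_head"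
  by (simp_all add: recon_quiver_def)

lemma arrow_tail_Ext:
  assumes "1 \<le> s" "s \<le> hj_gamma \<alpha>s"
  shows "arrow_tail \<alpha>s (Ext s) \<in> {1..hj_len \<alpha>s}"
proof -
  have "ext_tails \<alpha>s ! (s - 1) \<in> set (ext_tails \<alpha>s)"
    using assms by (intro nth_mem) (simp add: length_ext_tails)
  then show ?thesis by (simp add: set_ext_tails)
qed

lemma fin_digraph_recon_quiver:
  assumes "\<alpha>s \<noteq> []"
  shows "fin_digraph (recon_quiver \<alpha>s)"
proof -
  have n: "1 \<le> hj_len \<alpha>s" using assms by (simp add: hj_len_def Suc_le_eq)
  show ?thesis
  proof
    fix e assume "e \<in> arcs (recon_quiver \<alpha>s)"
    then show "tail (recon_quiver \<alpha>s) e \<in> verts (recon_quiver \<alpha>s)"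
      "head (recon_quiver \<alpha>s) e \<in> verts (recon_quiver \<alpha>s)"
      using arrow_tail_Ext[of _ \<alpha>s] n
      by (auto simp: recon_quiver_def cw_next_def acw_next_def simp del: arrow_tail.simps(5)
               split: if_splits)
  qed (auto simp: recon_quiver_def)
qed

lemma ktail_range:
  assumes "s \<le> hj_gamma \<alpha>s + 1" "\<alpha>s \<noteq> []"
  shows "ktail \<alpha>s s \<in> {1..hj_len \<alpha>s}"
  using assms arrow_tail_Ext[of s \<alpha>s] 
  by (auto simp: ktail_def karrow_def hj_len_def Suc_le_eq simp del: arrow_tail.simps(5))

lemma ktail_mono:
  assumes "s \<le> t" "t \<le> hj_gamma \<alpha>s + 1" "\<alpha>s \<noteq> []"
  shows "ktail \<alpha>s s \<le> ktail \<alpha>s t"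
proof (cases "s = 0 \<or> t = hj_gamma \<alpha>s + 1")
  case True
  then show ?thesis
    using ktail_range[of s \<alpha>s] ktail_range[of t \<alpha>s] assms
    by (auto simp: ktail_def[of _ 0] ktail_def[of _ "Suc (hj_gamma _)"] karrow_def)
next
  case False
  then have "ext_tails \<alpha>s ! (s - 1) \<le> ext_tails \<alpha>s ! (t - 1)"
    using assms by (intro sorted_nth_mono sorted_ext_tails) (auto simp: length_ext_tails)
  then show ?thesis using False assms by (auto simp: ktail_def karrow_def)
qed

lemma ktail_surj:
  assumes "t \<in> {1..hj_len \<alpha>s}" "hj_coef \<alpha>s t > 2"
  shows "\<exists>j \<in> {0..hj_gamma \<alpha>s + 1}. ktail \<alpha>s j = t"
proof -
  have "t \<in> set (ext_tails \<alpha>s)" using assms by (simp add: set_ext_tails)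
  then obtain i where "i < hj_gamma \<alpha>s" "ext_tails \<alpha>s ! i = t"
    by (auto simp: in_set_conv_nth length_ext_tails)
  then show ?thesis by (intro bexI[of _ "i + 1"]) (auto simp: ktail_def karrow_def)
qed

lemma ktail_uidx_vidx:
  assumes "t \<in> {1..hj_len \<alpha>s}" "hj_coef \<alpha>s t > 2"
  shows "ktail \<alpha>s (uidx \<alpha>s t) = t" "uidx \<alpha>s t \<le> hj_gamma \<alpha>s + 1"
    "ktail \<alpha>s (vidx \<alpha>s t) = t" "vidx \<alpha>s t \<le> hj_gamma \<alpha>s + 1"
proof -
  let ?J = "{j \<in> {0..hj_gamma \<alpha>s + 1}. ktail \<alpha>s j = t}"
  have "?J \<noteq> {}" "finite ?J" using ktail_surj[OF assms] by auto
  from Max_in[OF this(2,1)] Min_in[OF this(2,1)]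
  show "ktail \<alpha>s (uidx \<alpha>s t) = t" "uidx \<alpha>s t \<le> hj_gamma \<alpha>s + 1"
    "ktail \<alpha>s (vidx \<alpha>s t) = t" "vidx \<alpha>s t \<le> hj_gamma \<alpha>s + 1"
    unfolding uidx_def vidx_def by auto
qed

lemma Vidx_le: "Vidx \<alpha>s t \<le> hj_gamma \<alpha>s + 1" if "1 < t"
proof -
  let ?J = "{j \<in> {0..hj_gamma \<alpha>s + 1}. ktail \<alpha>s j < t}"
  have "0 \<in> ?J" using that by (simp add: ktail_def karrow_def)
  then have "Max ?J \<in> ?J" by (intro Max_in) auto
  then show ?thesis using that by (auto simp: Vidx_def)
qed

context
  fixes \<alpha>s :: "nat list"
  assumes ne: "\<alpha>s \<noteq> []" and ge2: "\<forall>\<alpha> \<in> set \<alpha>s. \<alpha> \<ge> 2"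
begin

interpretation fin_digraph "recon_quiver \<alpha>s"
  by (rule fin_digraph_recon_quiver[OF ne])

lemma awalk_pair:
  assumes "awalk i [e] j" "awalk j (f # p) m"
  shows "awalk i (e # f # p) m"
  using awalk_appendI[OF assms] by simp

lemma awalk_arrow:
  assumes "e \<in> arcs (recon_quiver \<alpha>s)"
  shows "awalk (arrow_tail \<alpha>s e) [e] (arrow_head e)"
  using assms tail_in_verts[OF assms] by (simp add: awalk_def)

context
  assumes n: "hj_len \<alpha>s \<noteq> 1"
begin

lemma awalk_cw: "i \<le> hj_len \<alpha>s \<Longrightarrow> j = cw_next \<alpha>s i \<Longrightarrow> awalk i [Cw i j] j"
  using awalk_arrow[of "Cw i j"] n by (auto simp: recon_quiver_def)

lemma awalk_acw: "i \<le> hj_len \<alpha>s \<Longrightarrow> j = acw_next \<alpha>s i \<Longrightarrow> awalk i [Acw i j] j"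
  using awalk_arrow[of "Acw i j"] n by (auto simp: recon_quiver_def)

lemma awalk_k:
  assumes "s \<le> hj_gamma \<alpha>s + 1"
  shows "awalk (ktail \<alpha>s s) [karrow \<alpha>s s] 0"
proof -
  consider "s = 0" | "s = hj_gamma \<alpha>s + 1" | "1 \<le> s" "s \<le> hj_gamma \<alpha>s"
    using assms by linarith
  then show ?thesis
  proof cases
    case 1
    then show ?thesis
      using awalk_cw[of 1 0] ne by (simp add: ktail_def karrow_def cw_next_def hj_len_def Suc_le_eq)
  next
    case 2
    then show ?thesis
      using awalk_acw[of "hj_len \<alpha>s" 0] by (simp add: ktail_def karrow_def acw_next_def)
  next
    case 3
    then have "Ext s \<in> arcs (recon_quiver \<alpha>s)" by (auto simp: recon_quiver_def)
    from awalk_arrow[OF this] show ?thesis using 3 by (simp add: ktail_def karrow_def)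
  qed
qed

lemma awalk_cw_iter:
  assumes "i \<le> hj_len \<alpha>s"
  shows "awalk i (map (\<lambda>m. Cw ((cw_next \<alpha>s ^^ m) i) ((cw_next \<alpha>s ^^ Suc m) i)) [0..<L])
           ((cw_next \<alpha>s ^^ L) i) \<and> (cw_next \<alpha>s ^^ L) i \<le> hj_len \<alpha>s"
proof (induction L)
  case 0
  then show ?case using assms by (simp add: awalk_Nil_iff)
next
  case (Suc L)
  let ?x = "(cw_next \<alpha>s ^^ L) i"
  have x: "?x \<le> hj_len \<alpha>s" using Suc by blast
  then have "cw_next \<alpha>s ?x \<le> hj_len \<alpha>s" 
    by (subst cw_next_def) (auto intro: order.trans[OF diff_le_self])
  moreover have "awalk ?x [Cw ?x (cw_next \<alpha>s ?x)] (cw_next \<alpha>s ?x)" by (rule awalk_cw[OF x refl])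
  ultimately show ?case using awalk_appendI[of i _ ?x] Suc by (simp del: awalk_append_iff)
qed

lemma awalk_acw_iter:
  assumes "i \<le> hj_len \<alpha>s"
  shows "awalk i (map (\<lambda>m. Acw ((acw_next \<alpha>s ^^ m) i) ((acw_next \<alpha>s ^^ Suc m) i)) [0..<L])
           ((acw_next \<alpha>s ^^ L) i) \<and> (acw_next \<alpha>s ^^ L) i \<le> hj_len \<alpha>s"
proof (induction L)
  case 0
  then show ?case using assms by (simp add: awalk_Nil_iff)
next
  case (Suc L)
  let ?x = "(acw_next \<alpha>s ^^ L) i"
  have x: "?x \<le> hj_len \<alpha>s" using Suc by blast
  then have "acw_next \<alpha>s ?x \<le> hj_len \<alpha>s" by (simp add: acw_next_def)
  moreover have "awalk ?x [Acw ?x (acw_next \<alpha>s ?x)] (acw_next \<alpha>s ?x)" by (rule awalk_acw[OF x refl])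
  ultimately show ?case using awalk_appendI[of i _ ?x] Suc by (simp del: awalk_append_iff)
qed

lemma awalk_cw_path:
  assumes "1 \<le> t" "t \<le> hj_len \<alpha>s"
  shows "awalk 0 (cw_path \<alpha>s 0 t) t" "cw_path \<alpha>s 0 t \<noteq> []"
proof -
  have "(cw_next \<alpha>s ^^ Suc d) 0 = hj_len \<alpha>s - d" if "d \<le> hj_len \<alpha>s" for d
    using that by (induction d) (auto simp: cw_next_def)
  from this[of "hj_len \<alpha>s - t"] have ex: "(cw_next \<alpha>s ^^ Suc (hj_len \<alpha>s - t)) 0 = t"
    using assms by simp
  have L: "(cw_next \<alpha>s ^^ (LEAST m. (cw_next \<alpha>s ^^ m) 0 = t)) 0 = t"
    by (rule LeastI[of "\<lambda>m. (cw_next \<alpha>s ^^ m) 0 = t", OF ex])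
  show "awalk 0 (cw_path \<alpha>s 0 t) t"
    using awalk_cw_iter[of 0 "LEAST m. (cw_next \<alpha>s ^^ m) 0 = t"] L unfolding cw_path_def by simp
  show "cw_path \<alpha>s 0 t \<noteq> []"
  proof
    assume "cw_path \<alpha>s 0 t = []"
    then have "(LEAST m. (cw_next \<alpha>s ^^ m) 0 = t) = 0" by (simp add: cw_path_def)
    with L assms show False by simp
  qed
qed

lemma awalk_acw_path:
  assumes "1 \<le> t" "t \<le> hj_len \<alpha>s"
  shows "awalk 0 (acw_path \<alpha>s 0 t) t" "acw_path \<alpha>s 0 t \<noteq> []"
proof -
  have "(acw_next \<alpha>s ^^ d) 0 = d" if "d \<le> hj_len \<alpha>s" for d
    using that by (induction d) (auto simp: acw_next_def)
  from this[of t] have ex: "(acw_next \<alpha>s ^^ t) 0 = t" using assms by simp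
  have L: "(acw_next \<alpha>s ^^ (LEAST m. (acw_next \<alpha>s ^^ m) 0 = t)) 0 = t"
    by (rule LeastI[of "\<lambda>m. (acw_next \<alpha>s ^^ m) 0 = t", OF ex])
  show "awalk 0 (acw_path \<alpha>s 0 t) t"
    using awalk_acw_iter[of 0 "LEAST m. (acw_next \<alpha>s ^^ m) 0 = t"] L unfolding acw_path_def by simp
  show "acw_path \<alpha>s 0 t \<noteq> []"
  proof
    assume "acw_path \<alpha>s 0 t = []"
    then have "(LEAST m. (acw_next \<alpha>s ^^ m) 0 = t) = 0" by (simp add: acw_path_def)
    with L assms show False by simp
  qed
qed

end

definition parallel_walks :: "arrow list \<Rightarrow> arrow list \<Rightarrow> bool" where
  "parallel_walks p q \<longleftrightarrow> p \<noteq> [] \<and> q \<noteq> [] \<and> (\<exists>i j. awalk i p j \<and> awalk i q j)"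

lemma parallel_walksI:
  "awalk i p j \<Longrightarrow> awalk i q j \<Longrightarrow> p \<noteq> [] \<Longrightarrow> q \<noteq> [] \<Longrightarrow> parallel_walks p q"
  by (auto simp: parallel_walks_def)

lemma recon_relations_parallel:
  assumes "(p, q) \<in> recon_relations \<alpha>s"
  shows "parallel_walks p q"
proof (cases "hj_len \<alpha>s = 1")
  case True
  then have gam: "hj_gamma \<alpha>s = hj_coef \<alpha>s 1 - 2" by (simp add: hj_gamma_def)
  have a: "awalk 0 [Acw1 m] 1" "awalk 1 [Cw1 m] 0" if "m = 1 \<or> m = 2" for m
    using awalk_arrow[of "Acw1 m"] awalk_arrow[of "Cw1 m"] that True
    by (auto simp: recon_quiver_def)
  have e: "awalk 1 [Ext s] 0" if "1 \<le> s" "s \<le> hj_coef \<alpha>s 1 - 2" for s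
    using awalk_arrow[of "Ext s"] arrow_tail_Ext[of s \<alpha>s] that True gam
    by (auto simp: recon_quiver_def)
  note P = awalk_pair[OF a(1) a(2)] awalk_pair[OF a(2) a(1)]
    awalk_pair[OF a(1) e] awalk_pair[OF e a(1)]
  show ?thesis
    using assms True
    by (auto simp: recon_relations_def recon_relations_1_def split: if_splits
          intro!: parallel_walksI[OF P(1) P(1)] parallel_walksI[OF P(2) P(2)]
            parallel_walksI[OF P(3) P(1)] parallel_walksI[OF P(4) P(2)]
            parallel_walksI[OF P(3) P(3)] parallel_walksI[OF P(4) P(4)])
next
  case n: False
  have n2: "2 \<le> hj_len \<alpha>s" using n ne by (cases \<alpha>s; cases "tl \<alpha>s") (auto simp: hj_len_def)
  have coef: "hj_coef \<alpha>s t = 2 \<or> hj_coef \<alpha>s t > 2" if "1 \<le> t" "t \<le> hj_len \<alpha>s" for t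
    using that ge2 nth_mem[of "t - 1" \<alpha>s] by (fastforce simp: hj_coef_def hj_len_def)
  note W = awalk_cw[OF n] awalk_acw[OF n]
  have kw: "awalk t [karrow \<alpha>s s] 0" if "s \<le> hj_gamma \<alpha>s + 1" "ktail \<alpha>s s = t" for s t
    using awalk_k[OF n that(1)] that(2) by simp
  have kt: "ktail \<alpha>s s = t \<and> s \<le> hj_gamma \<alpha>s + 1"
    if "vidx \<alpha>s t \<le> s" "s \<le> uidx \<alpha>s t" "t \<in> {1..hj_len \<alpha>s}" "hj_coef \<alpha>s t > 2" for s t
    using ktail_uidx_vidx[OF that(3,4)] that(1,2)
      ktail_mono[of "vidx \<alpha>s t" s \<alpha>s] ktail_mono[of s "uidx \<alpha>s t" \<alpha>s] ne by auto
  have kt1: "ktail \<alpha>s s = 1 \<and> s \<le> hj_gamma \<alpha>s + 1"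
    if "s \<le> uidx \<alpha>s 1" "hj_coef \<alpha>s 1 > 2" for s
    using ktail_uidx_vidx[of 1 \<alpha>s] that n2
      ktail_range[of s \<alpha>s] ktail_mono[of s "uidx \<alpha>s 1" \<alpha>s] ne by auto
  have AV: "awalk 0 (acw_path \<alpha>s 0 (ktail \<alpha>s (Vidx \<alpha>s t)) @ [karrow \<alpha>s (Vidx \<alpha>s t)]) 0"
    if "1 < t" for t
    using awalk_appendI[OF awalk_acw_path(1)[OF n] awalk_k[OF n Vidx_le[OF that]]]
      ktail_range[OF Vidx_le[OF that] ne] by auto
  note C = awalk_cw_path[OF n] and A = awalk_acw_path[OF n]
  have loop: "awalk t [Cw t (t - 1), Acw (t - 1) t] t" if "1 \<le> t" "t \<le> hj_len \<alpha>s" for t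
    by (rule awalk_pair[OF W]) (use that in \<open>auto intro!: W simp: cw_next_def acw_next_def\<close>)
  have loop': "awalk t [Acw t (t + 1), Cw (t + 1) t] t" if "1 \<le> t" "t < hj_len \<alpha>s" for t
    by (rule awalk_pair[OF W(2)]) (use that in \<open>auto intro!: W simp: cw_next_def acw_next_def\<close>)
  have cn: "awalk 0 [Cw 0 (hj_len \<alpha>s)] (hj_len \<alpha>s)" by (rule W) (auto simp: cw_next_def)
  have an: "awalk (hj_len \<alpha>s) [Acw (hj_len \<alpha>s) 0] 0" by (rule W) (auto simp: acw_next_def)
  have a01: "awalk 0 [Acw 0 1] 1" by (rule W) (use n2 in \<open>auto simp: acw_next_def\<close>)
  from assms n consider "(p, q) \<in> step_first \<alpha>s"
    | t where "1 < t" "t < hj_len \<alpha>s" "(p, q) \<in> step_middle \<alpha>s t" | "(p, q) \<in> step_last \<alpha>s"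
    by (auto simp: recon_relations_def)
  then show ?thesis
  proof cases
    case 1
    show ?thesis
    proof (cases "hj_coef \<alpha>s 1 = 2")
      case True
      then show ?thesis
        using 1 loop[of 1] loop'[of 1] n2
        by (auto simp: step_first_def numeral_2_eq_2 intro!: parallel_walksI)
    next
      case False
      then have gt: "hj_coef \<alpha>s 1 > 2" using coef[of 1] n2 by auto
      note k = kt1[OF _ gt]
      have kw1: "awalk 1 [karrow \<alpha>s s] 0" if "s \<le> uidx \<alpha>s 1" for s
        using kw k[OF that] by blast
      have r1: "parallel_walks [karrow \<alpha>s s, Acw 0 1] ([karrow \<alpha>s (s + 1)] @ cw_path \<alpha>s 0 1)"
        "parallel_walks [Acw 0 1, karrow \<alpha>s s] (cw_path \<alpha>s 0 1 @ [karrow \<alpha>s (s + 1)])"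
        if "s < uidx \<alpha>s 1" for s
        using that n2
          parallel_walksI[OF awalk_pair[OF kw1 a01] awalk_appendI[OF kw1 C(1)], of s "s + 1"]
          parallel_walksI[OF awalk_pair[OF a01 kw1] awalk_appendI[OF C(1) kw1], of s "s + 1"]
        by simp_all
      have r2: "parallel_walks [karrow \<alpha>s (uidx \<alpha>s 1), Acw 0 1] [Acw 1 2, Cw 2 1]"
        using parallel_walksI[OF awalk_pair[OF kw1[OF order.refl] a01] loop'[of 1]] n2
        by (simp add: numeral_2_eq_2)
      show ?thesis using 1 False r1 r2 by (auto simp: step_first_def)
    qed
  next
    case 2
    show ?thesis
    proof (cases "hj_coef \<alpha>s t = 2")
      case True
      then show ?thesis
        using 2 loop[of t] loop'[of t]
        by (auto simp: step_middle_def intro!: parallel_walksI)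
    next
      case False
      then have gt: "hj_coef \<alpha>s t > 2" using coef[of t] 2 by auto
      note uv = ktail_uidx_vidx[OF _ gt]
      have t: "t \<in> {1..hj_len \<alpha>s}" using 2 by simp
      have kwt: "awalk t [karrow \<alpha>s s] 0" if "vidx \<alpha>s t \<le> s" "s \<le> uidx \<alpha>s t" for s
        using kw kt[OF that t gt] by blast
      have kwv: "awalk t [karrow \<alpha>s (vidx \<alpha>s t)] 0" "awalk t [karrow \<alpha>s (uidx \<alpha>s t)] 0"
        using kw uv[OF t] by blast+
      have r1: "parallel_walks ([karrow \<alpha>s s] @ acw_path \<alpha>s 0 t) ([karrow \<alpha>s (s + 1)] @ cw_path \<alpha>s 0 t)"
        "parallel_walks (acw_path \<alpha>s 0 t @ [karrow \<alpha>s s]) (cw_path \<alpha>s 0 t @ [karrow \<alpha>s (s + 1)])"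
        if "vidx \<alpha>s t \<le> s" "s < uidx \<alpha>s t" for s
        using that t
          parallel_walksI[OF awalk_appendI[OF kwt A(1)] awalk_appendI[OF kwt C(1)], of s t "s + 1"]
          parallel_walksI[OF awalk_appendI[OF A(1) kwt] awalk_appendI[OF C(1) kwt], of s "s + 1"]
        by simp_all
      have r2: "parallel_walks [Cw t (t - 1), Acw (t - 1) t] ([karrow \<alpha>s (vidx \<alpha>s t)] @ cw_path \<alpha>s 0 t)"
        using t by (intro parallel_walksI[OF loop awalk_appendI[OF kwv(1) C(1)]]) auto
      have r3: "parallel_walks (cw_path \<alpha>s 0 t @ [karrow \<alpha>s (vidx \<alpha>s t)])
          (acw_path \<alpha>s 0 (ktail \<alpha>s (Vidx \<alpha>s t)) @ [karrow \<alpha>s (Vidx \<alpha>s t)])"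
        using t 2 by (intro parallel_walksI[OF awalk_appendI[OF C(1) kwv(1)] AV]) auto
      have r4: "parallel_walks ([karrow \<alpha>s (uidx \<alpha>s t)] @ acw_path \<alpha>s 0 t) [Acw t (t + 1), Cw (t + 1) t]"
        using t 2 by (intro parallel_walksI[OF awalk_appendI[OF kwv(2) A(1)] loop']) auto
      show ?thesis using 2(3) False r1 r2 r3 r4 by (auto simp: step_middle_def)
    qed
  next
    case 3
    let ?n = "hj_len \<alpha>s"
    show ?thesis
    proof (cases "hj_coef \<alpha>s ?n = 2")
      case True
      then show ?thesis
        using 3 n2 parallel_walksI[OF loop[of ?n] awalk_pair[OF an cn]]
          parallel_walksI[OF awalk_pair[OF cn an] AV[of ?n]]
        by (auto simp: step_last_def Let_def)
    next
      case False
      then have gt: "hj_coef \<alpha>s ?n > 2" using coef[of ?n] n2 by auto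
      note uv = ktail_uidx_vidx[OF _ gt]
      have t: "?n \<in> {1..hj_len \<alpha>s}" using n2 by simp
      have kwt: "awalk ?n [karrow \<alpha>s s] 0" if "vidx \<alpha>s ?n \<le> s" "s \<le> uidx \<alpha>s ?n" for s
        using kw kt[OF that t gt] by blast
      have kwv: "awalk ?n [karrow \<alpha>s (vidx \<alpha>s ?n)] 0"
        using kw uv[OF t] by blast
      have r1: "parallel_walks ([karrow \<alpha>s s] @ acw_path \<alpha>s 0 ?n) [karrow \<alpha>s (s + 1), Cw 0 ?n]"
        "parallel_walks (acw_path \<alpha>s 0 ?n @ [karrow \<alpha>s s]) [Cw 0 ?n, karrow \<alpha>s (s + 1)]"
        if "vidx \<alpha>s ?n \<le> s" "s < uidx \<alpha>s ?n" for s
        using that t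
          parallel_walksI[OF awalk_appendI[OF kwt A(1)] awalk_pair[OF kwt cn], of s "s + 1"]
          parallel_walksI[OF awalk_appendI[OF A(1) kwt] awalk_pair[OF cn kwt], of s "s + 1"]
        by simp_all
      show ?thesis
        using 3 False r1 n2 parallel_walksI[OF loop[of ?n] awalk_pair[OF kwv cn]]
          parallel_walksI[OF awalk_pair[OF cn kwv] AV[of ?n]]
        by (auto simp: step_last_def Let_def)
    qed
  qed
qed

lemma path_of_closed:
  assumes "awalk i p j" "p \<noteq> []"
  shows "path_of (recon_quiver \<alpha>s) p \<in> carrier (path_algebra (recon_quiver \<alpha>s))"
proof -
  have *: "tail (recon_quiver \<alpha>s) (hd p') = i' \<and> head (recon_quiver \<alpha>s) (last p') = j'"
    if "cas i' p' j'" "p' \<noteq> []" for i' p' j'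
    using that
  proof (induction p' arbitrary: i')
    case (Cons e p')
    then show ?case by (cases p') auto
  qed simp
  from *[of i p j] assms show ?thesis
    by (auto simp: path_of_def path_algebra_def paths_def awalk_def)
qed

lemma ideal_recon_ideal: "ideal (recon_ideal \<alpha>s) (path_algebra (recon_quiver \<alpha>s))"
proof -
  interpret R: ring "path_algebra (recon_quiver \<alpha>s)" by (rule ring_path_algebra)
  have "{path_of (recon_quiver \<alpha>s) p - path_of (recon_quiver \<alpha>s) q | p q.
          (p, q) \<in> recon_relations \<alpha>s} \<subseteq> carrier (path_algebra (recon_quiver \<alpha>s))"
  proof safe
    fix p q assume "(p, q) \<in> recon_relations \<alpha>s"
    then have "path_of (recon_quiver \<alpha>s) p \<in> carrier (path_algebra (recon_quiver \<alpha>s))"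
      "path_of (recon_quiver \<alpha>s) q \<in> carrier (path_algebra (recon_quiver \<alpha>s))"
      using recon_relations_parallel path_of_closed unfolding parallel_walks_def by metis+
    then show "path_of (recon_quiver \<alpha>s) p - path_of (recon_quiver \<alpha>s) q
        \<in> carrier (path_algebra (recon_quiver \<alpha>s))"
      by (auto simp: path_algebra_def dest!: subsetD[OF keys_diff])
  qed
  then show ?thesis
    unfolding recon_ideal_def relation_ideal_def by (rule R.genideal_ideal)
qed

end

lemma ring_reconstruction_algebra:
  assumes "r > a" "a \<ge> 1"
  shows "ring (reconstruction_algebra r a)"
  using is_hj_expansion_hj_expansion[OF assms] ideal.quotient_is_ring[OF ideal_recon_ideal]
  unfolding reconstruction_algebra_def is_hj_expansion_def by blast

text \<open>The structure map \<open>\<complex> \<rightarrow> A\<^sub>r\<^sub>,\<^sub>a\<close>, \<open>c \<mapsto> c\<cdot>1\<close>.\<close>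

definition recon_scalar :: "nat \<Rightarrow> nat \<Rightarrow> complex \<Rightarrow> (nat, arrow) path_elem set" where
  "recon_scalar r a c =
     recon_ideal (hj_expansion r a)
       +>\<^bsub>path_algebra (recon_quiver (hj_expansion r a))\<^esub>
     path_scalar (recon_quiver (hj_expansion r a)) c"


section \<open>Invariants of cyclic quotient singularities\<close>

definition primitive_root_of_unity :: "nat \<Rightarrow> complex \<Rightarrow> bool" where
  "primitive_root_of_unity r \<epsilon> \<longleftrightarrow> r > 0 \<and> \<epsilon> ^ r = 1 \<and> (\<forall>m. 0 < m \<and> m < r \<longrightarrow> \<epsilon> ^ m \<noteq> 1)"

definition GL2 :: "complex mat monoid" where
  "GL2 = units_of (ring_mat TYPE(complex) 2 ())"

text \<open>The group \<open>1/r(1,a)\<close>; \<open>r\<close> is determined by \<open>\<epsilon>\<close>.\<close>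

definition group_1ra :: "complex \<Rightarrow> nat \<Rightarrow> complex mat set" where
  "group_1ra \<epsilon> a = generate GL2 {mat_of_rows_list 2 [[\<epsilon>, 0], [0, \<epsilon> ^ a]]}"

text \<open>\<open>\<complex>[x,y]\<close> is \<^typ>\<open>complex poly poly\<close>, with \<open>x\<close> the inner and \<open>y\<close> the outer variable.\<close>

definition polyX :: "complex poly poly" where "polyX = [:[:0, 1:]:]"

definition polyY :: "complex poly poly" where "polyY = [:0, 1:]"

definition polyC :: "complex \<Rightarrow> complex poly poly" where "polyC c = [:[:c:]:]"

definition poly_subst ::
    "complex poly poly \<Rightarrow> complex poly poly \<Rightarrow> complex poly poly \<Rightarrow> complex poly poly" where
  "poly_subst f g h = poly (map_poly (\<lambda>p. poly (map_poly polyC p) g) f) h"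

text \<open>\<open>M\<close> acts by algebra automorphisms, and linearly on the span of \<open>x, y\<close> with matrix \<open>M\<close>
  with respect to this basis; so \<open>diag(\<lambda>,\<mu>)\<close> maps \<open>x\<close> to \<open>\<lambda>x\<close> and \<open>y\<close> to \<open>\<mu>y\<close>.\<close>

definition mat_act :: "complex mat \<Rightarrow> complex poly poly \<Rightarrow> complex poly poly" where
  "mat_act M f =
     poly_subst f (polyC (M $$ (0, 0)) * polyX + polyC (M $$ (1, 0)) * polyY)
                  (polyC (M $$ (0, 1)) * polyX + polyC (M $$ (1, 1)) * polyY)"

definition invariant_ring :: "complex mat set \<Rightarrow> complex poly poly ring" where
  "invariant_ring G = ring_of_type_algebra\<lparr>carrier := {f. \<forall>M \<in> G. mat_act M f = f}\<rparr>"

end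

theory Submission
  imports
    Defs
    "HOL-Combinatorics.Permutations"
    "HOL-Library.Product_Lexorder"
begin

text \<open>All relations identify two paths, and they are homogeneous if every arrow is given the degree
  of the monomial \<open>x\<^sup>p y\<^sup>q\<close> by which it acts between the special Cohen--Macaulay modules. It is
  therefore enough to understand which degrees occur for paths \<open>i \<rightarrow> j\<close>, and to see that paths with
  equal ends and equal degree are congruent. If the arrows out of a vertex are ordered by their
  degrees, the relations join consecutive ones at the least common multiple of their degrees. A
  lattice argument with the bases given by the \<open>i\<close>- and \<open>j\<close>-series shows that no admissible degree
  lies strictly below such a corner. This yields, by induction on the degree, that every admissible
  degree is the degree of a path, and that any two paths of the same degree are connected by
  relations, by comparing their first arrows.

  So the algebra is the ring of matrices over \<open>\<complex>[x,y]\<close> whose entries are spanned by admissible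
  monomials. Its centre consists of the invariant scalar matrices. A Buchberger argument over
  \<open>\<complex>[x\<^sup>r,y\<^sup>r]\<close> shows that every submodule over the centre is finitely generated, which gives both
  finiteness and the noetherian property. A ring generated by \<open>m\<close> elements over its centre satisfies
  the standard identity of degree \<open>m + 1\<close>.\<close>

section \<open>Rings that are finite over their centre\<close>

text \<open>The hard half is that the relations suffice. Comparing first arrows reduces this to two
  arrows out of one vertex whose degrees both divide an admissible monomial; relations joining them
  must divide it as well. At a vertex \<open>t \<ge> 1\<close> this is automatic, since neighbouring
  arrows are joined at the least common multiple of their degrees; there the lattice argument only
  produces a first arrow. Vertex 0 is different: its two arrows have degrees \<open>x\<close> and
  \<open>y\<close>, but \<open>xy\<close> is in general not admissible, and the relations sit at
  those generators of the invariant ring that are divisible by \<open>xy\<close>. That every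
  admissible monomial divisible by \<open>xy\<close> is divisible by one of them is the arithmetic
  fact special to this vertex. These generators have the degrees of the corners at the other
  vertices, so the same boxes without lattice points settle both questions. The vertices carry the
  characters \<open>I t\<close>, which decrease from \<open>r\<close> to 1 and are distinct modulo
  \<open>r\<close>.\<close>

lemma (in ring) finsum_signed_involution:
  assumes "finite P" "inj_on g P" "g ` P \<inter> P = {}"
    and "F \<in> P \<union> g ` P \<rightarrow> carrier R" "\<And>p. p \<in> P \<Longrightarrow> F (g p) = \<ominus> F p"
  shows "finsum R F (P \<union> g ` P) = \<zero>"
proof -
  have "finsum R F (P \<union> g ` P) = finsum R F P \<oplus> finsum R F (g ` P)"
    using assms by (intro finsum_Un_disjoint) auto
  also have "finsum R F (g ` P) = (\<Oplus>p\<in>P. F (g p))"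
    using assms by (intro finsum_reindex) auto
  also have "finsum R F P \<oplus> (\<Oplus>p\<in>P. F (g p)) = (\<Oplus>p\<in>P. F p \<oplus> F (g p))"
    using assms by (intro finsum_addf[symmetric]) auto
  also have "\<dots> = (\<Oplus>p\<in>P. \<zero>)"
    using assms by (intro finsum_cong') (auto simp: r_neg Pi_iff)
  finally show ?thesis by simp
qed

section \<open>The standard polynomial as an identity\<close>

definition std_poly :: "nat \<Rightarrow> nc_poly" where
  "std_poly m = (\<Sum>\<pi> | \<pi> permutes {..<m}. Poly_Mapping.single (map \<pi> [0..<m]) (sign \<pi>))"

lemma inj_on_permutes_word: "inj_on (\<lambda>\<pi>. map \<pi> [0..<m]) {\<pi>. \<pi> permutes {..<m::nat}}"
proof (rule inj_onI, rule ext)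
  fix \<pi> \<rho> i
  assume *: "\<pi> \<in> {\<pi>. \<pi> permutes {..<m}}" "\<rho> \<in> {\<pi>. \<pi> permutes {..<m}}"
    "map \<pi> [0..<m] = map \<rho> [0..<m]"
  show "\<pi> i = \<rho> i"
  proof (cases "i < m")
    case True
    then show ?thesis using *(3) by (auto simp: list_eq_iff_nth_eq)
  qed (use * in \<open>auto simp: permutes_def\<close>)
qed

lemma lookup_std_poly:
  assumes "\<pi> permutes {..<m}"
  shows "Poly_Mapping.lookup (std_poly m) (map \<pi> [0..<m]) = sign \<pi>"
proof -
  have "Poly_Mapping.lookup (std_poly m) (map \<pi> [0..<m]) =
      (\<Sum>\<rho> | \<rho> permutes {..<m}. if \<rho> = \<pi> then sign \<rho> else 0)"
    unfolding std_poly_def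
    by (simp add: lookup_sum, intro sum.cong refl)
       (use inj_onD[OF inj_on_permutes_word] assms in \<open>auto simp: lookup_single when_def\<close>)
  then show ?thesis using assms by (simp add: finite_permutations)
qed

lemma keys_std_poly:
  "Poly_Mapping.keys (std_poly m) = (\<lambda>\<pi>. map \<pi> [0..<m]) ` {\<pi>. \<pi> permutes {..<m}}"
proof
  show "Poly_Mapping.keys (std_poly m) \<subseteq> (\<lambda>\<pi>. map \<pi> [0..<m]) ` {\<pi>. \<pi> permutes {..<m}}"
    unfolding std_poly_def by (rule order.trans[OF keys_sum]) (auto split: if_splits)
  show "(\<lambda>\<pi>. map \<pi> [0..<m]) ` {\<pi>. \<pi> permutes {..<m}} \<subseteq> Poly_Mapping.keys (std_poly m)"
    by (auto simp: in_keys_iff lookup_std_poly sign_def)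
qed

lemma nc_monic_std_poly: "nc_monic (std_poly m)"
  unfolding nc_monic_def keys_std_poly
proof (intro bexI conjI)
  show "Poly_Mapping.lookup (std_poly m) (map id [0..<m]) = 1"
    by (subst lookup_std_poly) (auto simp: permutes_id)
qed (auto intro!: image_eqI[of _ _ id] simp: permutes_id)

context ring
begin

lemma centreD: "z \<in> centre R \<Longrightarrow> z \<in> carrier R"
  "z \<in> centre R \<Longrightarrow> x \<in> carrier R \<Longrightarrow> z \<otimes> x = x \<otimes> z"
  by (auto simp: centre_def)

lemma centre_add: "y \<in> centre R \<Longrightarrow> z \<in> centre R \<Longrightarrow> y \<oplus> z \<in> centre R"
  by (auto simp: centre_def l_distr r_distr)

lemma centre_zero: "\<zero> \<in> centre R"
  by (auto simp: centre_def)

definition word_prod :: "(nat \<Rightarrow> 'a) \<Rightarrow> nat list \<Rightarrow> 'a" where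
  "word_prod \<tau> w = foldr (\<lambda>i x. \<tau> i \<otimes> x) w \<one>"

lemma word_prod_simps [simp]:
  "word_prod \<tau> [] = \<one>" "word_prod \<tau> (i # w) = \<tau> i \<otimes> word_prod \<tau> w"
  by (simp_all add: word_prod_def)

lemma word_prod_closed [simp]: "range \<tau> \<subseteq> carrier R \<Longrightarrow> word_prod \<tau> w \<in> carrier R"
  by (induction w) auto

lemma word_prod_cong: "(\<And>i. i \<in> set w \<Longrightarrow> \<tau> i = \<upsilon> i) \<Longrightarrow> word_prod \<tau> w = word_prod \<upsilon> w"
  by (induction w) auto

lemma range_fun_upd: "range \<tau> \<subseteq> carrier R \<Longrightarrow> x \<in> carrier R \<Longrightarrow> range (\<tau>(k := x)) \<subseteq> carrier R"
  by auto

text \<open>The word has no repetitions, so the \<open>k\<close>-th argument occurs in the product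
  exactly once; this is what makes the standard polynomial multilinear.\<close>

lemma word_prod_add:
  assumes "range \<tau> \<subseteq> carrier R" "x \<in> carrier R" "y \<in> carrier R" "distinct w" "k \<in> set w"
  shows "word_prod (\<tau>(k := x \<oplus> y)) w = word_prod (\<tau>(k := x)) w \<oplus> word_prod (\<tau>(k := y)) w"
  using assms(4,5)
proof (induction w)
  case (Cons i w)
  have \<tau>: "\<tau> j \<in> carrier R" for j using assms(1) by auto
  have W: "word_prod (\<tau>(k := u)) v \<in> carrier R" if "u \<in> carrier R" for u v
    by (rule word_prod_closed[OF range_fun_upd[OF assms(1) that]])
  show ?case
  proof (cases "i = k")
    case True
    then have "word_prod (\<tau>(k := u)) w = word_prod \<tau> w" for u
      using Cons.prems by (intro word_prod_cong) auto
    then show ?thesis using True assms by (simp add: l_distr del: fun_upd_apply) (simp add: l_distr)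
  next
    case False
    then show ?thesis
      using Cons W[OF assms(2)] W[OF assms(3)] \<tau> by (simp add: r_distr del: fun_upd_apply) (simp add: r_distr)
  qed
qed simp

lemma word_prod_centre:
  assumes "range \<tau> \<subseteq> carrier R" "x \<in> carrier R" "z \<in> centre R" "distinct w" "k \<in> set w"
  shows "word_prod (\<tau>(k := z \<otimes> x)) w = z \<otimes> word_prod (\<tau>(k := x)) w"
  using assms(4,5)
proof (induction w)
  case (Cons i w)
  have \<tau>: "\<tau> j \<in> carrier R" for j using assms(1) by auto
  have z: "z \<in> carrier R" using assms by (simp add: centreD)
  have c: "word_prod (\<tau>(k := x)) w \<in> carrier R" 
    using range_fun_upd[OF assms(1,2)] by (rule word_prod_closed)
  show ?case
  proof (cases "i = k")
    case True
    then have "word_prod (\<tau>(k := u)) w = word_prod \<tau> w" for u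
      using Cons.prems by (intro word_prod_cong) auto
    then show ?thesis using True assms z by (simp add: m_assoc del: fun_upd_apply) (simp add: m_assoc)
  next
    case False
    then have "word_prod (\<tau>(k := z \<otimes> x)) (i # w) = \<tau> i \<otimes> (z \<otimes> word_prod (\<tau>(k := x)) w)"
      using Cons by (simp del: fun_upd_apply) simp
    also have "\<dots> = (z \<otimes> \<tau> i) \<otimes> word_prod (\<tau>(k := x)) w"
      using centreD(2)[OF assms(3) \<tau>] z c \<tau> by (simp add: m_assoc[symmetric])
    finally show ?thesis using z c \<tau> False by (simp add: m_assoc del: fun_upd_apply) simp
  qed
qed simp

lemma nc_eval_std_poly:
  assumes "range \<tau> \<subseteq> carrier R"
  shows "nc_eval R \<tau> (std_poly m) =
    (\<Oplus>\<pi>\<in>{\<pi>. \<pi> permutes {..<m}}. [sign \<pi>] \<cdot> word_prod \<tau> (map \<pi> [0..<m]))"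
  using assms unfolding nc_eval_def keys_std_poly word_prod_def[symmetric]
  by (subst finsum_reindex[OF _ inj_on_permutes_word])
     (auto simp: lookup_std_poly intro!: finsum_cong')

lemma std_poly_add:
  assumes "range \<tau> \<subseteq> carrier R" "x \<in> carrier R" "y \<in> carrier R" "k < m"
  shows "nc_eval R (\<tau>(k := x \<oplus> y)) (std_poly m) =
    nc_eval R (\<tau>(k := x)) (std_poly m) \<oplus> nc_eval R (\<tau>(k := y)) (std_poly m)"
proof -
  have *: "word_prod (\<tau>(k := x \<oplus> y)) (map \<pi> [0..<m]) =
      word_prod (\<tau>(k := x)) (map \<pi> [0..<m]) \<oplus> word_prod (\<tau>(k := y)) (map \<pi> [0..<m])"
    if "\<pi> permutes {..<m}" for \<pi>
    using assms permutes_image[OF that] permutes_inj_on[OF that]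
    by (intro word_prod_add) (auto simp: distinct_map atLeast0LessThan)
  have E: "nc_eval R (\<tau>(k := u)) (std_poly m) =
      (\<Oplus>\<pi>\<in>{\<pi>. \<pi> permutes {..<m}}. [sign \<pi>] \<cdot> word_prod (\<tau>(k := u)) (map \<pi> [0..<m]))"
    if "u \<in> carrier R" for u
    by (rule nc_eval_std_poly[OF range_fun_upd[OF assms(1) that]])
  have W: "word_prod (\<tau>(k := u)) w \<in> carrier R" if "u \<in> carrier R" for u w
    by (rule word_prod_closed[OF range_fun_upd[OF assms(1) that]])
  have "nc_eval R (\<tau>(k := x)) (std_poly m) \<oplus> nc_eval R (\<tau>(k := y)) (std_poly m) =
      (\<Oplus>\<pi>\<in>{\<pi>. \<pi> permutes {..<m}}. [sign \<pi>] \<cdot> word_prod (\<tau>(k := x)) (map \<pi> [0..<m]) \<oplus>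
        [sign \<pi>] \<cdot> word_prod (\<tau>(k := y)) (map \<pi> [0..<m]))"
    unfolding E[OF assms(2)] E[OF assms(3)] using W assms(2,3)
    by (intro finsum_addf[symmetric]) (auto simp del: fun_upd_apply)
  also have "\<dots> = nc_eval R (\<tau>(k := x \<oplus> y)) (std_poly m)"
    unfolding E[OF a_closed[OF assms(2,3)]]
    using W[OF assms(2)] W[OF assms(3)] assms(2,3)
    by (intro finsum_cong') (auto simp: * add.int_pow_distrib simp del: fun_upd_apply)
  finally show ?thesis ..
qed

lemma std_poly_centre:
  assumes "range \<tau> \<subseteq> carrier R" "x \<in> carrier R" "z \<in> centre R" "k < m"
  shows "nc_eval R (\<tau>(k := z \<otimes> x)) (std_poly m) = z \<otimes> nc_eval R (\<tau>(k := x)) (std_poly m)"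
proof -
  have *: "word_prod (\<tau>(k := z \<otimes> x)) (map \<pi> [0..<m]) = z \<otimes> word_prod (\<tau>(k := x)) (map \<pi> [0..<m])"
    if "\<pi> permutes {..<m}" for \<pi>
    using assms permutes_image[OF that] permutes_inj_on[OF that]
    by (intro word_prod_centre) (auto simp: distinct_map atLeast0LessThan)
  have z: "z \<in> carrier R" by (rule centreD(1)[OF assms(3)])
  have E: "nc_eval R (\<tau>(k := u)) (std_poly m) =
      (\<Oplus>\<pi>\<in>{\<pi>. \<pi> permutes {..<m}}. [sign \<pi>] \<cdot> word_prod (\<tau>(k := u)) (map \<pi> [0..<m]))"
    if "u \<in> carrier R" for u
    by (rule nc_eval_std_poly[OF range_fun_upd[OF assms(1) that]])
  have W: "word_prod (\<tau>(k := u)) w \<in> carrier R" if "u \<in> carrier R" for u w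
    by (rule word_prod_closed[OF range_fun_upd[OF assms(1) that]])
  show ?thesis
    using assms(2) z unfolding E[OF assms(2)] E[OF m_closed[OF z assms(2)]]
    by (subst finsum_rdistr)
       (auto simp: finite_permutations W * add_pow_rdistr_int simp del: fun_upd_apply
          intro!: finsum_cong')
qed

text \<open>Composing with the transposition of \<open>i\<close> and \<open>j\<close> matches even
  with odd permutations. It keeps the value of the word, because \<open>\<tau> i = \<tau> j\<close>,
  and reverses the sign, so the terms cancel in pairs.\<close>

lemma std_poly_alternating:
  assumes "range \<tau> \<subseteq> carrier R" "i < m" "j < m" "i \<noteq> j" "\<tau> i = \<tau> j"
  shows "nc_eval R \<tau> (std_poly m) = \<zero>"
proof -
  let ?P = "{\<pi>. \<pi> permutes {..<m} \<and> evenperm \<pi>}"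
  let ?t = "Transposition.transpose i j"
  have t: "?t permutes {..<m}" using assms by (intro permutes_swap_id) auto
  have perm: "permutation \<pi>" if "\<pi> permutes {..<m}" for \<pi>
    using that by (auto simp: permutation_permutes)
  have sgn: "sign (?t \<circ> \<pi>) = - sign \<pi>" if "\<pi> permutes {..<m}" for \<pi>
    using sign_compose[OF perm[OF t] perm[OF that]] sign_swap_id[of i j] assms by simp
  have UN: "{\<pi>. \<pi> permutes {..<m}} = ?P \<union> (\<lambda>\<pi>. ?t \<circ> \<pi>) ` ?P"
  proof safe
    fix \<pi> assume *: "\<pi> permutes {..<m}" "\<pi> \<notin> (\<lambda>\<pi>. ?t \<circ> \<pi>) ` ?P"
    show "evenperm \<pi>"
    proof (rule ccontr)
      assume "\<not> evenperm \<pi>"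
      then have "sign \<pi> = -1" by (simp add: sign_def)
      then have "sign (?t \<circ> \<pi>) = 1" using sgn[OF *(1)] by simp
      then have "evenperm (?t \<circ> \<pi>)" by (simp add: sign_def split: if_splits)
      moreover have "(?t \<circ> \<pi>) permutes {..<m}" using * t by (simp add: permutes_compose)
      moreover have "\<pi> = ?t \<circ> (?t \<circ> \<pi>)" by (simp add: fun_eq_iff)
      ultimately show False using *(2) by blast
    qed
  qed (use t in \<open>auto simp: permutes_compose\<close>)
  have wp: "word_prod \<tau> (map (?t \<circ> \<pi>) [0..<m]) = word_prod \<tau> (map \<pi> [0..<m])" for \<pi>
  proof -
    have "word_prod \<tau> (map ?t w) = word_prod \<tau> w" for w
      using assms by (induction w) (auto simp: Transposition.transpose_def)
    from this[of "map \<pi> [0..<m]"] show ?thesis by simp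
  qed
  have "nc_eval R \<tau> (std_poly m) =
      (\<Oplus>\<pi>\<in>?P \<union> (\<lambda>\<pi>. ?t \<circ> \<pi>) ` ?P. [sign \<pi>] \<cdot> word_prod \<tau> (map \<pi> [0..<m]))"
    unfolding UN[symmetric] by (rule nc_eval_std_poly[OF assms(1)])
  also have "\<dots> = \<zero>"
  proof (rule finsum_signed_involution)
    show "finite ?P" by (rule finite_subset[OF _ finite_permutations[of "{..<m}"]]) auto
    show "inj_on (\<lambda>\<pi>. ?t \<circ> \<pi>) ?P"
      by (rule inj_onI, rule ext) (metis comp_apply transpose_involutory)
    show "(\<lambda>\<pi>. ?t \<circ> \<pi>) ` ?P \<inter> ?P = {}"
    proof -
      have False if "\<pi> permutes {..<m}" "evenperm \<pi>" "evenperm (?t \<circ> \<pi>)" for \<pi>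
        using sgn[OF that(1)] that(2,3) by (simp add: sign_def)
      then show ?thesis by blast
    qed
    fix \<pi> assume "\<pi> \<in> ?P"
    then show "[sign (?t \<circ> \<pi>)] \<cdot> word_prod \<tau> (map (?t \<circ> \<pi>) [0..<m]) =
        \<ominus> ([sign \<pi>] \<cdot> word_prod \<tau> (map \<pi> [0..<m]))"
      using sgn assms(1) unfolding wp by (simp add: add.int_pow_neg)
  qed (use assms in auto)
  finally show ?thesis .
qed

text \<open>The arguments are replaced one at a time by members of a finite generating set \<open>S\<close>; when all
  \<open>card S + 1\<close> of them lie in \<open>S\<close>, two coincide.\<close>

lemma finite_over_centre_imp_PI_ring:
  assumes "finite_over_centre R"
  shows "PI_ring R"
proof -
  obtain S where S: "finite S" "S \<subseteq> carrier R"
    "\<And>x. x \<in> carrier R \<Longrightarrow> \<exists>z \<in> S \<rightarrow> centre R. x = (\<Oplus>s\<in>S. z s \<otimes> s)"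
    using assms unfolding finite_over_centre_def by blast
  let ?m = "Suc (card S)"
  have "nc_eval R \<tau> (std_poly ?m) = \<zero>"
    if "range \<tau> \<subseteq> carrier R" "k \<le> ?m" "\<forall>i. k \<le> i \<and> i < ?m \<longrightarrow> \<tau> i \<in> S" for \<tau> k
    using that
  proof (induction k arbitrary: \<tau>)
    case 0
    then have "\<tau> ` {..<?m} \<subseteq> S" by auto
    then have "card (\<tau> ` {..<?m}) < card {..<?m}"
      using card_mono[OF S(1)] by (simp add: le_imp_less_Suc)
    then have "\<not> inj_on \<tau> {..<?m}" by (metis card_image less_irrefl)
    then show ?case using std_poly_alternating[OF 0(1)] by (auto simp: inj_on_def)
  next
    case (Suc k)
    then have k: "k < ?m" by simp
    let ?E = "\<lambda>x. nc_eval R (\<tau>(k := x)) (std_poly ?m)"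
    have E0: "?E s = \<zero>" if "s \<in> S" for s
      using Suc.prems that S(2) by (intro Suc.IH) auto
    \<comment> \<open>Serves the empty partial sum. Writing zero as
      \<open>\<zero> \<otimes> \<zero>\<close> with a central left factor makes
      \<open>std_poly_centre\<close> applicable.\<close>
    have E_zero: "?E \<zero> = \<zero>"
    proof -
      have "nc_eval R (\<tau>(k := \<zero> \<otimes> \<zero>)) (std_poly ?m) = \<zero> \<otimes> ?E \<zero>"
        using Suc.prems k by (intro std_poly_centre) (auto simp: centre_zero)
      moreover have "?E \<zero> \<in> carrier R"
        using range_fun_upd[OF Suc.prems(1) zero_closed, of k]
        by (subst nc_eval_std_poly) (auto simp del: fun_upd_apply intro!: finsum_closed)
      ultimately show ?thesis by (simp del: fun_upd_apply)
    qed
    have sum: "?E (\<Oplus>s\<in>T. z s \<otimes> s) = \<zero>" if "T \<subseteq> S" "z \<in> S \<rightarrow> centre R" for T z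
      using finite_subset[OF that(1) S(1)] that(1)
    proof (induction T)
      case empty
      then show ?case using E_zero by (simp del: fun_upd_apply)
    next
      case (insert s T)
      have z: "z t \<in> carrier R" "z t \<in> centre R" "t \<in> carrier R" if "t \<in> S" for t
        using that \<open>z \<in> S \<rightarrow> centre R\<close> S(2) centreD(1) by auto
      have "(\<Oplus>t\<in>insert s T. z t \<otimes> t) = z s \<otimes> s \<oplus> (\<Oplus>t\<in>T. z t \<otimes> t)"
        using insert z by (intro finsum_insert) (auto intro!: m_closed)
      moreover have "(\<Oplus>t\<in>T. z t \<otimes> t) \<in> carrier R"
        using insert z by (intro finsum_closed) (auto intro!: m_closed)
      ultimately have "?E (\<Oplus>t\<in>insert s T. z t \<otimes> t) = z s \<otimes> ?E s \<oplus> ?E (\<Oplus>t\<in>T. z t \<otimes> t)"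
        using insert.prems z Suc.prems(1) k by (simp add: std_poly_add std_poly_centre del: fun_upd_apply)
      then show ?case using insert E0 z by (simp del: fun_upd_apply)
    qed
    have "\<tau> k \<in> carrier R" using Suc.prems(1) by auto
    then obtain z where z: "z \<in> S \<rightarrow> centre R" "\<tau> k = (\<Oplus>s\<in>S. z s \<otimes> s)" using S(3) by blast
    then show ?case using sum[OF order.refl z(1)] by (simp add: z(2)[symmetric] del: fun_upd_apply)
  qed
  from this[OF _ order.refl] have "nc_eval R \<tau> (std_poly ?m) = \<zero>" if "range \<tau> \<subseteq> carrier R" for \<tau>
    using that by (meson not_less)
  then show ?thesis using nc_monic_std_poly ring_axioms unfolding PI_ring_def by blast
qed

end

section \<open>Noetherian modules over the centre\<close>

lemma Dickson_nat_pairs: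
  fixes T :: "(nat \<times> nat) set"
  obtains F where "F \<subseteq> T" "finite F" "\<And>p q. (p, q) \<in> T \<Longrightarrow> \<exists>(p', q') \<in> F. p' \<le> p \<and> q' \<le> q"
proof (cases "T = {}")
  case False
  then obtain p0 q0 where 0: "(p0, q0) \<in> T" by auto
  \<comment> \<open>A pair of \<open>T\<close> that is not above \<open>(p0, q0)\<close> lies in one
    of the finitely many columns \<open>p < p0\<close> or rows \<open>q < q0\<close>; the least pair
    of each of these is added.\<close>
  define f where "f p = (p, LEAST q. (p, q) \<in> T)" for p
  define g where "g q = (LEAST p. (p, q) \<in> T, q)" for q
  let ?F = "insert (p0, q0) (f ` {p \<in> {..<p0}. \<exists>q. (p, q) \<in> T} \<union> g ` {q \<in> {..<q0}. \<exists>p. (p, q) \<in> T})"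
  show thesis
  proof (rule that[of ?F])
    show "?F \<subseteq> T" using 0 by (auto simp: f_def g_def intro: LeastI)
    show "finite ?F" by simp
    fix p q assume pq: "(p, q) \<in> T"
    consider "p0 \<le> p" "q0 \<le> q" | "p < p0" | "q < q0" by linarith
    then show "\<exists>(p', q') \<in> ?F. p' \<le> p \<and> q' \<le> q"
    proof cases
      case 2
      then show ?thesis using pq by (intro bexI[of _ "f p"]) (auto simp: f_def intro: Least_le)
    next
      case 3
      then show ?thesis using pq by (intro bexI[of _ "g q"]) (auto simp: g_def intro: Least_le)
    qed auto
  qed
qed (use that in auto)

context ring
begin

definition central_span :: "'a set \<Rightarrow> 'a set" where
  "central_span S = {x. \<exists>z \<in> S \<rightarrow> centre R. x = (\<Oplus>s\<in>S. z s \<otimes> s)}"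

text \<open>The ring is a noetherian module over its centre.\<close>

definition fg_central_submodules :: bool where
  "fg_central_submodules \<longleftrightarrow>
     (\<forall>I. additive_subgroup I R \<longrightarrow> (\<forall>z \<in> centre R. \<forall>x \<in> I. z \<otimes> x \<in> I) \<longrightarrow>
        (\<exists>S \<subseteq> I. finite S \<and> I \<subseteq> central_span S))"

lemma central_span_zero: "S \<subseteq> carrier R \<Longrightarrow> \<zero> \<in> central_span S"
  unfolding central_span_def using centre_zero
  by (auto intro!: bexI[of _ "\<lambda>_. \<zero>"] add.finprod_one_eqI[symmetric])

lemma central_span_add:
  assumes "finite S" "S \<subseteq> carrier R" "x \<in> central_span S" "y \<in> centre R" "s \<in> S"
  shows "x \<oplus> y \<otimes> s \<in> central_span S"
proof -
  obtain z where z: "z \<in> S \<rightarrow> centre R" "x = (\<Oplus>t\<in>S. z t \<otimes> t)"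
    using assms(3) unfolding central_span_def by blast
  let ?z = "z(s := z s \<oplus> y)"
  have c: "z t \<in> carrier R" "t \<in> carrier R" if "t \<in> S" for t
    using that z(1) assms(2) centreD(1) by auto
  have y: "y \<in> carrier R" using assms(4) by (rule centreD)
  have split: "(\<Oplus>t\<in>S. w t \<otimes> t) = w s \<otimes> s \<oplus> (\<Oplus>t\<in>S - {s}. w t \<otimes> t)"
    if "\<And>t. t \<in> S \<Longrightarrow> w t \<in> carrier R" for w
  proof -
    have "(\<Oplus>t\<in>insert s (S - {s}). w t \<otimes> t) = w s \<otimes> s \<oplus> (\<Oplus>t\<in>S - {s}. w t \<otimes> t)"
      using assms that c by (intro finsum_insert) auto
    then show ?thesis using assms(5) by (simp add: insert_absorb)
  qed
  have zc: "?z t \<in> carrier R" if "t \<in> S" for t using c y that assms(5) by simp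
  have rest: "(\<Oplus>t\<in>S - {s}. ?z t \<otimes> t) = (\<Oplus>t\<in>S - {s}. z t \<otimes> t)"
    using c by (intro finsum_cong') auto
  have cl: "(\<Oplus>t\<in>S - {s}. z t \<otimes> t) \<in> carrier R"
    using c by (intro finsum_closed) auto
  have "(\<Oplus>t\<in>S. ?z t \<otimes> t) = (z s \<oplus> y) \<otimes> s \<oplus> (\<Oplus>t\<in>S - {s}. z t \<otimes> t)"
    using split[of ?z, OF zc] rest by simp
  also have "\<dots> = x \<oplus> y \<otimes> s"
    using z(2) split[of z] c[OF assms(5)] c(1) y cl by (simp add: l_distr a_ac)
  finally have "x \<oplus> y \<otimes> s = (\<Oplus>t\<in>S. ?z t \<otimes> t)" by simp
  moreover have "?z \<in> S \<rightarrow> centre R" using z(1) assms(4,5) by (auto simp: Pi_iff centre_add)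
  ultimately show ?thesis unfolding central_span_def by blast
qed

lemma central_span_in_submodule:
  assumes "additive_subgroup J R" "\<And>z x. z \<in> centre R \<Longrightarrow> x \<in> J \<Longrightarrow> z \<otimes> x \<in> J"
    and "finite S" "S \<subseteq> J" "x \<in> central_span S"
  shows "x \<in> J"
proof -
  interpret J: additive_subgroup J R by fact
  obtain z where z: "z \<in> S \<rightarrow> centre R" "x = (\<Oplus>t\<in>S. z t \<otimes> t)"
    using assms(5) unfolding central_span_def by blast
  have "(\<Oplus>t\<in>T. z t \<otimes> t) \<in> J" if "T \<subseteq> S" for T
    using finite_subset[OF that assms(3)] that
  proof (induction T)
    case (insert t T)
    have mem: "z u \<otimes> u \<in> J" if "u \<in> S" for u using that z(1) assms(2,4) by auto
    have "(\<Oplus>u\<in>insert t T. z u \<otimes> u) = z t \<otimes> t \<oplus> (\<Oplus>u\<in>T. z u \<otimes> u)"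
      using insert J.a_Hcarr[OF mem] by (intro finsum_insert) auto
    then show ?case using insert mem by simp
  qed simp
  then show ?thesis using z(2) by simp
qed

lemma fg_central_submodules_imp_finite_over_centre:
  assumes fg_central_submodules
  shows "finite_over_centre R"
proof -
  have "additive_subgroup (carrier R) R"
    by (intro additive_subgroupI add.subgroup_self)
  then obtain S where "S \<subseteq> carrier R" "finite S" "carrier R \<subseteq> central_span S"
    using assms unfolding fg_central_submodules_def by (meson m_closed centreD(1))
  then show ?thesis unfolding finite_over_centre_def central_span_def by blast
qed

text \<open>One-sided ideals are stable under the centre, right ideals because central elements can
  be moved to the other side. So finitely many generators over the centre also generate the
  ideal.\<close>

lemma fg_central_submodules_imp_noetherian:
  assumes fg_central_submodules
  shows "noetherian R"
proof -
  have *: "\<exists>S \<subseteq> carrier R. finite S \<and> I = \<Inter>{J. P J \<and> S \<subseteq> J}"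
    if "P I" and P: "\<And>J. P J \<Longrightarrow> additive_subgroup J R"
      "\<And>J z x. P J \<Longrightarrow> z \<in> centre R \<Longrightarrow> x \<in> J \<Longrightarrow> z \<otimes> x \<in> J" for P I
  proof -
    obtain S where S: "S \<subseteq> I" "finite S" "I \<subseteq> central_span S"
      using assms P[OF \<open>P I\<close>] unfolding fg_central_submodules_def by blast
    have "I \<subseteq> J" if "P J" "S \<subseteq> J" for J
      using central_span_in_submodule[OF P[OF that(1)] S(2) that(2)] S(3) by blast
    then show ?thesis
      using S \<open>P I\<close> additive_subgroup.a_subset[OF P(1)[OF \<open>P I\<close>]] by (intro exI[of _ S]) blast
  qed
  have "\<exists>S \<subseteq> carrier R. finite S \<and> I = \<Inter>{J. left_ideal J R \<and> S \<subseteq> J}"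
    if "left_ideal I R" for I
    by (rule *[of "\<lambda>J. left_ideal J R", OF that]) (auto simp: left_ideal_def centreD(1))
  then have "left_noetherian R"
    unfolding left_noetherian_def using ring_axioms by blast
  moreover have "\<exists>S \<subseteq> carrier R. finite S \<and> I = \<Inter>{J. right_ideal J R \<and> S \<subseteq> J}"
    if "right_ideal I R" for I
  proof (rule *[of "\<lambda>J. right_ideal J R", OF that])
    fix J z x assume "right_ideal J R" "z \<in> centre R" "x \<in> J"
    then show "z \<otimes> x \<in> J"
      using centreD(1)[of z] centreD(2)[of z x]
      by (auto simp: right_ideal_def dest: additive_subgroup.a_Hcarr)
  qed (auto simp: right_ideal_def)
  then have "right_noetherian R"
    unfolding right_noetherian_def using ring_axioms by blast
  ultimately show ?thesis unfolding noetherian_def by simp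
qed

text \<open>The Buchberger argument: leading exponents with respect to the lexicographic order, Dickson's
  lemma, and reduction. The central elements act on exponents by translation by multiples of \<open>r\<close>,
  so there are finitely many classes of exponents modulo this action.\<close>

lemma fg_central_submodulesI:
  fixes \<psi> :: "'a \<Rightarrow> nat \<times> nat \<times> nat \<times> nat \<Rightarrow> 'k :: field"
  assumes add: "\<And>x y k. x \<in> carrier R \<Longrightarrow> y \<in> carrier R \<Longrightarrow> \<psi> (x \<oplus> y) k = \<psi> x k + \<psi> y k"
    and inj: "\<And>x. x \<in> carrier R \<Longrightarrow> (\<And>k. \<psi> x k = 0) \<Longrightarrow> x = \<zero>"
    and fin: "\<And>x. x \<in> carrier R \<Longrightarrow> finite {k. \<psi> x k \<noteq> 0}"
    and bound: "\<And>x p q i j. x \<in> carrier R \<Longrightarrow> \<psi> x (p, q, i, j) \<noteq> 0 \<Longrightarrow> i < N \<and> j < N"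
    and "r > 0"
    and act: "\<And>c k l. \<exists>z \<in> centre R. \<forall>x \<in> carrier R. \<forall>p q i j. \<psi> (z \<otimes> x) (p, q, i, j) =
        (if r * k \<le> p \<and> r * l \<le> q then c * \<psi> x (p - r * k, q - r * l, i, j) else 0)"
  shows fg_central_submodules
  unfolding fg_central_submodules_def
proof (intro allI impI)
  fix I assume sub: "additive_subgroup I R" and cen: "\<forall>z \<in> centre R. \<forall>x \<in> I. z \<otimes> x \<in> I"
  interpret I: additive_subgroup I R by fact
  note Icar = I.a_Hcarr
  \<comment> \<open>The order compares the exponents first; the matrix position
    \<open>(i, j)\<close> only breaks ties.\<close>
  define lm where "lm x = Max {k. \<psi> x k \<noteq> 0}" for x
  have lm: "\<psi> x (lm x) \<noteq> 0" "\<And>k. lm x < k \<Longrightarrow> \<psi> x k = 0" if "x \<in> I" "x \<noteq> \<zero>" for x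
  proof -
    have ne: "{k. \<psi> x k \<noteq> 0} \<noteq> {}" using inj[OF Icar] that by blast
    show "\<psi> x (lm x) \<noteq> 0" using Max_in[OF fin[OF Icar[OF that(1)]] ne] unfolding lm_def by simp
    show "\<psi> x k = 0" if "lm x < k" for k
      using Max_ge[OF fin[OF Icar[OF \<open>x \<in> I\<close>]], of k] that unfolding lm_def by (auto simp: not_le[symmetric])
  qed
  define T where "T = {lm x | x. x \<in> I \<and> x \<noteq> \<zero>}"
  \<comment> \<open>The leading exponents in one class modulo central translations, measured in
    steps of \<open>r\<close>, so that Dickson's lemma for pairs applies.\<close>
  define T' where "T' = (\<lambda>(a, b, i, j). {(k, l). (a + r * k, b + r * l, i, j) \<in> T})"
  have "\<exists>F. F \<subseteq> T' \<kappa> \<and> finite F \<and> (\<forall>p q. (p, q) \<in> T' \<kappa> \<longrightarrow> (\<exists>(p', q') \<in> F. p' \<le> p \<and> q' \<le> q))" for \<kappa>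
    by (rule Dickson_nat_pairs[of "T' \<kappa>"]) blast
  then obtain F' where F': "\<And>\<kappa>. F' \<kappa> \<subseteq> T' \<kappa>" "\<And>\<kappa>. finite (F' \<kappa>)"
    "\<And>\<kappa> p q. (p, q) \<in> T' \<kappa> \<Longrightarrow> \<exists>(p', q') \<in> F' \<kappa>. p' \<le> p \<and> q' \<le> q"
    by metis
  define F where "F = (\<Union>(a, b, i, j) \<in> {..<r} \<times> {..<r} \<times> {..<N} \<times> {..<N}.
      (\<lambda>(k, l). (a + r * k, b + r * l, i, j)) ` F' (a, b, i, j))"
  have finF: "finite F" unfolding F_def using F'(2) by auto
  have "F \<subseteq> T" unfolding F_def using F'(1) by (fastforce simp: T'_def)
  then have "\<forall>f \<in> F. \<exists>x. x \<in> I \<and> x \<noteq> \<zero> \<and> lm x = f" unfolding T_def by blast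
  then obtain g where g: "\<And>f. f \<in> F \<Longrightarrow> g f \<in> I \<and> g f \<noteq> \<zero> \<and> lm (g f) = f" by metis
  let ?S = "g ` F"
  have S: "finite ?S" "?S \<subseteq> I" "?S \<subseteq> carrier R" using finF g Icar by auto
  have "x \<in> central_span ?S" if "x \<in> I" "x \<noteq> \<zero>" "lm x = t" for x t
    using that
  proof (induction t arbitrary: x rule: less_induct)
    case (less t)
    obtain p q i j where t: "t = (p, q, i, j)" by (cases t) auto
    have ij: "i < N" "j < N" using bound[OF Icar[OF less.prems(1)], of p q i j] lm(1)[OF less.prems(1,2)] less.prems(3) t by auto
    let ?\<kappa> = "(p mod r, q mod r, i, j)"
    have "(p div r, q div r) \<in> T' ?\<kappa>" using less.prems t by (force simp: T'_def T_def)
    then obtain k' l' where kl: "(k', l') \<in> F' ?\<kappa>" "k' \<le> p div r" "l' \<le> q div r"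
      using F'(3) by blast
    obtain p0 q0 k l where pq: "p = p0 + r * k" "q = q0 + r * l" and f: "(p0, q0, i, j) \<in> F"
    proof
      show "p = (p mod r + r * k') + r * (p div r - k')" "q = (q mod r + r * l') + r * (q div r - l')"
        using mod_mult_div_eq[of p r] mod_mult_div_eq[of q r] kl(2,3)
        by (simp_all only: add.assoc add_mult_distrib2[symmetric] le_add_diff_inverse)
      show "(p mod r + r * k', q mod r + r * l', i, j) \<in> F"
        unfolding F_def using kl(1) ij \<open>r > 0\<close> by (intro UN_I[of ?\<kappa>]) auto
    qed
    define f where "f = (p0, q0, i, j)"
    note f = f[folded f_def]
    \<comment> \<open>Chosen so that adding \<open>z \<otimes> g f\<close> cancels the leading
      coefficient of \<open>x\<close>.\<close>
    define c where "c = - \<psi> x t / \<psi> (g f) f"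
    obtain z where z: "z \<in> centre R" "\<And>x p q i j. x \<in> carrier R \<Longrightarrow> \<psi> (z \<otimes> x) (p, q, i, j) =
        (if r * k \<le> p \<and> r * l \<le> q then c * \<psi> x (p - r * k, q - r * l, i, j) else 0)"
      using act[of k l c] by blast
    have zc: "z \<in> carrier R" by (rule centreD(1)[OF z(1)])
    have gf: "g f \<in> I" "g f \<noteq> \<zero>" "lm (g f) = f" "g f \<in> carrier R" using g[OF f] Icar by auto
    define x' where "x' = x \<oplus> z \<otimes> g f"
    have x: "x \<in> carrier R" "z \<otimes> g f \<in> carrier R" using less.prems Icar zc gf by auto
    have x': "x' \<in> I" unfolding x'_def using less.prems(1) cen z(1) gf(1) by simp
    \<comment> \<open>Translation preserves the lexicographic order, so the added multiple has no
      exponent above \<open>t\<close>.\<close>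
    have high: "\<psi> x' u = 0" if "t \<le> u" for u
    proof (cases "u = t")
      case True
      have "\<psi> (z \<otimes> g f) t = c * \<psi> (g f) f"
        using z(2)[OF gf(4)] by (simp add: t f_def pq)
      moreover have "\<psi> (g f) f \<noteq> 0" using lm(1)[OF gf(1,2)] gf(3) by simp
      ultimately show ?thesis using True x unfolding x'_def by (simp add: add c_def)
    next
      case False
      then have tu: "t < u" using that by simp
      then have 1: "\<psi> x u = 0" using lm(2)[OF less.prems(1,2)] less.prems(3) by simp
      obtain p' q' i' j' where u: "u = (p', q', i', j')" by (cases u) auto
      have "\<psi> (z \<otimes> g f) u = 0"
      proof (cases "r * k \<le> p' \<and> r * l \<le> q'")
        case True
        have "f < (p' - r * k, q' - r * l, i', j')"
          using tu True unfolding u t f_def pq by auto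
        then have "\<psi> (g f) (p' - r * k, q' - r * l, i', j') = 0"
          using lm(2)[OF gf(1,2)] gf(3) by simp
        then show ?thesis unfolding u z(2)[OF gf(4)] by simp
      next
        case False
        then show ?thesis unfolding u z(2)[OF gf(4)] by auto
      qed
      then show ?thesis using 1 x unfolding x'_def by (simp add: add)
    qed
    have "x' \<in> central_span ?S"
    proof (cases "x' = \<zero>")
      case False
      have "lm x' < t" using high lm(1)[OF x' False] by (meson not_le)
      then show ?thesis using less.IH x' False by blast
    qed (use central_span_zero[OF S(3)] in simp)
    moreover have "\<ominus> z \<in> centre R" using z(1) by (auto simp: centre_def l_minus r_minus)
    ultimately have "x' \<oplus> (\<ominus> z) \<otimes> g f \<in> central_span ?S"
      using f S by (intro central_span_add) auto
    moreover have "x' \<oplus> (\<ominus> z) \<otimes> g f = x"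
      unfolding x'_def using x zc gf(4) by (simp add: l_minus a_assoc r_neg)
    ultimately show ?case by simp
  qed
  then have "I \<subseteq> central_span ?S" using central_span_zero[OF S(3)] by blast
  then show "\<exists>S\<subseteq>I. finite S \<and> I \<subseteq> central_span S" using S by blast
qed

end

section \<open>The \<open>i\<close>-series and the \<open>j\<close>-series\<close>

text \<open>If \<open>m \<le> 0\<close>, positivity of \<open>P\<close> forces
  \<open>m + m' \<ge> 1\<close>, and then \<open>Q \<ge> (m + m') * y2 \<ge> y2\<close>. If
  \<open>m > 0\<close> and \<open>m' < 0\<close>, nonnegativity of \<open>Q\<close> forces the same,
  and \<open>P \<ge> (m + m') * x1 \<ge> x1\<close>. If \<open>m > 0\<close> and
  \<open>m' \<ge> 0\<close>, the bound on \<open>P\<close> is immediate.\<close>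

lemma lattice_corner_bound:
  fixes P Q x1 x2 y1 y2 m m' :: int
  assumes "x2 < x1" "0 \<le> x2" "y1 < y2" "0 < y2"
    and P: "P = m * x1 + m' * x2" "0 < P" and Q: "Q = m * y1 + m' * y2" "0 \<le> Q"
  shows "x1 \<le> P \<or> y2 \<le> Q"
proof (cases "m \<le> 0")
  case True
  have "0 < m'"
  proof (rule ccontr)
    assume "\<not> 0 < m'"
    then have "m * x1 \<le> 0" "m' * x2 \<le> 0" using True assms by (simp_all add: mult_nonpos_nonneg)
    then show False using P by linarith
  qed
  have "- m < m'"
  proof (rule ccontr)
    assume "\<not> - m < m'"
    then have "m' * x2 \<le> (- m) * x2" using assms by (intro mult_right_mono) auto
    also have "\<dots> \<le> (- m) * x1" using True assms by (intro mult_left_mono) auto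
    finally show False using P by simp
  qed
  then have "(- m + 1) * y2 \<le> m' * y2" using assms by (intro mult_right_mono) auto
  moreover have "m * y2 \<le> m * y1" using True assms by (intro mult_left_mono_neg) auto
  ultimately show ?thesis using Q by (simp add: algebra_simps)
next
  case False
  show ?thesis
  proof (cases "0 \<le> m'")
    case True
    then have "0 \<le> m' * x2" "1 * x1 \<le> m * x1"
      using False assms by (auto intro!: mult_right_mono)
    then show ?thesis using P by linarith
  next
    case m': False
    have "- m' < m"
    proof (rule ccontr)
      assume "\<not> - m' < m"
      then have "m * y2 \<le> (- m') * y2" using assms by (intro mult_right_mono) auto
      moreover have "m * y1 < m * y2" using False assms by (intro mult_strict_left_mono) auto
      ultimately show False using Q by simp
    qed
    then have "(- m' + 1) * x1 \<le> m * x1" using assms by (intro mult_right_mono) auto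
    moreover have "m' * x1 \<le> m' * x2" using m' assms by (intro mult_left_mono_neg) auto
    ultimately show ?thesis using P by (simp add: algebra_simps)
  qed
qed

text \<open>Two solutions of one recurrence: \<open>I\<close> consists of the numerators of the
  tails of the continued fraction and falls from \<open>r\<close> to 0, \<open>J\<close> of those of
  its initial segments and rises from 0 to \<open>r\<close>.\<close>

locale hj_series =
  fixes r a n :: nat and \<alpha> I J :: "nat \<Rightarrow> nat"
  assumes n: "1 \<le> n" and alpha: "\<And>t. 1 \<le> t \<Longrightarrow> t \<le> n \<Longrightarrow> 2 \<le> \<alpha> t"
    and I0: "I 0 = r" and I1: "I 1 = a" and In: "I n = 1" and ISn: "I (Suc n) = 0"
    and Irec: "\<And>t. 1 \<le> t \<Longrightarrow> t \<le> n \<Longrightarrow> I (t - 1) + I (t + 1) = \<alpha> t * I t"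
    and J0: "J 0 = 0" and J1: "J 1 = 1"
    and Jrec: "\<And>t. 1 \<le> t \<Longrightarrow> t \<le> n \<Longrightarrow> J (t - 1) + J (t + 1) = \<alpha> t * J t"
    and cop: "coprime r a"
begin

lemma I_less: "t \<le> n \<Longrightarrow> I (Suc t) < I t"
proof (induction t rule: inc_induct)
  case base
  then show ?case using In ISn by simp
next
  case (step t)
  have "2 * I (Suc t) \<le> \<alpha> (Suc t) * I (Suc t)"
    using step alpha[of "Suc t"] by (intro mult_right_mono) auto
  moreover have "I t + I (Suc (Suc t)) = \<alpha> (Suc t) * I (Suc t)" using Irec[of "Suc t"] step by simp
  ultimately show ?case using step.IH by linarith
qed

lemma J_less: "t \<le> n \<Longrightarrow> J t < J (Suc t)"
proof (induction t)
  case 0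
  then show ?case using J0 J1 by simp
next
  case (Suc t)
  have "2 * J (Suc t) \<le> \<alpha> (Suc t) * J (Suc t)"
    using Suc alpha[of "Suc t"] by (intro mult_right_mono) auto
  moreover have "J t + J (Suc (Suc t)) = \<alpha> (Suc t) * J (Suc t)" using Jrec[of "Suc t"] Suc by simp
  moreover have "J t < J (Suc t)" using Suc by simp
  ultimately show ?case by linarith
qed

lemma I_mono: "s < t \<Longrightarrow> t \<le> Suc n \<Longrightarrow> I t < I s"
proof (induction t)
  case (Suc t)
  then show ?case using I_less[of t] by (cases "s = t") auto
qed simp

lemma J_mono: "s < t \<Longrightarrow> t \<le> Suc n \<Longrightarrow> J s < J t"
proof (induction t)
  case (Suc t)
  then show ?case using J_less[of t] by (cases "s = t") auto
qed simp

lemma I_le: "s \<le> t \<Longrightarrow> t \<le> Suc n \<Longrightarrow> I t \<le> I s"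
  using I_mono[of s t] by (cases "s = t") auto

lemma J_le: "s \<le> t \<Longrightarrow> t \<le> Suc n \<Longrightarrow> J s \<le> J t"
  using J_mono[of s t] by (cases "s = t") auto

lemma Irec_int: "1 \<le> t \<Longrightarrow> t \<le> n \<Longrightarrow> int (I (t - 1)) = int (\<alpha> t) * int (I t) - int (I (t + 1))"
  using Irec[of t] by (metis add_diff_cancel_right' of_nat_add of_nat_mult)

lemma Jrec_int: "1 \<le> t \<Longrightarrow> t \<le> n \<Longrightarrow> int (J (t - 1)) = int (\<alpha> t) * int (J t) - int (J (t + 1))"
  using Jrec[of t] by (metis add_diff_cancel_right' of_nat_add of_nat_mult)

text \<open>The determinant of two solutions of this recurrence does not depend on \<open>t\<close>,
  and at \<open>t = 0\<close> it is \<open>r\<close>.\<close>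

lemma det: "t \<le> n \<Longrightarrow> int (I t) * int (J (Suc t)) - int (I (Suc t)) * int (J t) = int r"
proof (induction t)
  case 0
  then show ?case using I0 J0 J1 by simp
next
  case (Suc t)
  then have *: "int (I t) = int (\<alpha> (Suc t)) * int (I (Suc t)) - int (I (Suc (Suc t)))"
    "int (J t) = int (\<alpha> (Suc t)) * int (J (Suc t)) - int (J (Suc (Suc t)))"
    using Irec_int[of "Suc t"] Jrec_int[of "Suc t"] by simp_all
  have "int (I t) * int (J (Suc t)) - int (I (Suc t)) * int (J t) = int r" using Suc by simp
  then show ?case unfolding * by (simp add: algebra_simps)
qed

lemma JSn: "J (Suc n) = r"
  using det[of n] In ISn by simp

text \<open>\<open>lat\<close> is the lattice of exponents of invariant Laurent monomials. For every \<open>t\<close> it has the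
  basis \<open>(I t, - J t)\<close>, \<open>(I (t + 1), - J (t + 1))\<close>.\<close>

definition lat :: "int \<Rightarrow> int \<Rightarrow> bool" where
  "lat u v \<longleftrightarrow> int r dvd u + int a * v"

lemma lat_add: "lat u v \<Longrightarrow> lat u' v' \<Longrightarrow> lat (u + u') (v + v')"
  unfolding lat_def using dvd_add[of "int r" "u + int a * v" "u' + int a * v'"]
  by (simp add: algebra_simps)

lemma lat_diff: "lat u v \<Longrightarrow> lat u' v' \<Longrightarrow> lat (u - u') (v - v')"
  unfolding lat_def using dvd_diff[of "int r" "u + int a * v" "u' + int a * v'"]
  by (simp add: algebra_simps)

lemma lat_mult: "lat u v \<Longrightarrow> lat (m * u) (m * v)"
  unfolding lat_def using dvd_mult[of "int r" "u + int a * v" m]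
  by (simp add: algebra_simps)

lemma lat_IJ: "t \<le> Suc n \<Longrightarrow> lat (int (I t)) (- int (J t))"
proof (induction t rule: less_induct)
  case (less t)
  consider "t = 0" | "t = 1" | s where "t = Suc s" "1 \<le> s"
    by (cases t) (auto simp: not_less_eq_eq Suc_le_eq)
  then show ?case
  proof cases
    case 3
    have "lat (int (\<alpha> s) * int (I s) - int (I (s - 1))) (int (\<alpha> s) * - int (J s) - - int (J (s - 1)))"
      using less 3 by (intro lat_diff lat_mult) auto
    then show ?thesis using Irec_int[of s] Jrec_int[of s] 3 less.prems by simp
  qed (use I0 I1 J0 J1 in \<open>auto simp: lat_def\<close>)
qed

text \<open>The start is the evident basis \<open>(r, 0)\<close>, \<open>(a, -1)\<close>; each step
  is the unimodular substitution given by the recurrence.\<close>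

lemma lat_basis:
  assumes "t \<le> n" "lat u v"
  shows "\<exists>m m'. u = m * int (I t) + m' * int (I (Suc t)) \<and> v = - (m * int (J t) + m' * int (J (Suc t)))"
  using assms(1)
proof (induction t)
  case 0
  obtain k where "u + int a * v = int r * k" using assms(2) unfolding lat_def by blast
  then show ?case using I0 I1 J0 J1
    by (intro exI[of _ k] exI[of _ "- v"]) (simp add: algebra_simps)
next
  case (Suc t)
  then obtain m m' where *: "u = m * int (I t) + m' * int (I (Suc t))"
    "v = - (m * int (J t) + m' * int (J (Suc t)))" by auto
  have r: "int (I t) = int (\<alpha> (Suc t)) * int (I (Suc t)) - int (I (Suc (Suc t)))"
    "int (J t) = int (\<alpha> (Suc t)) * int (J (Suc t)) - int (J (Suc (Suc t)))"
    using Irec_int[of "Suc t"] Jrec_int[of "Suc t"] Suc.prems by simp_all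
  show ?case
    by (intro exI[of _ "m * int (\<alpha> (Suc t)) + m'"] exI[of _ "- m"]) (simp add: * r algebra_simps)
qed

text \<open>The corner bound for the basis at \<open>t\<close> leaves only
  \<open>J (Suc t) \<le> v\<close> as an alternative, which is excluded. So
  \<open>(I t, - J t)\<close> is a record among the lattice points of this quadrant.\<close>

lemma record_minimum:
  assumes "t \<le> n" "lat u (- v)" "0 \<le> v" "v < int (J (Suc t))" "0 < u"
  shows "int (I t) \<le> u"
proof -
  obtain m m' where *: "u = m * int (I t) + m' * int (I (Suc t))"
    "v = m * int (J t) + m' * int (J (Suc t))"
    using lat_basis[OF assms(1,2)] by auto
  have "int (I t) \<le> u \<or> int (J (Suc t)) \<le> v"
    by (rule lattice_corner_bound[OF _ _ _ _ *(1) assms(5) *(2) assms(3)])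
       (use I_less[OF assms(1)] J_less[OF assms(1)] in auto)
  then show ?thesis using assms(4) by linarith
qed

lemma lat_axis: "lat 0 v \<Longrightarrow> 0 < v \<Longrightarrow> int r \<le> v"
  using cop unfolding lat_def by (auto simp: coprime_dvd_mult_right_iff dest: zdvd_imp_le)

text \<open>The arrows out of a vertex \<open>t \<ge> 1\<close> have degrees \<open>(Xd t s, Yd t s)\<close> for \<open>s < \<alpha> t\<close>; subtraction
  is truncated, which is what is needed at both ends of this range.\<close>

definition Xd :: "nat \<Rightarrow> nat \<Rightarrow> nat" where "Xd t s = I (t - 1) - (s + 1) * I t"

definition Yd :: "nat \<Rightarrow> nat \<Rightarrow> nat" where "Yd t s = s * J t - J (t - 1)"

lemma int_X:
  assumes "1 \<le> t" "t \<le> n" "s + 2 \<le> \<alpha> t"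
  shows "int (Xd t s) = int (I (t - 1)) - (int s + 1) * int (I t)" "0 < Xd t s"
proof -
  have "(s + 2) * I t \<le> \<alpha> t * I t" using assms by (intro mult_right_mono) auto
  then have "(s + 1) * I t < I (t - 1)" using Irec[of t] I_less[of t] assms by simp
  then show "0 < Xd t s" "int (Xd t s) = int (I (t - 1)) - (int s + 1) * int (I t)"
    unfolding Xd_def by (simp_all add: of_nat_diff algebra_simps)
qed

lemma int_Y:
  assumes "1 \<le> t" "t \<le> n" "1 \<le> s"
  shows "int (Yd t s) = int s * int (J t) - int (J (t - 1))" "0 < Yd t s"
proof -
  have "1 * J t \<le> s * J t" using assms by (intro mult_right_mono) auto
  moreover have "J (t - 1) < J t" using J_less[of "t - 1"] assms by simp
  ultimately have "J (t - 1) < s * J t" by linarith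
  then show "0 < Yd t s" "int (Yd t s) = int s * int (J t) - int (J (t - 1))"
    unfolding Yd_def by (simp_all add: of_nat_diff)
qed

lemma X_last: "1 \<le> t \<Longrightarrow> t \<le> n \<Longrightarrow> Xd t (\<alpha> t - 1) = 0"
  using Irec[of t] alpha[of t] by (simp add: Xd_def)

lemma X_antimono: "s \<le> s' \<Longrightarrow> Xd t s' \<le> Xd t s"
  unfolding Xd_def by (intro diff_le_mono2 mult_right_mono) auto

lemma Y_mono: "s \<le> s' \<Longrightarrow> Yd t s \<le> Yd t s'"
  unfolding Yd_def by (intro diff_le_mono mult_right_mono) auto

lemma Y_zero [simp]: "Yd t 0 = 0"
  by (simp add: Yd_def)

lemma Y_less:
  assumes "1 \<le> t" "t \<le> n" "s + 2 \<le> \<alpha> t"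
  shows "int (Yd t (s + 1)) \<le> int (J (Suc t)) - int (J t)"
proof -
  have "(int s + 2) * int (J t) \<le> int (\<alpha> t) * int (J t)" using assms by (intro mult_right_mono) auto
  then show ?thesis using int_Y[of t "s + 1"] Jrec_int[of t] assms by (simp add: algebra_simps)
qed

text \<open>With \<open>b t = (I t, - J t)\<close>, the vectors \<open>b (t - 1) - s * b t\<close>
  and \<open>b (t - 1) - (s + 1) * b t\<close> form another basis of the lattice, and
  \<open>lattice_corner_bound\<close> for it excludes the box. The box is wider than the corner by
  \<open>I t\<close>, which leaves room for shifts between different target vertices.\<close>

lemma no_lattice_point_in_box:
  assumes t: "1 \<le> t" "t \<le> n" "s + 2 \<le> \<alpha> t"
    and "lat P Q" "0 < P" "P < int (I (t - 1)) - int s * int (I t)" "0 \<le> Q" "Q < int (Yd t (s + 1))"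
  shows False
proof -
  obtain m m' where *: "P = m * int (I (t - 1)) + m' * int (I t)"
    "Q = - (m * int (J (t - 1)) + m' * int (J t))"
    using lat_basis[of "t - 1" P Q] assms by fastforce
  note Xd = int_X[OF t] and Yd = int_Y[OF t(1,2), of "s + 1"]
  have Y': "int (Yd t (s + 1)) = (int s + 1) * int (J t) - int (J (t - 1))" using Yd(1) by simp
  \<comment> \<open>In the new basis the point has the coordinates \<open>m + k\<close> and
    \<open>- k\<close>.\<close>
  define k where "k = m' + m * int s"
  have "int (I (t - 1)) - int s * int (I t) \<le> P \<or> int (Yd t (s + 1)) \<le> Q"
  proof (rule lattice_corner_bound)
    show "P = (m + k) * (int (I (t - 1)) - int s * int (I t)) + (- k) * int (Xd t s)"
      unfolding Xd(1) *(1) k_def by (simp add: algebra_simps)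
    show "Q = (m + k) * (int s * int (J t) - int (J (t - 1))) + (- k) * int (Yd t (s + 1))"
      unfolding Y' *(2) k_def by (simp add: algebra_simps)
  qed (use assms Xd Yd I_mono[of t "Suc n"] J_mono[of 0 t] ISn J0 in \<open>auto simp: algebra_simps\<close>)
  then show False using assms by linarith
qed

text \<open>\<open>W u v p q\<close> says that \<open>x\<^sup>p y\<^sup>q\<close> is a homomorphism from the \<open>u\<close>-th to the \<open>v\<close>-th special
  Cohen--Macaulay module.\<close>

definition W :: "nat \<Rightarrow> nat \<Rightarrow> nat \<Rightarrow> nat \<Rightarrow> bool" where
  "W u v p q \<longleftrightarrow> lat (int p + int (I u) - int (I v)) (int q)"

text \<open>Since \<open>(I t, - J t)\<close> lies in \<open>lat\<close>, the shift between the
  modules can be moved from the \<open>x\<close>-exponent to the \<open>y\<close>-exponent.\<close>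

lemma W_lat_J:
  assumes "u \<le> Suc n" "v \<le> Suc n" "W u v p q"
  shows "lat (int p) (int q + int (J u) - int (J v))"
  using lat_add[OF lat_diff[OF assms(3)[unfolded W_def] lat_IJ[OF assms(1)]] lat_IJ[OF assms(2)]]
  by simp

text \<open>A shift by \<open>(I v, - J v)\<close>, where needed, turns the degree into a lattice
  point within the width of the empty box. Two cases escape the box: for
  \<open>1 \<le> v < t\<close> the second coordinate may become negative, which contradicts
  \<open>record_minimum\<close>; for \<open>v = t\<close> the point may lie on the
  \<open>y\<close>-axis, where \<open>lat_axis\<close> applies.\<close>

lemma W_below_corner:
  assumes t: "1 \<le> t" "t \<le> n" "s + 2 \<le> \<alpha> t" and v: "v \<le> n" and W: "W t v p q"
    and p: "p < Xd t s" and q: "q < Yd t (s + 1)"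
  shows "p = 0 \<and> q = 0 \<and> v = t"
proof -
  note Xd = int_X[OF t]
  have px: "int p + int (I t) < int (I (t - 1)) - int s * int (I t)"
    using p Xd by (simp add: algebra_simps)
  have It: "0 < I t" using I_mono[of t "Suc n"] t ISn by simp
  note box = no_lattice_point_in_box[OF t]
  consider "v = 0" | "v = t" | "1 \<le> v" "v < t" | "t < v" by linarith
  then show ?thesis
  proof cases
    case 1
    have "lat (int p + int (I t)) (int q)"
      using lat_add[OF W[unfolded W_def] lat_IJ[of 0]] 1 J0 by simp
    then show ?thesis using box[of "int p + int (I t)" "int q"] px q It by simp
  next
    case 2
    have l: "lat (int p) (int q)" using W 2 unfolding W_def by simp
    have "p = 0" using box[OF l] px q It by (cases "p = 0") auto
    moreover have "q = 0"
    proof (rule ccontr)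
      assume "q \<noteq> 0"
      then have "r \<le> q" using lat_axis[of "int q"] l \<open>p = 0\<close> by simp
      moreover have "int (Yd t (s + 1)) \<le> int (J (Suc n))"
        using Y_less[OF t] J_le[of "Suc t" "Suc n"] t by simp
      ultimately show False using q JSn by simp
    qed
    ultimately show ?thesis using 2 by simp
  next
    case 3
    have l: "lat (int p + int (I t)) (int q - int (J v))"
      using lat_add[OF W[unfolded W_def] lat_IJ[of v]] 3 t by simp
    show ?thesis
    proof (cases "J v \<le> q")
      case True
      then show ?thesis using box[OF l] px q It by simp
    next
      case False
      have "int (I (t - 1)) \<le> int p + int (I t)"
        using l False J_mono[of v t] 3 t It
        by (intro record_minimum[of "t - 1" _ "int (J v) - int q"]) auto
      moreover have "0 \<le> int s * int (I t)" by simp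
      ultimately show ?thesis using px by linarith
    qed
  next
    case 4
    then show ?thesis using box[OF W[unfolded W_def]] px q I_mono[of t v] v by simp
  qed
qed

text \<open>Take the least \<open>s\<close> with \<open>Xd t s \<le> p\<close>. If
  \<open>q < Yd t s\<close>, the degree would lie strictly below the corner between the arrows
  \<open>s - 1\<close> and \<open>s\<close>.\<close>

lemma arrow_below:
  assumes t: "1 \<le> t" "t \<le> n" and v: "v \<le> n" and W: "W t v p q" and nz: "(p, q) \<noteq> (0, 0)"
  shows "\<exists>s < \<alpha> t. Xd t s \<le> p \<and> Yd t s \<le> q"
proof -
  have ex: "Xd t (\<alpha> t - 1) \<le> p" using X_last[OF t] by simp
  define s where "s = (LEAST s. Xd t s \<le> p)"
  have s: "Xd t s \<le> p" "s \<le> \<alpha> t - 1"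
    unfolding s_def by (rule LeastI[of "\<lambda>s. Xd t s \<le> p", OF ex], rule Least_le[of "\<lambda>s. Xd t s \<le> p", OF ex])
  have "Yd t s \<le> q"
  proof (rule ccontr)
    assume *: "\<not> Yd t s \<le> q"
    then obtain s' where s': "s = Suc s'" by (cases s) auto
    then have "p < Xd t s'" using not_less_Least[of s' "\<lambda>s. Xd t s \<le> p"] unfolding s_def by simp
    then show False using W_below_corner[OF t _ v W, of s'] * s s' nz alpha[OF t] by auto
  qed
  then show ?thesis using s alpha[OF t] by (intro exI[of _ s]) auto
qed

text \<open>The characters \<open>I 0, ..., I n\<close> are strictly decreasing and lie between 1
  and \<open>r\<close>, so they are distinct modulo \<open>r\<close>.\<close>

lemma W_zero: "u \<le> n \<Longrightarrow> v \<le> n \<Longrightarrow> W u v 0 0 \<longleftrightarrow> u = v"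
proof
  assume uv: "u \<le> n" "v \<le> n" and W: "W u v 0 0"
  have *: "0 < I t" "I t \<le> r" "t \<noteq> 0 \<Longrightarrow> I t < r" if "t \<le> n" for t
    using that I_mono[of t "Suc n"] ISn I_le[of 0 t] I_mono[of 0 t] I0 by auto
  have "int r dvd int (I u) - int (I v)" using W unfolding W_def lat_def by simp
  then have "int (I u) = int (I v)"
    using *[OF uv(1)] *[OF uv(2)] zdvd_imp_le[of "int r" "int (I u) - int (I v)"]
      zdvd_imp_le[of "int r" "int (I v) - int (I u)"] by (cases "I u < I v"; cases "I v < I u")
        (auto simp: dvd_diff_commute)
  then show "u = v" using I_mono[of u v] I_mono[of v u] uv by (cases "u < v"; cases "v < u") auto
qed (simp add: W_def lat_def)

text \<open>Order all corners by decreasing \<open>x\<close>-degree; the last one at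
  \<open>t\<close> has the degree of the first one at \<open>t + 1\<close>. Let
  \<open>(T, s)\<close> be the first with \<open>x\<close>-degree at most \<open>p\<close>. If it
  does not divide the monomial, then \<open>p\<close> is below the \<open>x\<close>-degree of the
  preceding corner and \<open>q\<close> below the \<open>y\<close>-degree of \<open>(T, s)\<close>,
  so that a shift to the lattice meets the empty box, the \<open>y\<close>-axis bound or the
  minimality of \<open>I v\<close>.\<close>

lemma corner_below:
  assumes v: "v \<le> n" and W: "W 0 v p q" and pq: "1 \<le> p" "1 \<le> q"
  shows "\<exists>t s. 1 \<le> t \<and> t \<le> n \<and> s + 2 \<le> \<alpha> t \<and> Xd t s \<le> p \<and> Yd t (s + 1) \<le> q"
proof (rule ccontr)
  assume no: "\<not> ?thesis"
  have last: "Xd t (\<alpha> t - 2) = I t - I (Suc t)" "Yd t (\<alpha> t - 1) = J (Suc t) - J t"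
    if "1 \<le> t" "t \<le> n" for t
  proof -
    have "int (Xd t (\<alpha> t - 2)) = int (I (t - 1)) - (int (\<alpha> t) - 1) * int (I t)"
      using int_X(1)[OF that, of "\<alpha> t - 2"] alpha[OF that] by (simp add: of_nat_diff)
    also have "\<dots> = int (I t) - int (I (Suc t))"
      using Irec_int[OF that] by (simp add: algebra_simps)
    finally show "Xd t (\<alpha> t - 2) = I t - I (Suc t)" by linarith
    have "int (Yd t (\<alpha> t - 1)) = (int (\<alpha> t) - 1) * int (J t) - int (J (t - 1))"
      using int_Y(1)[OF that, of "\<alpha> t - 1"] alpha[OF that] by (simp add: of_nat_diff)
    also have "\<dots> = int (J (Suc t)) - int (J t)"
      using Jrec_int[OF that] by (simp add: algebra_simps)
    finally show "Yd t (\<alpha> t - 1) = J (Suc t) - J t" by linarith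
  qed
  define T where "T = (LEAST t. I t - I (Suc t) \<le> p)"
  have ex: "I n - I (Suc n) \<le> p" using pq In by simp
  have T: "I T - I (Suc T) \<le> p" "T \<le> n"
    unfolding T_def by (rule LeastI[of "\<lambda>t. I t - I (Suc t) \<le> p", OF ex], rule Least_le[of "\<lambda>t. I t - I (Suc t) \<le> p", OF ex])
  have T1: "1 \<le> T"
  proof (rule ccontr)
    assume "\<not> 1 \<le> T"
    then have "T = 0" by simp
    then have "Xd 1 0 \<le> p" "Yd 1 1 \<le> q" using T pq I0 J0 J1 by (auto simp: Xd_def Yd_def)
    then show False using no n alpha[of 1] by (auto intro: exI[of _ 1] exI[of _ 0])
  qed
  have pT: "p < I (T - 1) - I T"
    using not_less_Least[of "T - 1" "\<lambda>t. I t - I (Suc t) \<le> p"] T1 unfolding T_def[symmetric] by simp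
  have ex2: "Xd T (\<alpha> T - 2) \<le> p" using last(1)[OF T1 T(2)] T by simp
  define s where "s = (LEAST s. Xd T s \<le> p)"
  have s: "Xd T s \<le> p" "s \<le> \<alpha> T - 2"
    unfolding s_def by (rule LeastI[of "\<lambda>s. Xd T s \<le> p", OF ex2], rule Least_le[of "\<lambda>s. Xd T s \<le> p", OF ex2])
  have s2: "s + 2 \<le> \<alpha> T" using s alpha[OF T1 T(2)] by linarith
  have s1: "1 \<le> s" using s pT by (cases s) (auto simp: Xd_def)
  have q: "q < Yd T (s + 1)" using no T1 T(2) s2 s(1) by (meson not_less)
  have "p < Xd T (s - 1)" using not_less_Least[of "s - 1" "\<lambda>s. Xd T s \<le> p"] s1 unfolding s_def[symmetric] by simp
  then have p: "int p < int (I (T - 1)) - int s * int (I T)"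
    using int_X(1)[OF T1 T(2), of "s - 1"] s2 s1 by (simp add: of_nat_diff)
  note box = no_lattice_point_in_box[OF T1 T(2) s2]
  show False
  proof (cases "v = 0")
    case True
    have "lat (int p) (int q)" using W True by (simp add: W_def)
    then show False using box[of "int p" "int q"] p q pq by simp
  next
    case False
    have l1: "lat (int p - int (I v)) (int q)"
      using lat_diff[OF W[unfolded W_def] lat_IJ[of 0]] I0 J0 by simp
    have l2: "lat (int p) (int q - int (J v))" using W_lat_J[OF _ _ W] v J0 by simp
    consider "J v \<le> q" | "I v < p" | "p = I v" | "q < J v" "p < I v" by linarith
    then show False
    proof cases
      case 1
      then show False using box[OF l2] p q pq by simp
    next
      case 2
      then show False using box[OF l1] p q by simp
    next
      case 3
      then have "r \<le> q" using lat_axis[of "int q"] l1 pq by simp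
      moreover have "int (Yd T (s + 1)) \<le> int (J (Suc n))"
        using Y_less[OF T1 T(2) s2] J_le[of "Suc T" "Suc n"] T by simp
      ultimately show False using q JSn by simp
    next
      case 4
      \<comment> \<open>Here both shifted points leave the first quadrant; the negative of one of
        them contradicts the minimality of \<open>I v\<close>.\<close>
      have "lat (int (I v) - int p) (- int q)"
        using lat_mult[OF l1, of "-1"] by simp
      then have "int (I v) \<le> int (I v) - int p"
        using 4 J_less[of v] v by (intro record_minimum[of v _ "int q"]) auto
      then show False using pq by simp
    qed
  qed
qed

end

section \<open>Path algebras with monomial relations graded by two variables\<close>

definition wdeg :: "('e \<Rightarrow> nat) \<Rightarrow> 'e list \<Rightarrow> nat" where
  "wdeg d p = sum_list (map d p)"

lemma wdeg_simps [simp]: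
  "wdeg d [] = 0" "wdeg d (e # p) = d e + wdeg d p" "wdeg d (p @ q) = wdeg d p + wdeg d q"
  by (simp_all add: wdeg_def)

text \<open>One relation applied at the start of a path of degree \<open>(p, q)\<close>, recorded
  only through the first arrows. Bounding one side is enough because the relations will be
  homogeneous.\<close>

definition rel_step :: "('e list \<times> 'e list) set \<Rightarrow> ('e \<Rightarrow> nat) \<Rightarrow> ('e \<Rightarrow> nat) \<Rightarrow> nat \<Rightarrow> nat \<Rightarrow> 'e \<Rightarrow> 'e \<Rightarrow> bool" where
  "rel_step E dx dy p q e f \<longleftrightarrow>
     (\<exists>x y. ((e # x, f # y) \<in> E \<or> (f # y, e # x) \<in> E) \<and> wdeg dx (e # x) \<le> p \<and> wdeg dy (e # x) \<le> q)"

text \<open>Two monomials can be compared along the arrows with which they start: the assumption \<open>link\<close>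
  connects any two arrows that can start a path of a given degree by relations of at most this
  degree.\<close>

locale monomial_presentation = fin_digraph G
  for G :: "(nat, 'e) pre_digraph" +
  fixes N :: nat and dx dy :: "'e \<Rightarrow> nat" and W :: "nat \<Rightarrow> nat \<Rightarrow> nat \<Rightarrow> nat \<Rightarrow> bool"
    and E :: "('e list \<times> 'e list) set"
  assumes verts: "verts G = {..<N}"
    and W_zero: "\<And>u v. u < N \<Longrightarrow> v < N \<Longrightarrow> W u v 0 0 \<longleftrightarrow> u = v"
    and W_step: "\<And>e v p q. e \<in> arcs G \<Longrightarrow> v < N \<Longrightarrow>
      W (tail G e) v (dx e + p) (dy e + q) \<longleftrightarrow> W (head G e) v p q"
    and deg_pos: "\<And>e. e \<in> arcs G \<Longrightarrow> 0 < dx e + dy e"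
    and arrow_below: "\<And>u v p q. u < N \<Longrightarrow> v < N \<Longrightarrow> W u v p q \<Longrightarrow> (p, q) \<noteq> (0, 0) \<Longrightarrow>
      \<exists>e \<in> arcs G. tail G e = u \<and> dx e \<le> p \<and> dy e \<le> q"
    and link: "\<And>u v p q e f. u < N \<Longrightarrow> v < N \<Longrightarrow> W u v p q \<Longrightarrow> e \<in> arcs G \<Longrightarrow> f \<in> arcs G \<Longrightarrow>
      tail G e = u \<Longrightarrow> tail G f = u \<Longrightarrow> dx e \<le> p \<Longrightarrow> dy e \<le> q \<Longrightarrow> dx f \<le> p \<Longrightarrow> dy f \<le> q \<Longrightarrow>
      (rel_step E dx dy p q)\<^sup>*\<^sup>* e f"
    and rel_deg: "\<And>x y. (x, y) \<in> E \<Longrightarrow> wdeg dx x = wdeg dx y \<and> wdeg dy x = wdeg dy y"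
    and rel_parallel: "\<And>x y. (x, y) \<in> E \<Longrightarrow> x \<noteq> [] \<and> y \<noteq> [] \<and> (\<exists>i j. awalk i x j \<and> awalk i y j)"
begin

abbreviation PA where "PA \<equiv> path_algebra G"

interpretation PA: ring PA by (rule ring_path_algebra)

lemma PA_simps [simp]:
  "x \<otimes>\<^bsub>PA\<^esub> y = path_mult x y" "x \<oplus>\<^bsub>PA\<^esub> y = x + y" "\<zero>\<^bsub>PA\<^esub> = 0" "\<one>\<^bsub>PA\<^esub> = path_scalar G 1"
  by (simp_all add: path_algebra_def)

lemma PA_carrier: "f \<in> carrier PA \<longleftrightarrow> Poly_Mapping.keys f \<subseteq> paths G"
  by (simp add: path_algebra_def)

lemma single_in_PA: "awalk u p v \<Longrightarrow> Poly_Mapping.single (u, p, v) c \<in> carrier PA"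
  by (auto simp: PA_carrier paths_def)

lemma PA_uminus: "f \<in> carrier PA \<Longrightarrow> \<ominus>\<^bsub>PA\<^esub> f = - f"
  by (rule PA.minus_equality) (simp_all add: PA_carrier)

lemma PA_minus: "f \<in> carrier PA \<Longrightarrow> g \<in> carrier PA \<Longrightarrow> f \<ominus>\<^bsub>PA\<^esub> g = f - g"
  by (simp add: a_minus_def PA_uminus)

lemma path_of_awalk:
  assumes "awalk u x w" "x \<noteq> []"
  shows "path_of G x = Poly_Mapping.single (u, x, w) 1"
proof -
  have "tail G (hd x) = u \<and> head G (last x) = w"
    using assms
  proof (induction x arbitrary: u)
    case (Cons e x)
    then show ?case by (cases x) (auto simp: awalk_Cons_iff awalk_Nil_iff)
  qed simp
  then show ?thesis by (simp add: path_of_def)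
qed

abbreviation rel_gens where "rel_gens \<equiv> {path_of G p - path_of G q | p q. (p, q) \<in> E}"

lemma rel_gens_closed: "rel_gens \<subseteq> carrier PA"
proof safe
  fix p q assume "(p, q) \<in> E"
  then obtain i j where "awalk i p j" "awalk i q j" "p \<noteq> []" "q \<noteq> []" using rel_parallel by blast
  then have "path_of G p \<in> carrier PA" "path_of G q \<in> carrier PA"
    by (simp_all add: path_of_awalk single_in_PA)
  then show "path_of G p - path_of G q \<in> carrier PA"
    using PA.minus_closed PA_minus by metis
qed

lemma ideal_rel: "ideal (relation_ideal G E) PA"
  unfolding relation_ideal_def by (rule PA.genideal_ideal[OF rel_gens_closed])

interpretation RI: ideal "relation_ideal G E" PA by (rule ideal_rel)

definition eqv :: "nat \<Rightarrow> 'e list \<Rightarrow> 'e list \<Rightarrow> nat \<Rightarrow> bool" where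
  "eqv u p q v \<longleftrightarrow> Poly_Mapping.single (u, p, v) 1 - Poly_Mapping.single (u, q, v) 1 \<in> relation_ideal G E"

lemma RI_add: "f \<in> relation_ideal G E \<Longrightarrow> g \<in> relation_ideal G E \<Longrightarrow> f + g \<in> relation_ideal G E"
  using RI.a_closed by simp

lemma RI_uminus: "f \<in> relation_ideal G E \<Longrightarrow> - f \<in> relation_ideal G E"
  using RI.a_inv_closed RI.a_Hcarr PA_uminus by metis

lemma RI_zero: "0 \<in> relation_ideal G E"
  using RI.zero_closed by simp

lemma RI_sum: "(\<And>i. i \<in> A \<Longrightarrow> f i \<in> relation_ideal G E) \<Longrightarrow> sum f A \<in> relation_ideal G E"
  by (induction A rule: infinite_finite_induct) (auto simp: RI_add RI_zero)

lemma eqv_refl: "eqv u p p v"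
  by (simp add: eqv_def RI_zero)

lemma eqv_sym: "eqv u p q v \<Longrightarrow> eqv u q p v"
  unfolding eqv_def using RI_uminus by fastforce

lemma eqv_trans: "eqv u p q v \<Longrightarrow> eqv u q s v \<Longrightarrow> eqv u p s v"
  unfolding eqv_def using RI_add by fastforce

lemma path_mult_diff_left: "path_mult (f - g) h = path_mult f h - path_mult g h"
  using path_mult_add_left[of "f - g" g h] by simp

lemma path_mult_diff_right: "path_mult h (f - g) = path_mult h f - path_mult h g"
  using path_mult_add_right[of h "f - g" g] by simp

lemma eqv_Cons:
  assumes "e \<in> arcs G" "eqv (head G e) p q v"
  shows "eqv (tail G e) (e # p) (e # q) v"
proof -
  have "awalk (tail G e) [e] (head G e)" using assms(1) by (simp add: awalk_Cons_iff awalk_Nil_iff)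
  from RI.I_l_closed[OF assms(2)[unfolded eqv_def] single_in_PA[OF this, of 1]] show ?thesis
    by (simp add: eqv_def path_mult_diff_right path_mult_single path_term_def)
qed

lemma eqv_rel:
  assumes "(x, y) \<in> E" "awalk u x w" "awalk w z v"
  shows "eqv u (x @ z) (y @ z) v" "awalk u y w"
proof -
  obtain i j where ij: "awalk i x j" "awalk i y j" "x \<noteq> []" "y \<noteq> []" using rel_parallel[OF assms(1)] by blast
  then have "i = u" "j = w"
    using assms(2) by (metis awalk_ends)+
  then show y: "awalk u y w" using ij by simp
  have "path_of G x - path_of G y \<in> relation_ideal G E"
    unfolding relation_ideal_def using PA.genideal_self[OF rel_gens_closed] assms(1) by blast
  then have "Poly_Mapping.single (u, x, w) 1 - Poly_Mapping.single (u, y, w) 1 \<in> relation_ideal G E"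
    using path_of_awalk[OF assms(2) ij(3)] path_of_awalk[OF y ij(4)] by simp
  from RI.I_r_closed[OF this single_in_PA[OF assms(3), of 1]] show "eqv u (x @ z) (y @ z) v"
    by (simp add: eqv_def path_mult_diff_left path_mult_single path_term_def)
qed

lemma W_awalk_append:
  assumes "awalk u x w" "v < N"
  shows "W u v (wdeg dx x + p) (wdeg dy x + q) \<longleftrightarrow> W w v p q"
  using assms(1)
proof (induction x arbitrary: u)
  case (Cons e x)
  then show ?case using W_step[of e v "wdeg dx x + p" "wdeg dy x + q"] assms(2)
    by (auto simp: awalk_Cons_iff add.assoc)
qed (simp add: awalk_Nil_iff)

lemma awalk_verts: "awalk u x v \<Longrightarrow> u < N \<and> v < N"
  using verts by auto

lemma W_awalk: "awalk u x v \<Longrightarrow> W u v (wdeg dx x) (wdeg dy x)"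
  using W_awalk_append[of u x v v 0 0] awalk_verts[of u x v] W_zero[of v v] by simp

text \<open>Induction on the total degree: \<open>arrow_below\<close> supplies a first arrow, and by
  \<open>W_step\<close> the remaining degree is again admissible.\<close>

lemma awalk_exists:
  assumes "u < N" "v < N" "W u v p q"
  shows "\<exists>x. awalk u x v \<and> wdeg dx x = p \<and> wdeg dy x = q"
  using assms
proof (induction "p + q" arbitrary: u p q rule: less_induct)
  case less
  show ?case
  proof (cases "(p, q) = (0, 0)")
    case True
    then have "u = v" using W_zero less.prems by auto
    then show ?thesis using True less.prems verts by (intro exI[of _ "[]"]) (auto simp: awalk_Nil_iff)
  next
    case False
    then obtain e where e: "e \<in> arcs G" "tail G e = u" "dx e \<le> p" "dy e \<le> q"
      using arrow_below[OF less.prems] by blast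
    have "W (head G e) v (p - dx e) (q - dy e)"
      using W_step[OF e(1) less.prems(2), of "p - dx e" "q - dy e"] e less.prems(3) by simp
    moreover have "head G e < N" using head_in_verts[OF e(1)] verts by simp
    moreover have "(p - dx e) + (q - dy e) < p + q" using deg_pos[OF e(1)] e by linarith
    ultimately obtain x where "awalk (head G e) x v" "wdeg dx x = p - dx e" "wdeg dy x = q - dy e"
      using less.hyps less.prems(2) by blast
    then show ?thesis using e by (intro exI[of _ "e # x"]) (auto simp: awalk_Cons_iff)
  qed
qed

text \<open>Equal first arrows are cancelled, and induction on the degree applies to the rest.
  Otherwise the chain from \<open>link\<close> changes the first arrow one relation at a time, and
  \<open>awalk_exists\<close> completes each relation to a pair of paths of the full degree.\<close>

lemma eqv_if_same_degree:
  assumes "awalk u x v" "awalk u y v" "wdeg dx x = wdeg dx y" "wdeg dy x = wdeg dy y"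
  shows "eqv u x y v"
  using assms
proof (induction "wdeg dx x + wdeg dy x" arbitrary: u x y rule: less_induct)
  case less
  let ?p = "wdeg dx x" and ?q = "wdeg dy x"
  have vN: "u < N" "v < N" using awalk_verts less.prems by auto
  show ?case
  proof (cases "x = [] \<or> y = []")
    case True
    have "z = []" if "awalk u z v" "wdeg dx z = 0" "wdeg dy z = 0" for z
      using that deg_pos by (cases z) (fastforce simp: awalk_Cons_iff)+
    then have "x = []" "y = []" using True less.prems by auto
    then show ?thesis by (simp add: eqv_refl)
  next
    case False
    then obtain e x' f y' where xy: "x = e # x'" "y = f # y'" by (cases x; cases y) auto
    have ef: "e \<in> arcs G" "f \<in> arcs G" "tail G e = u" "tail G f = u"
      using less.prems xy by (auto simp: awalk_Cons_iff)
    have same_first: "eqv u (g # s) (g # t) v"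
      if "awalk u (g # s) v" "awalk u (g # t) v" "wdeg dx (g # s) = ?p" "wdeg dy (g # s) = ?q"
        "wdeg dx (g # t) = ?p" "wdeg dy (g # t) = ?q" for g s t
    proof -
      have g: "g \<in> arcs G" "tail G g = u" using that(1) by (auto simp: awalk_Cons_iff)
      have "eqv (head G g) s t v"
        using that deg_pos[OF g(1)] by (intro less.hyps) (auto simp: awalk_Cons_iff)
      then show ?thesis using eqv_Cons[OF g(1)] g(2) by simp
    qed
    have "(rel_step E dx dy ?p ?q)\<^sup>*\<^sup>* e f"
      using less.prems xy by (intro link[OF vN W_awalk[OF less.prems(1)]] ef) auto
    \<comment> \<open>All continuations at once, because each relation in the chain also changes
      what follows the first arrow.\<close>
    then have "\<forall>t. awalk u (f # t) v \<longrightarrow> wdeg dx (f # t) = ?p \<longrightarrow> wdeg dy (f # t) = ?q \<longrightarrow> eqv u x (f # t) v"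
    proof (induction rule: rtranclp_induct)
      case base
      then show ?case using same_first less.prems(1) xy by auto
    next
      case (step f g)
      then obtain s t where st: "(f # s, g # t) \<in> E \<or> (g # t, f # s) \<in> E"
        "wdeg dx (f # s) \<le> ?p" "wdeg dy (f # s) \<le> ?q" unfolding rel_step_def by blast
      have deg: "wdeg dx (f # s) = wdeg dx (g # t)" "wdeg dy (f # s) = wdeg dy (g # t)"
        using st(1) rel_deg by (metis, metis)
      show ?case
      proof (intro allI impI)
        fix t' assume t': "awalk u (g # t') v" "wdeg dx (g # t') = ?p" "wdeg dy (g # t') = ?q"
        obtain i j where ij: "awalk i (f # s) j" "awalk i (g # t) j"
          using st(1) rel_parallel by (metis list.distinct(1))
        have iu: "i = u" using ij(2) t'(1) by (auto simp: awalk_Cons_iff)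
        have jN: "j < N" using ij awalk_verts by blast
        have "W j v (?p - wdeg dx (f # s)) (?q - wdeg dy (f # s))"
          using W_awalk_append[OF ij(1) vN(2), of "?p - wdeg dx (f # s)" "?q - wdeg dy (f # s)"]
            W_awalk[OF less.prems(1)] st(2,3) iu by simp
        then obtain z where z: "awalk j z v" "wdeg dx z = ?p - wdeg dx (f # s)"
            "wdeg dy z = ?q - wdeg dy (f # s)"
          using awalk_exists[OF jN vN(2)] by blast
        have zd: "wdeg dx ((f # s) @ z) = ?p" "wdeg dy ((f # s) @ z) = ?q"
          "wdeg dx ((g # t) @ z) = ?p" "wdeg dy ((g # t) @ z) = ?q"
          using z(2,3) st(2,3) deg by (simp_all only: wdeg_simps(3))
        have walks: "awalk u ((f # s) @ z) v" "awalk u ((g # t) @ z) v"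
          using awalk_appendI[OF ij(1) z(1)] awalk_appendI[OF ij(2) z(1)] iu by blast+
        have "eqv u x (f # s @ z) v"
          using step.IH walks(1) zd(1,2) by simp
        moreover have "eqv u (f # s @ z) (g # t @ z) v"
          using st(1) eqv_rel(1)[of "f # s" "g # t" u j z v] eqv_rel(1)[of "g # t" "f # s" u j z v]
            ij iu z(1) eqv_sym by auto
        moreover have "eqv u (g # t @ z) (g # t') v"
          using same_first[of g "t @ z" t'] walks(2) t' zd(3,4) by simp
        ultimately show "eqv u x (g # t') v" using eqv_trans by blast
      qed
    qed
    then show ?thesis using less.prems xy by simp
  qed
qed

end

section \<open>The representation by polynomial matrices\<close>

definition bimonom :: "nat \<Rightarrow> nat \<Rightarrow> complex \<Rightarrow> complex poly poly" where
  "bimonom p q c = monom (monom c p) q"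

lemma coeff_bimonom: "coeff (coeff (bimonom p q c) q') p' = (if p = p' \<and> q = q' then c else 0)"
  by (auto simp: bimonom_def)

lemma bimonom_add: "bimonom p q (c + d) = bimonom p q c + bimonom p q d"
  by (simp add: bimonom_def add_monom[symmetric])

lemma bimonom_0 [simp]: "bimonom p q 0 = 0"
  by (simp add: bimonom_def)

lemma bimonom_mult: "bimonom p q c * bimonom p' q' d = bimonom (p + p') (q + q') (c * d)"
  by (simp add: bimonom_def mult_monom)

lemma poly_poly_eqI: "(\<And>p q. coeff (coeff f q) p = coeff (coeff g q) p) \<Longrightarrow> f = g"
  by (intro poly_eqI) blast

definition graded_mats :: "nat \<Rightarrow> (nat \<Rightarrow> nat \<Rightarrow> nat \<Rightarrow> nat \<Rightarrow> bool) \<Rightarrow> complex poly poly mat set" where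
  "graded_mats N W = {M \<in> carrier_mat N N. \<forall>i<N. \<forall>j<N. \<forall>p q. coeff (coeff (M $$ (i, j)) q) p \<noteq> 0 \<longrightarrow> W i j p q}"

lemma finite_coeffs: "finite {(p, q). coeff (coeff (P :: 'a :: zero poly poly) q) p \<noteq> 0}"
proof (rule finite_subset)
  show "{(p, q). coeff (coeff P q) p \<noteq> 0} \<subseteq>
      (\<Union>q \<in> {..degree P}. (\<lambda>p. (p, q)) ` {..degree (coeff P q)})"
  proof safe
    fix p q assume *: "coeff (coeff P q) p \<noteq> 0"
    then have "q \<le> degree P" by (intro le_degree) auto
    then show "(p, q) \<in> (\<Union>q \<in> {..degree P}. (\<lambda>p. (p, q)) ` {..degree (coeff P q)})"
      using le_degree[OF *] by blast
  qed
qed simp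

context monomial_presentation
begin

interpretation PA: ring PA by (rule ring_path_algebra)
interpretation RI: ideal "relation_ideal G E" PA by (rule ideal_rel)

definition ent1 :: "nat \<Rightarrow> nat \<Rightarrow> nat \<times> 'e list \<times> nat \<Rightarrow> complex \<Rightarrow> complex poly poly" where
  "ent1 i j x c = (if fst x = i \<and> snd (snd x) = j
     then bimonom (wdeg dx (fst (snd x))) (wdeg dy (fst (snd x))) c else 0)"

definition ent :: "nat \<Rightarrow> nat \<Rightarrow> (nat, 'e) path_elem \<Rightarrow> complex poly poly" where
  "ent i j f = (\<Sum>x \<in> Poly_Mapping.keys f. ent1 i j x (Poly_Mapping.lookup f x))"

lemma ent1_add: "ent1 i j x (c + d) = ent1 i j x c + ent1 i j x d"
  by (simp add: ent1_def bimonom_add)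

lemma ent1_0 [simp]: "ent1 i j x 0 = 0"
  by (simp add: ent1_def)

lemma ent_superset:
  assumes "finite A" "Poly_Mapping.keys f \<subseteq> A"
  shows "ent i j f = (\<Sum>x \<in> A. ent1 i j x (Poly_Mapping.lookup f x))"
  unfolding ent_def using assms by (intro sum.mono_neutral_left) (auto simp: in_keys_iff)

lemma ent_add: "ent i j (f + g) = ent i j f + ent i j g"
proof -
  let ?A = "Poly_Mapping.keys f \<union> Poly_Mapping.keys g"
  have "Poly_Mapping.keys (f + g) \<subseteq> ?A" by (rule keys_add)
  then show ?thesis
    by (subst (1 2 3) ent_superset[of ?A]) (auto simp: lookup_add ent1_add sum.distrib)
qed

lemma ent_0 [simp]: "ent i j 0 = 0"
  by (simp add: ent_def)

lemma ent_sum: "ent i j (sum f A) = (\<Sum>a\<in>A. ent i j (f a))"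
  by (induction A rule: infinite_finite_induct) (simp_all add: ent_add)

lemma ent_single [simp]: "ent i j (Poly_Mapping.single x c) = ent1 i j x c"
  by (subst ent_superset[of "{x}"]) auto

lemma ent_diff: "ent i j (f - g) = ent i j f - ent i j g"
  using ent_add[of i j "f - g" g] by simp

lemma ent_path_term:
  assumes "snd (snd x) < N"
  shows "ent i k (path_term x y (c * d)) = (\<Sum>j<N. ent1 i j x c * ent1 j k y d)"
proof -
  have "(\<Sum>j<N. ent1 i j x c * ent1 j k y d) = (\<Sum>j<N. if j = snd (snd x) then ent1 i j x c * ent1 j k y d else 0)"
    by (intro sum.cong) (auto simp: ent1_def)
  also have "\<dots> = ent1 i (snd (snd x)) x c * ent1 (snd (snd x)) k y d" using assms by simp
  also have "\<dots> = ent i k (path_term x y (c * d))"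
    by (auto simp: ent1_def path_term_def bimonom_mult)
  finally show ?thesis ..
qed

lemma keys_verts:
  assumes "f \<in> carrier PA" "x \<in> Poly_Mapping.keys f"
  shows "fst x < N" "snd (snd x) < N" "awalk (fst x) (fst (snd x)) (snd (snd x))"
  using assms awalk_verts by (force simp: PA_carrier paths_def)+

lemma ent_mult:
  assumes "f \<in> carrier PA"
  shows "ent i k (path_mult f g) = (\<Sum>j<N. ent i j f * ent j k g)"
proof -
  let ?F = "Poly_Mapping.keys f" and ?G = "Poly_Mapping.keys g"
  have "ent i k (path_mult f g) = (\<Sum>x\<in>?F. \<Sum>y\<in>?G.
      ent i k (path_term x y (Poly_Mapping.lookup f x * Poly_Mapping.lookup g y)))"
    by (subst path_mult_eq[of ?F ?G]) (simp_all add: ent_sum)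
  also have "\<dots> = (\<Sum>x\<in>?F. \<Sum>y\<in>?G. \<Sum>j<N.
      ent1 i j x (Poly_Mapping.lookup f x) * ent1 j k y (Poly_Mapping.lookup g y))"
    using keys_verts[OF assms] by (intro sum.cong refl ent_path_term)
  also have "\<dots> = (\<Sum>x\<in>?F. \<Sum>j<N. \<Sum>y\<in>?G.
      ent1 i j x (Poly_Mapping.lookup f x) * ent1 j k y (Poly_Mapping.lookup g y))"
    by (intro sum.cong refl sum.swap)
  also have "\<dots> = (\<Sum>j<N. \<Sum>x\<in>?F. \<Sum>y\<in>?G.
      ent1 i j x (Poly_Mapping.lookup f x) * ent1 j k y (Poly_Mapping.lookup g y))"
    by (rule sum.swap)
  also have "\<dots> = (\<Sum>j<N. ent i j f * ent j k g)"
    by (simp add: ent_def sum_product)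
  finally show ?thesis .
qed

lemma coeff_ent: "coeff (coeff (ent i j f) q) p =
    (\<Sum>x | x \<in> Poly_Mapping.keys f \<and> (fst x, snd (snd x), wdeg dx (fst (snd x)), wdeg dy (fst (snd x))) = (i, j, p, q).
       Poly_Mapping.lookup f x)"
proof -
  have "coeff (coeff (ent i j f) q) p = (\<Sum>x \<in> Poly_Mapping.keys f.
      if (fst x, snd (snd x), wdeg dx (fst (snd x)), wdeg dy (fst (snd x))) = (i, j, p, q)
      then Poly_Mapping.lookup f x else 0)"
    unfolding ent_def coeff_sum by (intro sum.cong refl) (auto simp: ent1_def coeff_bimonom)
  then show ?thesis by (simp add: sum.inter_filter)
qed

abbreviation MR where "MR \<equiv> ring_mat TYPE(complex poly poly) N ()"

definition rep :: "(nat, 'e) path_elem \<Rightarrow> complex poly poly mat" where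
  "rep f = mat N N (\<lambda>(i, j). ent i j f)"

lemma rep_index: "i < N \<Longrightarrow> j < N \<Longrightarrow> rep f $$ (i, j) = ent i j f"
  by (simp add: rep_def)

lemma rep_carrier: "rep f \<in> carrier_mat N N"
  by (simp add: rep_def)

lemma ent_path_scalar: "ent i j (path_scalar G c) = (if i = j \<and> i < N then bimonom 0 0 c else 0)"
proof -
  have "ent i j (path_scalar G c) = (\<Sum>v<N. if v = i then (if i = j then bimonom 0 0 c else 0) else 0)"
    unfolding path_scalar_def ent_sum verts by (intro sum.cong refl) (auto simp: ent1_def)
  then show ?thesis by simp
qed

lemma rep_scalar: "rep (path_scalar G c) = bimonom 0 0 c \<cdot>\<^sub>m 1\<^sub>m N"
  by (rule eq_matI) (auto simp: rep_def ent_path_scalar)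

lemma rep_ring_hom: "ring_hom_ring PA MR rep"
proof (rule ring_hom_ringI2)
  show "ring PA" by (rule PA.ring_axioms)
  show "ring MR" by (rule ring_mat)
  show "rep \<in> Ring.ring_hom PA MR"
  proof (rule ring_hom_memI)
    fix f g assume fg: "f \<in> carrier PA" "g \<in> carrier PA"
    show "rep (f \<otimes>\<^bsub>PA\<^esub> g) = rep f \<otimes>\<^bsub>MR\<^esub> rep g"
      by (rule eq_matI)
         (auto simp: ring_mat_simps rep_def scalar_prod_def ent_mult[OF fg(1)] atLeast0LessThan)
    show "rep (f \<oplus>\<^bsub>PA\<^esub> g) = rep f \<oplus>\<^bsub>MR\<^esub> rep g"
      by (rule eq_matI) (auto simp: ring_mat_simps rep_def ent_add)
  next
    have "bimonom 0 0 1 = (1 :: complex poly poly)" by (simp add: bimonom_def)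
    then show "rep \<one>\<^bsub>PA\<^esub> = \<one>\<^bsub>MR\<^esub>" by (auto simp: rep_scalar ring_mat_simps intro!: eq_matI)
  qed (auto simp: ring_mat_simps rep_carrier)
qed

text \<open>The relations lie in the kernel by homogeneity. Conversely, modulo the relations each
  path can be replaced by a chosen one with the same ends and degree; the total coefficient of each
  chosen path is a coefficient of a matrix entry, hence zero.\<close>

lemma rel_ideal_kernel: "relation_ideal G E = a_kernel PA MR rep"
proof
  interpret H: ring_hom_ring PA MR rep by (rule rep_ring_hom)
  have ker: "f \<in> a_kernel PA MR rep \<longleftrightarrow> f \<in> carrier PA \<and> (\<forall>i<N. \<forall>j<N. ent i j f = 0)" for f
  proof -
    have "rep f = 0\<^sub>m N N \<longleftrightarrow> (\<forall>i<N. \<forall>j<N. ent i j f = 0)"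
      by (auto simp: rep_def mat_eq_iff)
    moreover have "f \<in> a_kernel PA MR rep \<longleftrightarrow> f \<in> carrier PA \<and> rep f = 0\<^sub>m N N"
      unfolding a_kernel_def' ring_mat_simps by blast
    ultimately show ?thesis by blast
  qed
  have "rel_gens \<subseteq> a_kernel PA MR rep"
  proof safe
    fix p q assume pq: "(p, q) \<in> E"
    then obtain i j where ij: "awalk i p j" "awalk i q j" "p \<noteq> []" "q \<noteq> []" using rel_parallel by blast
    have "path_of G p - path_of G q \<in> carrier PA" using rel_gens_closed pq by blast
    moreover have "ent i' j' (path_of G p - path_of G q) = 0" for i' j'
      using rel_deg[OF pq] ij by (simp add: path_of_awalk ent_diff ent1_def)
    ultimately show "path_of G p - path_of G q \<in> a_kernel PA MR rep" by (simp add: ker)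
  qed
  then show "relation_ideal G E \<subseteq> a_kernel PA MR rep"
    unfolding relation_ideal_def by (intro PA.genideal_minimal H.kernel_is_ideal)
  show "a_kernel PA MR rep \<subseteq> relation_ideal G E"
  proof
    fix f assume "f \<in> a_kernel PA MR rep"
    then have f: "f \<in> carrier PA" "\<And>i j. i < N \<Longrightarrow> j < N \<Longrightarrow> ent i j f = 0" by (auto simp: ker)
    let ?K = "Poly_Mapping.keys f"
    define cls where "cls x = (fst x, snd (snd x), wdeg dx (fst (snd x)), wdeg dy (fst (snd x)))"
      for x :: "nat \<times> 'e list \<times> nat"
    define sec where "sec = (\<lambda>(i, j, p, q). (i, SOME x. awalk i x j \<and> wdeg dx x = p \<and> wdeg dy x = q, j))"
    have sec: "Poly_Mapping.single x c - Poly_Mapping.single (sec (cls x)) c \<in> relation_ideal G E"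
      if "x \<in> ?K" for x c
    proof -
      obtain u p v where x: "x = (u, p, v)" by (cases x) auto
      have a: "awalk u p v" using keys_verts(3)[OF f(1) that] x by simp
      let ?S = "SOME y. awalk u y v \<and> wdeg dx y = wdeg dx p \<and> wdeg dy y = wdeg dy p"
      have s: "awalk u ?S v \<and> wdeg dx ?S = wdeg dx p \<and> wdeg dy ?S = wdeg dy p"
        by (rule someI[of _ p]) (use a in simp)
      have "eqv u p ?S v" using s a by (intro eqv_if_same_degree) auto
      \<comment> \<open>Scaling by \<open>c\<close> is expressed as multiplication by
        \<open>c\<close> times the trivial path at \<open>u\<close>, under which an ideal is
        closed.\<close>
      from RI.I_l_closed[OF this[unfolded eqv_def] single_in_PA[of u "[]" u c]] a
      have "path_mult (Poly_Mapping.single (u, [], u) c)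
          (Poly_Mapping.single (u, p, v) 1 - Poly_Mapping.single (u, ?S, v) 1) \<in> relation_ideal G E"
        using awalk_verts[OF a] verts by (simp add: awalk_Nil_iff)
      then show ?thesis
        by (simp add: path_mult_diff_right path_mult_single path_term_def x cls_def sec_def)
    qed
    have "(\<Sum>x\<in>?K. Poly_Mapping.single (sec (cls x)) (Poly_Mapping.lookup f x)) =
        (\<Sum>d\<in>cls ` ?K. \<Sum>x | x \<in> ?K \<and> cls x = d. Poly_Mapping.single (sec (cls x)) (Poly_Mapping.lookup f x))"
      by (rule sum.image_gen) simp
    also have "\<dots> = (\<Sum>d\<in>cls ` ?K. 0)"
    proof (intro sum.cong refl)
      fix d assume "d \<in> cls ` ?K"
      then obtain i j p q where d: "d = (i, j, p, q)" "i < N" "j < N"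
        using keys_verts[OF f(1)] unfolding cls_def by blast
      have single_sum: "(\<Sum>x\<in>A. Poly_Mapping.single k (c x)) = Poly_Mapping.single k (\<Sum>x\<in>A. c x)"
        for A :: "(nat \<times> 'e list \<times> nat) set" and k :: "nat \<times> 'e list \<times> nat" and c :: "nat \<times> 'e list \<times> nat \<Rightarrow> complex"
        by (induction A rule: infinite_finite_induct) (simp_all add: single_add)
      have "(\<Sum>x | x \<in> ?K \<and> cls x = d. Poly_Mapping.single (sec (cls x)) (Poly_Mapping.lookup f x)) =
          (\<Sum>x | x \<in> ?K \<and> cls x = d. Poly_Mapping.single (sec d) (Poly_Mapping.lookup f x))"
        by (intro sum.cong) auto
      also have "\<dots> = Poly_Mapping.single (sec d) (coeff (coeff (ent i j f) q) p)"
        unfolding single_sum coeff_ent cls_def d(1) ..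
      finally show "(\<Sum>x | x \<in> ?K \<and> cls x = d. Poly_Mapping.single (sec (cls x)) (Poly_Mapping.lookup f x)) = 0"
        using f(2) d by simp
    qed
    finally have "(\<Sum>x\<in>?K. Poly_Mapping.single x (Poly_Mapping.lookup f x) -
        Poly_Mapping.single (sec (cls x)) (Poly_Mapping.lookup f x)) = f"
      using path_elem_sum[of f] by (simp add: sum_subtractf)
    moreover have "(\<Sum>x\<in>?K. Poly_Mapping.single x (Poly_Mapping.lookup f x) -
        Poly_Mapping.single (sec (cls x)) (Poly_Mapping.lookup f x)) \<in> relation_ideal G E"
      by (rule RI_sum) (rule sec)
    ultimately show "f \<in> relation_ideal G E" by simp
  qed
qed

text \<open>Surjectivity needs a path for each admissible monomial, which
  \<open>awalk_exists\<close> supplies.\<close>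

lemma rep_image: "rep ` carrier PA = graded_mats N W"
proof safe
  fix f assume f: "f \<in> carrier PA"
  show "rep f \<in> graded_mats N W"
    unfolding graded_mats_def
  proof (intro CollectI conjI allI impI)
    fix i j p q assume ij: "i < N" "j < N" "coeff (coeff (rep f $$ (i, j)) q) p \<noteq> 0"
    let ?cls = "\<lambda>x. (fst x, snd (snd x), wdeg dx (fst (snd x)), wdeg dy (fst (snd x)))"
    have "(\<Sum>x | x \<in> Poly_Mapping.keys f \<and> ?cls x = (i, j, p, q). Poly_Mapping.lookup f x) \<noteq> 0"
      using ij(3) unfolding rep_index[OF ij(1,2)] coeff_ent .
    then have "{x \<in> Poly_Mapping.keys f. ?cls x = (i, j, p, q)} \<noteq> {}" by (metis sum.empty)
    then obtain x where x: "x \<in> Poly_Mapping.keys f" "?cls x = (i, j, p, q)" by blast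
    then show "W i j p q" using W_awalk[OF keys_verts(3)[OF f x(1)]] by auto
  qed (rule rep_carrier)
next
  fix M assume "M \<in> graded_mats N W"
  then have M: "M \<in> carrier_mat N N"
    "\<And>i j p q. i < N \<Longrightarrow> j < N \<Longrightarrow> coeff (coeff (M $$ (i, j)) q) p \<noteq> 0 \<Longrightarrow> W i j p q"
    by (auto simp: graded_mats_def)
  let ?c = "\<lambda>(i, j, p, q). coeff (coeff (M $$ (i, j)) q) p"
  define K where "K = (SIGMA i:{..<N}. SIGMA j:{..<N}. {(p, q). coeff (coeff (M $$ (i, j)) q) p \<noteq> 0})"
  have finK: "finite K" unfolding K_def using finite_coeffs by (intro finite_SigmaI) auto
  have "\<exists>x. awalk i x j \<and> wdeg dx x = p \<and> wdeg dy x = q" if "(i, j, p, q) \<in> K" for i j p q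
    using that M(2) awalk_exists unfolding K_def by auto
  then obtain w where w: "\<And>i j p q. (i, j, p, q) \<in> K \<Longrightarrow>
      awalk i (w i j p q) j \<and> wdeg dx (w i j p q) = p \<and> wdeg dy (w i j p q) = q"
    by metis
  let ?x = "\<lambda>(i, j, p, q). (i, w i j p q, j)"
  define f where "f = (\<Sum>k\<in>K. Poly_Mapping.single (?x k) (?c k))"
  have "Poly_Mapping.keys f \<subseteq> (\<Union>k\<in>K. {?x k})"
    unfolding f_def by (rule order.trans[OF keys_sum]) (auto split: if_splits)
  then have f: "f \<in> carrier PA" using w by (fastforce simp: PA_carrier paths_def)
  have "ent i j f = M $$ (i, j)" if ij: "i < N" "j < N" for i j
  proof (rule poly_poly_eqI)
    fix p q
    have "coeff (coeff (ent i j f) q) p = (\<Sum>k\<in>K. coeff (coeff (ent1 i j (?x k) (?c k)) q) p)"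
      unfolding f_def ent_sum coeff_sum by simp
    also have "\<dots> = (\<Sum>k\<in>K. if k = (i, j, p, q) then ?c (i, j, p, q) else 0)"
      using w by (intro sum.cong refl) (auto simp: ent1_def coeff_bimonom)
    also have "\<dots> = coeff (coeff (M $$ (i, j)) q) p"
      using finK ij by (auto simp: K_def)
    finally show "coeff (coeff (ent i j f) q) p = coeff (coeff (M $$ (i, j)) q) p" .
  qed
  then have "rep f = M" using M(1) by (intro eq_matI) (auto simp: rep_def)
  then show "M \<in> rep ` carrier PA" using f by blast
qed

definition quot_rep :: "(nat, 'e) path_elem set \<Rightarrow> complex poly poly mat" where
  "quot_rep C = the_elem (rep ` C)"

lemma quot_rep_coset:
  assumes "f \<in> carrier PA"
  shows "quot_rep (relation_ideal G E +>\<^bsub>PA\<^esub> f) = rep f"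
proof -
  interpret H: ring_hom_ring PA MR rep by (rule rep_ring_hom)
  show ?thesis unfolding quot_rep_def rel_ideal_kernel by (rule H.the_elem_simp[OF assms])
qed

lemma quot_rep_iso: "quot_rep \<in> ring_iso (PA Quot relation_ideal G E) (MR\<lparr>carrier := graded_mats N W\<rparr>)"
proof -
  interpret H: ring_hom_ring PA MR rep by (rule rep_ring_hom)
  show ?thesis
    using H.FactRing_iso_set_aux unfolding rel_ideal_kernel rep_image quot_rep_def .
qed

end

section \<open>Graded matrix algebras\<close>

definition invariant_polys :: "nat \<Rightarrow> nat \<Rightarrow> complex poly poly set" where
  "invariant_polys r a = {f. \<forall>p q. coeff (coeff f q) p \<noteq> 0 \<longrightarrow> r dvd p + a * q}"

definition scalar_mat :: "nat \<Rightarrow> complex poly poly \<Rightarrow> complex poly poly mat" where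
  "scalar_mat N g = g \<cdot>\<^sub>m 1\<^sub>m N"

lemma scalar_mat_mult:
  assumes "M \<in> carrier_mat N N"
  shows "scalar_mat N g * M = g \<cdot>\<^sub>m M" "M * scalar_mat N g = g \<cdot>\<^sub>m M"
  using assms unfolding scalar_mat_def
  by (auto simp: mult_smult_assoc_mat[of _ N N] mult_smult_distrib[of _ N N])

definition unit_mat :: "nat \<Rightarrow> nat \<Rightarrow> nat \<Rightarrow> complex poly poly \<Rightarrow> complex poly poly mat" where
  "unit_mat N i j f = mat N N (\<lambda>(u, v). if u = i \<and> v = j then f else 0)"

lemma unit_mat_mult:
  assumes "M \<in> carrier_mat N N" "i < N" "j < N" "u < N" "v < N"
  shows "(M * unit_mat N i j f) $$ (u, v) = (if v = j then M $$ (u, i) * f else 0)"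
    "(unit_mat N i j f * M) $$ (u, v) = (if u = i then f * M $$ (j, v) else 0)"
proof -
  have "(M * unit_mat N i j f) $$ (u, v) = (\<Sum>k\<in>{0..<N}. M $$ (u, k) * (if k = i \<and> v = j then f else 0))"
    using assms by (simp add: unit_mat_def scalar_prod_def)
  also have "\<dots> = (\<Sum>k\<in>{0..<N}. if k = i then (if v = j then M $$ (u, i) * f else 0) else 0)"
    by (intro sum.cong) auto
  finally show "(M * unit_mat N i j f) $$ (u, v) = (if v = j then M $$ (u, i) * f else 0)"
    using assms by simp
  have "(unit_mat N i j f * M) $$ (u, v) = (\<Sum>k\<in>{0..<N}. (if u = i \<and> k = j then f else 0) * M $$ (k, v))"
    using assms by (simp add: unit_mat_def scalar_prod_def)
  also have "\<dots> = (\<Sum>k\<in>{0..<N}. if k = j then (if u = i then f * M $$ (j, v) else 0) else 0)"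
    by (intro sum.cong) auto
  finally show "(unit_mat N i j f * M) $$ (u, v) = (if u = i then f * M $$ (j, v) else 0)"
    using assms by simp
qed

lemma coeff_bimonom_mult:
  "coeff (coeff (bimonom k l c * f) q) p = (if k \<le> p \<and> l \<le> q then c * coeff (coeff f (q - l)) (p - k) else 0)"
  by (simp add: bimonom_def coeff_monom_mult)

text \<open>\<open>wt u\<close> is the character of the module at vertex \<open>u\<close>, so only
  its residue modulo \<open>r\<close> counts.\<close>

locale graded_matrix_ring = ring A for A (structure) +
  fixes \<phi> :: "'a \<Rightarrow> complex poly poly mat" and N r a :: nat and wt :: "nat \<Rightarrow> int"
    and W :: "nat \<Rightarrow> nat \<Rightarrow> nat \<Rightarrow> nat \<Rightarrow> bool"
  assumes N: "0 < N" and r: "0 < r"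
    and W: "\<And>u v p q. W u v p q \<longleftrightarrow> int r dvd int p + int a * int q + wt u - wt v"
    and iso: "\<phi> \<in> ring_iso A (ring_mat TYPE(complex poly poly) N () \<lparr>carrier := graded_mats N W\<rparr>)"
begin

lemma phi_hom:
  assumes "x \<in> carrier A" "y \<in> carrier A"
  shows "\<phi> (x \<oplus> y) = \<phi> x + \<phi> y" "\<phi> (x \<otimes> y) = \<phi> x * \<phi> y"
  using ring_iso_memE(2,3)[OF iso assms] by (simp_all add: ring_mat_simps)

lemma phi_one: "\<phi> \<one> = 1\<^sub>m N"
  using ring_iso_memE(4)[OF iso] by (simp add: ring_mat_simps)

lemma phi_bij: "bij_betw \<phi> (carrier A) (graded_mats N W)"
  using ring_iso_memE(5)[OF iso] by simp

lemma phi_inj: "x \<in> carrier A \<Longrightarrow> y \<in> carrier A \<Longrightarrow> \<phi> x = \<phi> y \<Longrightarrow> x = y"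
  using phi_bij by (auto simp: bij_betw_def inj_on_def)

lemma phi_surj: "M \<in> graded_mats N W \<Longrightarrow> \<exists>x \<in> carrier A. \<phi> x = M"
  using phi_bij unfolding bij_betw_def by (metis imageE)

lemma phi_closed:
  assumes "x \<in> carrier A"
  shows "\<phi> x \<in> graded_mats N W" "\<phi> x \<in> carrier_mat N N"
proof -
  show "\<phi> x \<in> graded_mats N W" by (rule bij_betw_apply[OF phi_bij assms])
  then show "\<phi> x \<in> carrier_mat N N" by (simp add: graded_mats_def)
qed

lemma phi_zero: "\<phi> \<zero> = 0\<^sub>m N N"
proof -
  have "\<phi> \<zero> + \<phi> \<zero> = \<phi> \<zero>" using phi_hom(1)[of \<zero> \<zero>] by simp
  moreover have "\<phi> \<zero> \<in> carrier_mat N N" by (rule phi_closed) simp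
  ultimately show ?thesis by (auto simp: mat_eq_iff)
qed

lemma scalar_mat_graded: "scalar_mat N g \<in> graded_mats N W \<longleftrightarrow> g \<in> invariant_polys r a"
proof -
  have *: "W i i p q \<longleftrightarrow> r dvd p + a * q" for i p q
    unfolding W using int_dvd_int_iff[of r "p + a * q"] by simp
  have "scalar_mat N g $$ (i, j) = (if i = j then g else 0)" if "i < N" "j < N" for i j
    using that by (simp add: scalar_mat_def)
  then show ?thesis
    using N * unfolding graded_mats_def invariant_polys_def by (auto simp: scalar_mat_def)
qed

lemma central_if_scalar:
  assumes "z \<in> carrier A" "\<phi> z = scalar_mat N g"
  shows "z \<in> centre A"
  unfolding centre_def using assms
  by (auto intro!: phi_inj simp: phi_hom scalar_mat_mult phi_closed)

lemma unit_mat_graded: "W i j p 0 \<Longrightarrow> unit_mat N i j (bimonom p 0 1) \<in> graded_mats N W"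
  unfolding graded_mats_def by (auto simp: unit_mat_def coeff_bimonom)

text \<open>Commuting with the diagonal idempotents kills the entries off the diagonal. Commuting
  with a power of \<open>x\<close> placed at \<open>(i, 0)\<close> equates two diagonal entries,
  since polynomials have no zero divisors.\<close>

lemma scalar_if_central:
  assumes z: "z \<in> centre A"
  shows "\<phi> z = scalar_mat N (\<phi> z $$ (0, 0))"
proof -
  let ?M = "\<phi> z"
  have zc: "z \<in> carrier A" using z by (rule centreD)
  have M: "?M \<in> carrier_mat N N" by (rule phi_closed[OF zc])
  have comm: "?M * unit_mat N i j (bimonom p 0 1) = unit_mat N i j (bimonom p 0 1) * ?M" if W': "W i j p 0" for i j p
  proof -
    obtain x where "x \<in> carrier A" "\<phi> x = unit_mat N i j (bimonom p 0 1)"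
      using phi_surj[OF unit_mat_graded[OF W']] by blast
    then show ?thesis using centreD(2)[OF z] phi_hom(2) zc by metis
  qed
  have off: "?M $$ (u, i) = 0" if "u < N" "i < N" "u \<noteq> i" for u i
  proof -
    have "W i i 0 0" by (simp add: W)
    from arg_cong[OF comm[OF this], of "\<lambda>M. M $$ (u, i)"] show ?thesis
      using unit_mat_mult[OF M that(2,2,1,2)] that by (simp add: bimonom_def)
  qed
  have diag: "?M $$ (i, i) = ?M $$ (0, 0)" if i: "i < N" for i
  proof -
    \<comment> \<open>As \<open>x\<close> has character 1, a power of \<open>x\<close> alone is
      admissible between any two vertices.\<close>
    define p where "p = nat ((wt 0 - wt i) mod int r)"
    have "int r dvd (wt 0 - wt i) mod int r - (wt 0 - wt i)" by (simp add: mod_eq_dvd_iff[symmetric])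
    then have "W i 0 p 0" using r unfolding W p_def by (simp add: algebra_simps)
    from arg_cong[OF comm[OF this], of "\<lambda>M. M $$ (i, 0)"]
    have "?M $$ (i, i) * bimonom p 0 1 = bimonom p 0 1 * ?M $$ (0, 0)"
      using unit_mat_mult[OF M i N i N] by simp
    moreover have "bimonom p 0 1 \<noteq> 0" by (simp add: bimonom_def)
    ultimately show ?thesis by (simp add: mult.commute)
  qed
  show ?thesis
  proof (rule eq_matI)
    fix i j assume "i < dim_row (scalar_mat N (?M $$ (0, 0)))" "j < dim_col (scalar_mat N (?M $$ (0, 0)))"
    then have "i < N" "j < N" by (simp_all add: scalar_mat_def)
    then show "?M $$ (i, j) = scalar_mat N (?M $$ (0, 0)) $$ (i, j)"
      using off[of i j] diag[of i] by (cases "i = j") (simp_all add: scalar_mat_def)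
  qed (use M in \<open>simp_all add: scalar_mat_def\<close>)
qed

lemma centre_iso:
  "(\<lambda>z. \<phi> z $$ (0, 0)) \<in> ring_iso (centre_ring A) (ring_of_type_algebra \<lparr>carrier := invariant_polys r a\<rparr>)"
proof -
  let ?\<theta> = "\<lambda>z. \<phi> z $$ (0, 0)"
  have index: "scalar_mat N g $$ (0, 0) = g" for g using N by (simp add: scalar_mat_def)
  have inv: "?\<theta> z \<in> invariant_polys r a" if "z \<in> centre A" for z
    using scalar_if_central[OF that] phi_closed(1)[OF centreD(1)[OF that]] scalar_mat_graded by metis
  have "bij_betw ?\<theta> (centre A) (invariant_polys r a)"
    unfolding bij_betw_def
  proof
    show "inj_on ?\<theta> (centre A)"
      using scalar_if_central phi_inj centreD(1) by (intro inj_onI) metis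
    show "?\<theta> ` centre A = invariant_polys r a"
    proof
      show "invariant_polys r a \<subseteq> ?\<theta> ` centre A"
      proof
        fix g assume "g \<in> invariant_polys r a"
        then obtain z where "z \<in> carrier A" "\<phi> z = scalar_mat N g"
          using phi_surj scalar_mat_graded by blast
        then show "g \<in> ?\<theta> ` centre A" using central_if_scalar index by (metis image_eqI)
      qed
    qed (use inv in blast)
  qed
  moreover have "?\<theta> (x \<otimes> y) = ?\<theta> x * ?\<theta> y" if "x \<in> centre A" "y \<in> centre A" for x y
  proof -
    have c: "x \<in> carrier A" "y \<in> carrier A" using that centreD(1) by auto
    have "\<phi> (x \<otimes> y) = ?\<theta> x \<cdot>\<^sub>m \<phi> y"
      using phi_hom(2)[OF c] scalar_if_central[OF that(1)] scalar_mat_mult(1)[OF phi_closed(2)[OF c(2)]] by metis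
    then show ?thesis using phi_closed(2)[OF c(2)] N by simp
  qed
  moreover have "?\<theta> (x \<oplus> y) = ?\<theta> x + ?\<theta> y" if "x \<in> centre A" "y \<in> centre A" for x y
    using phi_hom(1) phi_closed(2)[OF centreD(1)[OF that(1)]]
      phi_closed(2)[OF centreD(1)[OF that(2)]] N that centreD(1) by simp
  moreover have "?\<theta> \<one> = 1" using N by (simp add: phi_one)
  ultimately show ?thesis using inv
    unfolding ring_iso_def
    by (auto simp: centre_ring_def ring_of_type_algebra_def intro!: ring_hom_memI)
qed

lemma fg_central: fg_central_submodules
proof (rule fg_central_submodulesI)
  let ?\<psi> = "\<lambda>x (p, q, i, j). if i < N \<and> j < N then poly.coeff (poly.coeff (\<phi> x $$ (i, j)) q) p else 0"
  show "?\<psi> (x \<oplus> y) k = ?\<psi> x k + ?\<psi> y k" if "x \<in> carrier A" "y \<in> carrier A" for x y k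
    using phi_hom(1)[OF that] phi_closed(2)[OF that(1)] phi_closed(2)[OF that(2)] by (auto split: prod.splits)
  show "x = \<zero>" if x: "x \<in> carrier A" "\<And>k. ?\<psi> x k = 0" for x
  proof (rule phi_inj[OF x(1)])
    have "\<phi> x $$ (i, j) = 0" if "i < N" "j < N" for i j
    proof (rule poly_poly_eqI)
      show "poly.coeff (poly.coeff (\<phi> x $$ (i, j)) q) p = poly.coeff (poly.coeff 0 q) p" for p q
        using x(2)[of "(p, q, i, j)"] that by simp
    qed
    then show "\<phi> x = \<phi> \<zero>"
      unfolding phi_zero using phi_closed(2)[OF x(1)] by (intro eq_matI) auto
  qed simp
  show "finite {k. ?\<psi> x k \<noteq> 0}" for x
  proof (rule finite_subset)
    show "{k. ?\<psi> x k \<noteq> 0} \<subseteq> (\<Union>i<N. \<Union>j<N. (\<lambda>(p, q). (p, q, i, j)) `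
        {(p, q). poly.coeff (poly.coeff (\<phi> x $$ (i, j)) q) p \<noteq> 0})"
      by (force split: if_splits)
  qed (use finite_coeffs in auto)
  show "i < N \<and> j < N" if "?\<psi> x (p, q, i, j) \<noteq> 0" for x p q i j
    using that by (auto split: if_splits)
  show "0 < r" by (rule r)
  fix c k l
  \<comment> \<open>Monomials in the \<open>r\<close>-th powers of \<open>x\<close> and
    \<open>y\<close> are invariant, and their scalar matrices give the translations of
    exponents.\<close>
  have "bimonom (r * k) (r * l) c \<in> invariant_polys r a"
    by (auto simp: invariant_polys_def coeff_bimonom split: if_splits)
  then obtain z where z: "z \<in> carrier A" "\<phi> z = scalar_mat N (bimonom (r * k) (r * l) c)"
    using phi_surj scalar_mat_graded by blast
  show "\<exists>z \<in> centre A. \<forall>x \<in> carrier A. \<forall>p q i j. ?\<psi> (z \<otimes> x) (p, q, i, j) =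
      (if r * k \<le> p \<and> r * l \<le> q then c * ?\<psi> x (p - r * k, q - r * l, i, j) else 0)"
  proof (intro bexI[OF _ central_if_scalar[OF z]] ballI allI)
    fix x p q i j assume x: "x \<in> carrier A"
    have "\<phi> (z \<otimes> x) = bimonom (r * k) (r * l) c \<cdot>\<^sub>m \<phi> x"
      using phi_hom(2)[OF z(1) x] z(2) scalar_mat_mult(1)[OF phi_closed(2)[OF x]] by simp
    then show "?\<psi> (z \<otimes> x) (p, q, i, j) =
        (if r * k \<le> p \<and> r * l \<le> q then c * ?\<psi> x (p - r * k, q - r * l, i, j) else 0)"
      using phi_closed(2)[OF x] by (simp add: coeff_bimonom_mult)
  qed
qed

lemma finiteness: "finite_over_centre A" "noetherian A" "PI_ring A"
  using fg_central fg_central_submodules_imp_finite_over_centre fg_central_submodules_imp_noetherian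
    finite_over_centre_imp_PI_ring by blast+

end

section \<open>Invariants of the cyclic group\<close>

lemma primitive_root_power_eq_1_iff:
  assumes "primitive_root_of_unity r \<epsilon>"
  shows "\<epsilon> ^ m = 1 \<longleftrightarrow> r dvd m"
proof -
  have r: "0 < r" "\<epsilon> ^ r = 1" "\<And>k. 0 < k \<Longrightarrow> k < r \<Longrightarrow> \<epsilon> ^ k \<noteq> 1"
    using assms by (auto simp: primitive_root_of_unity_def)
  have "\<epsilon> ^ m = \<epsilon> ^ (r * (m div r) + m mod r)" by simp
  also have "\<dots> = \<epsilon> ^ (m mod r)" unfolding power_add power_mult r(2) by simp
  finally have "\<epsilon> ^ m = 1 \<longleftrightarrow> \<epsilon> ^ (m mod r) = 1" by simp
  also have "\<dots> \<longleftrightarrow> m mod r = 0" using r(3)[of "m mod r"] r(1) by (cases "m mod r = 0") auto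
  finally show ?thesis by (simp add: dvd_eq_mod_eq_0)
qed

definition diag2 :: "complex \<Rightarrow> complex \<Rightarrow> complex mat" where
  "diag2 l m = mat_of_rows_list 2 [[l, 0], [0, m]]"

lemma diag2_simps [simp]:
  "diag2 l m \<in> carrier_mat 2 2" "diag2 l m $$ (0, 0) = l" "diag2 l m $$ (0, Suc 0) = 0"
  "diag2 l m $$ (Suc 0, 0) = 0" "diag2 l m $$ (Suc 0, Suc 0) = m"
  by (auto simp: diag2_def mat_of_rows_list_def)

lemma diag2_mult: "diag2 l m * diag2 l' m' = diag2 (l * l') (m * m')"
  by (rule eq_matI) (auto simp: diag2_def mat_of_rows_list_def scalar_prod_def less_Suc_eq numeral_2_eq_2)

lemma diag2_one: "diag2 1 1 = 1\<^sub>m 2"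
  by (rule eq_matI) (auto simp: diag2_def mat_of_rows_list_def less_2_cases_iff)

text \<open>The inverse of the generator is its power \<open>r - 1\<close>, so natural exponents
  reach the whole group.\<close>

lemma group_1ra_elem:
  assumes "\<epsilon> ^ r = 1" "0 < r" "M \<in> group_1ra \<epsilon> a"
  shows "\<exists>k. M = diag2 (\<epsilon> ^ k) ((\<epsilon> ^ a) ^ k)"
proof -
  interpret R: ring "ring_mat TYPE(complex) 2 ()" by (rule ring_mat)
  interpret G: group GL2 unfolding GL2_def by (rule R.units_group)
  let ?g = "diag2 \<epsilon> (\<epsilon> ^ a)" and ?h = "diag2 (\<epsilon> ^ (r - 1)) ((\<epsilon> ^ a) ^ (r - 1))"
  have "(\<epsilon> ^ a) ^ r = 1" by (metis assms(1) mult.commute power_mult power_one)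
  then have sq: "\<epsilon> * \<epsilon> ^ (r - 1) = 1" "\<epsilon> ^ a * (\<epsilon> ^ a) ^ (r - 1) = 1"
    using power_minus_mult[OF assms(2), of \<epsilon>] power_minus_mult[OF assms(2), of "\<epsilon> ^ a"] assms(1)
    by (simp_all only: mult.commute)
  have gh: "?g * ?h = 1\<^sub>m 2" "?h * ?g = 1\<^sub>m 2"
    using sq by (simp_all add: diag2_mult diag2_one mult.commute)
  have car: "?g \<in> carrier GL2" "?h \<in> carrier GL2"
    using gh unfolding GL2_def units_of_def Units_def by (auto simp: ring_mat_simps)
  have inv: "inv\<^bsub>GL2\<^esub> ?g = ?h"
    using car gh by (intro G.inv_equality) (auto simp: GL2_def units_of_def ring_mat_simps)
  show ?thesis
    using assms(3) unfolding group_1ra_def diag2_def[symmetric]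
  proof (induction rule: generate.induct)
    case one
    show ?case by (rule exI[of _ 0]) (simp add: diag2_one GL2_def units_of_def ring_mat_simps)
  next
    case (incl h)
    then show ?case by (intro exI[of _ 1]) simp
  next
    case (inv h)
    then show ?case using \<open>inv\<^bsub>GL2\<^esub> ?g = ?h\<close> by (intro exI[of _ "r - 1"]) simp
  next
    case (eng h1 h2)
    then obtain k l where "h1 = diag2 (\<epsilon> ^ k) ((\<epsilon> ^ a) ^ k)" "h2 = diag2 (\<epsilon> ^ l) ((\<epsilon> ^ a) ^ l)" by blast
    then show ?case
      by (intro exI[of _ "k + l"]) (simp add: diag2_mult GL2_def units_of_def ring_mat_simps power_add)
  qed
qed

text \<open>\<open>map_poly f\<close> may lower the degree; summing up to the old degree only adds
  zero terms.\<close>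

lemma poly_map_poly:
  fixes f :: "'a :: zero \<Rightarrow> 'b :: comm_ring_1"
  assumes "f 0 = 0"
  shows "poly (map_poly f p) x = (\<Sum>i\<le>degree p. f (coeff p i) * x ^ i)"
proof -
  have "degree (map_poly f p) \<le> degree p"
    by (rule degree_le) (simp add: coeff_map_poly assms coeff_eq_0)
  then have "poly (map_poly f p) x = (\<Sum>i\<le>degree p. coeff (map_poly f p) i * x ^ i)"
    unfolding poly_altdef by (intro sum.mono_neutral_left) (auto simp: coeff_eq_0)
  then show ?thesis by (simp add: coeff_map_poly assms)
qed

lemma coeff_mat_act_diag2:
  "coeff (coeff (mat_act (diag2 l m) f) q) p = l ^ p * m ^ q * coeff (coeff f q) p"
proof -
  have X: "polyC l * polyX + polyC 0 * polyY = bimonom 1 0 l"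
    by (simp add: polyC_def polyX_def polyY_def bimonom_def monom_altdef)
  have Y: "polyC 0 * polyX + polyC m * polyY = bimonom 0 1 m"
    by (simp add: polyC_def polyX_def polyY_def bimonom_def monom_altdef)
  have pw: "bimonom p q c ^ k = bimonom (p * k) (q * k) (c ^ k)" for p q c k
    by (simp add: bimonom_def monom_power)
  have C: "polyC c = bimonom 0 0 c" for c by (simp add: polyC_def bimonom_def monom_0)
  have C0: "polyC 0 = 0" by (simp add: C)
  have inner: "poly (map_poly polyC h) (bimonom 1 0 l) = (\<Sum>p\<le>degree h. bimonom p 0 (coeff h p * l ^ p))" for h
    unfolding poly_map_poly[of polyC, OF C0] by (intro sum.cong refl) (simp add: C pw bimonom_mult)
  let ?F = "\<lambda>h. poly (map_poly polyC h) (bimonom 1 0 l)"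
  have F0: "?F 0 = 0" by simp
  have "mat_act (diag2 l m) f = poly (map_poly ?F f) (bimonom 0 1 m)"
    unfolding mat_act_def poly_subst_def using X Y by simp
  also have "\<dots> = (\<Sum>q\<le>degree f. \<Sum>p\<le>degree (coeff f q). bimonom p q (coeff (coeff f q) p * l ^ p * m ^ q))"
    unfolding poly_map_poly[of ?F, OF F0]
    by (intro sum.cong refl, subst inner) (simp add: pw sum_distrib_right bimonom_mult)
  finally have "coeff (coeff (mat_act (diag2 l m) f) q) p =
      (\<Sum>q'\<le>degree f. \<Sum>p'\<le>degree (coeff f q'). if p' = p \<and> q' = q then l ^ p * m ^ q * coeff (coeff f q) p else 0)"
    by (simp add: coeff_sum coeff_bimonom) (intro sum.cong refl, auto)
  also have "\<dots> = (\<Sum>q'\<le>degree f. if q' = q then (\<Sum>p'\<le>degree (coeff f q). if p' = p then l ^ p * m ^ q * coeff (coeff f q) p else 0) else 0)"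
    by (intro sum.cong refl) auto
  also have "\<dots> = l ^ p * m ^ q * coeff (coeff f q) p"
    by (auto simp: coeff_eq_0 not_le)
  finally show ?thesis .
qed

text \<open>Each monomial is an eigenvector of the generator, with eigenvalue
  \<open>\<epsilon> ^ (p + a * q)\<close>, so invariance can be tested coefficient by
  coefficient.\<close>

lemma invariants_eq:
  assumes "primitive_root_of_unity r \<epsilon>"
  shows "{f. \<forall>M \<in> group_1ra \<epsilon> a. mat_act M f = f} = invariant_polys r a"
proof safe
  fix f assume *: "\<forall>M \<in> group_1ra \<epsilon> a. mat_act M f = f"
  have "diag2 \<epsilon> (\<epsilon> ^ a) \<in> group_1ra \<epsilon> a"
    unfolding group_1ra_def diag2_def by (intro generate.incl) simp
  then have "mat_act (diag2 \<epsilon> (\<epsilon> ^ a)) f = f" using * by blast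
  then have "\<epsilon> ^ p * (\<epsilon> ^ a) ^ q * coeff (coeff f q) p = coeff (coeff f q) p" for p q
    using coeff_mat_act_diag2 by metis
  then have "\<epsilon> ^ (p + a * q) = 1" if "coeff (coeff f q) p \<noteq> 0" for p q
    using that by (metis mult_cancel_right1 power_add power_mult)
  then show "f \<in> invariant_polys r a"
    using primitive_root_power_eq_1_iff[OF assms] by (simp add: invariant_polys_def)
next
  fix f M assume f: "f \<in> invariant_polys r a" and "M \<in> group_1ra \<epsilon> a"
  then obtain k where M: "M = diag2 (\<epsilon> ^ k) ((\<epsilon> ^ a) ^ k)"
    using assms group_1ra_elem[of \<epsilon> r M a] by (auto simp: primitive_root_of_unity_def)
  show "mat_act M f = f"
  proof (rule poly_poly_eqI)
    fix p q
    have "(\<epsilon> ^ k) ^ p * ((\<epsilon> ^ a) ^ k) ^ q = (\<epsilon> ^ (p + a * q)) ^ k"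
      by (simp add: power_mult[symmetric] power_add[symmetric] algebra_simps)
    then show "coeff (coeff (mat_act M f) q) p = coeff (coeff f q) p"
      using f primitive_root_power_eq_1_iff[OF assms, of "p + a * q"]
      by (cases "coeff (coeff f q) p = 0") (auto simp: M coeff_mat_act_diag2 invariant_polys_def)
  qed
qed

section \<open>Quivers with the arrows of a reconstruction algebra\<close>

text \<open>What the cases \<open>n = 1\<close> and \<open>n \<ge> 2\<close> have in common, despite
  their different arrows. At vertex 0, \<open>rel_0\<close> asks for a relation between
  \<open>c0\<close> and \<open>a0\<close> at every corner of every other vertex.\<close>

locale hj_quiver = hj_series r a n \<alpha> I J + fin_digraph G
  for r a n \<alpha> I J and G :: "(nat, 'e) pre_digraph" +
  fixes dx dy :: "'e \<Rightarrow> nat" and E :: "('e list \<times> 'e list) set" and c0 a0 :: 'e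
    and out :: "nat \<Rightarrow> nat \<Rightarrow> 'e"
  assumes verts: "verts G = {..<Suc n}"
    and arcs_0: "{e \<in> arcs G. tail G e = 0} = {c0, a0}"
    and deg_0: "dx c0 = 1" "dy c0 = 0" "dx a0 = 0" "dy a0 = 1"
    and head_0: "head G c0 = n" "head G a0 = 1"
    and arcs_out: "\<And>t. 1 \<le> t \<Longrightarrow> t \<le> n \<Longrightarrow> {e \<in> arcs G. tail G e = t} = out t ` {..<\<alpha> t}"
    and deg_out: "\<And>t s. 1 \<le> t \<Longrightarrow> t \<le> n \<Longrightarrow> s < \<alpha> t \<Longrightarrow>
      dx (out t s) = hj_series.Xd I t s \<and> dy (out t s) = hj_series.Yd J t s"
    and head_out: "\<And>t s. 1 \<le> t \<Longrightarrow> t \<le> n \<Longrightarrow> s < \<alpha> t \<Longrightarrow> head G (out t s) =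
      (if s = 0 then t - 1 else if s = \<alpha> t - 1 then (if t = n then 0 else t + 1) else 0)"
    and rel_out: "\<And>t s. 1 \<le> t \<Longrightarrow> t \<le> n \<Longrightarrow> s + 2 \<le> \<alpha> t \<Longrightarrow>
      \<exists>x y. ((out t s # x, out t (s + 1) # y) \<in> E \<or> (out t (s + 1) # y, out t s # x) \<in> E) \<and>
        wdeg dx (out t s # x) = hj_series.Xd I t s \<and> wdeg dy (out t s # x) = hj_series.Yd J t (s + 1)"
    and rel_0: "\<And>t s. 1 \<le> t \<Longrightarrow> t \<le> n \<Longrightarrow> s + 2 \<le> \<alpha> t \<Longrightarrow>
      \<exists>x y. ((a0 # x, c0 # y) \<in> E \<or> (c0 # y, a0 # x) \<in> E) \<and>
        wdeg dx (a0 # x) = hj_series.Xd I t s \<and> wdeg dy (a0 # x) = hj_series.Yd J t (s + 1)"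
    and rel_deg: "\<And>x y. (x, y) \<in> E \<Longrightarrow> wdeg dx x = wdeg dx y \<and> wdeg dy x = wdeg dy y"
    and rel_parallel: "\<And>x y. (x, y) \<in> E \<Longrightarrow> x \<noteq> [] \<and> y \<noteq> [] \<and> (\<exists>i j. awalk i x j \<and> awalk i y j)"
begin

lemma arc_cases:
  assumes "e \<in> arcs G"
  obtains "tail G e = 0" "e = c0" | "tail G e = 0" "e = a0"
    | t s where "1 \<le> t" "t \<le> n" "tail G e = t" "s < \<alpha> t" "e = out t s"
proof (cases "tail G e = 0")
  case True
  then have "e \<in> {c0, a0}" using assms arcs_0 by blast
  then show thesis using that True by blast
next
  case False
  then have t: "1 \<le> tail G e" "tail G e \<le> n" using tail_in_verts[OF assms] verts by auto
  then have "e \<in> out (tail G e) ` {..<\<alpha> (tail G e)}" using arcs_out[OF t] assms by blast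
  then show thesis using that(3)[OF t refl] by blast
qed

lemma arc_0: "c0 \<in> arcs G" "a0 \<in> arcs G" "tail G c0 = 0" "tail G a0 = 0"
  using arcs_0 by blast+

lemma arc_out: "1 \<le> t \<Longrightarrow> t \<le> n \<Longrightarrow> s < \<alpha> t \<Longrightarrow> out t s \<in> arcs G \<and> tail G (out t s) = t"
  using arcs_out by blast

lemma lat_r: "lat (int r) 0"
  by (simp add: lat_def)

text \<open>Every arrow has the character prescribed by its ends. This yields \<open>W_step\<close>:
  admissibility is unaffected by removing a first arrow.\<close>

lemma lat_arc:
  assumes "e \<in> arcs G"
  shows "lat (int (dx e) + int (I (tail G e)) - int (I (head G e))) (int (dy e))"
  using assms
proof (cases rule: arc_cases)
  case 1
  then show ?thesis using lat_r I0 In deg_0 head_0 by simp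
next
  case 2
  then show ?thesis using lat_diff[OF lat_IJ[of 0] lat_IJ[of 1]] I0 I1 J0 J1 deg_0 head_0 n by simp
next
  case (3 t s)
  note d = deg_out[OF 3(1,2,4)] and h = head_out[OF 3(1,2,4)]
  have IS: "I (Suc t) < I t" "J t < J (Suc t)" using I_less J_less 3 by auto
  consider "s = 0" | "s = \<alpha> t - 1" "s \<noteq> 0" | "1 \<le> s" "s + 2 \<le> \<alpha> t" using 3(4) by linarith
  then show ?thesis
  proof cases
    case 1
    have "I t < I (t - 1)" using I_less[of "t - 1"] 3 by simp
    then show ?thesis using 1 3 d h by (simp add: Xd_def lat_def)
  next
    case 2
    have X0: "Xd t s = 0" using X_last 3 2 by simp
    have s1: "1 \<le> s" using 2 by simp
    have "int (Yd t s) = int (J (Suc t)) - int (J t)"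
      using int_Y(1)[OF 3(1,2) s1] Jrec_int[OF 3(1,2)] 2 alpha[OF 3(1,2)] 
      by (simp add: of_nat_diff algebra_simps)
    moreover have "lat (int (I t) - int (I (Suc t))) (int (J (Suc t)) - int (J t))"
      using lat_diff[OF lat_IJ[of t] lat_IJ[of "Suc t"]] 3 by simp
    moreover from lat_diff[OF this lat_r]
    have "t = n \<Longrightarrow> lat (int (I t) - int r) (int (J (Suc t)) - int (J t))" using ISn by simp
    ultimately show ?thesis using 2 3 d h X0 I0 by auto
  next
    case m: 3
    have "lat (int (I (t - 1)) - int s * int (I t) - int r) (- int (J (t - 1)) - int s * - int (J t) - 0)"
      using 3 by (intro lat_diff lat_mult lat_IJ lat_r) auto
    moreover have "int (dx e) + int (I (tail G e)) - int (I (head G e)) =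
        int (I (t - 1)) - int s * int (I t) - int r"
      using m 3 d h int_X(1)[OF 3(1,2) m(2)] I0 by (auto simp: algebra_simps)
    moreover have "int (dy e) = - int (J (t - 1)) - int s * - int (J t) - 0"
      using m 3 d int_Y(1)[OF 3(1,2) m(1)] by simp
    ultimately show ?thesis by (simp only:)
  qed
qed

lemma lat_shift: "lat u v \<Longrightarrow> lat (u + u') (v + v') \<longleftrightarrow> lat u' v'"
  using lat_add[of u v u' v'] lat_diff[of "u + u'" "v + v'" u v] by auto

lemma W_step:
  assumes "e \<in> arcs G"
  shows "W (tail G e) v (dx e + p) (dy e + q) \<longleftrightarrow> W (head G e) v p q"
  using lat_shift[OF lat_arc[OF assms], of "int p + int (I (head G e)) - int (I v)" "int q"]
  unfolding W_def by (simp add: algebra_simps)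

lemma deg_pos: "e \<in> arcs G \<Longrightarrow> 0 < dx e + dy e"
proof (erule arc_cases)
  fix t s assume *: "1 \<le> t" "t \<le> n" "s < \<alpha> t" "e = out t s"
  show "0 < dx e + dy e"
  proof (cases "s = 0")
    case True
    then show ?thesis using deg_out[OF *(1-3)] *(4) int_X(2)[OF *(1,2), of 0] alpha[OF *(1,2)] by simp
  next
    case False
    then show ?thesis using deg_out[OF *(1-3)] *(4) int_Y(2)[OF *(1,2), of s] by simp
  qed
qed (simp_all add: deg_0)

lemma rel_step_sym: "rel_step E dx dy p q e f \<Longrightarrow> rel_step E dx dy p q f e"
  unfolding rel_step_def using rel_deg by (metis (no_types, lifting))

lemma rel_steps_sym: "(rel_step E dx dy p q)\<^sup>*\<^sup>* e f \<Longrightarrow> (rel_step E dx dy p q)\<^sup>*\<^sup>* f e"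
  using rel_step_sym by (metis symp_rtranclp sympD sympI)

text \<open>The intermediate corners \<open>(Xd t k, Yd t (k + 1))\<close> with
  \<open>s \<le> k < s'\<close> all lie below \<open>(p, q)\<close>, because \<open>Xd\<close>
  decreases and \<open>Yd\<close> increases along the arrows.\<close>

lemma rel_steps_out:
  assumes t: "1 \<le> t" "t \<le> n" and p: "Xd t s \<le> p" and q: "Yd t s' \<le> q" and "s \<le> s'" "s' < \<alpha> t"
  shows "(rel_step E dx dy p q)\<^sup>*\<^sup>* (out t s) (out t s')"
  using assms(5,6,4)
proof (induction s' rule: dec_induct)
  case (step k)
  have "Yd t k \<le> q" using Y_mono[of k "Suc k" t] step.prems by simp
  then have "(rel_step E dx dy p q)\<^sup>*\<^sup>* (out t s) (out t k)" using step by simp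
  moreover obtain x y where "(out t k # x, out t (k + 1) # y) \<in> E \<or> (out t (k + 1) # y, out t k # x) \<in> E"
      "wdeg dx (out t k # x) = Xd t k" "wdeg dy (out t k # x) = Yd t (k + 1)"
    using rel_out[OF t, of k] step.prems by auto
  then have "rel_step E dx dy p q (out t k) (out t (Suc k))"
    unfolding rel_step_def using step X_antimono[of s k t] p by (intro exI[of _ x] exI[of _ y]) auto
  ultimately show ?case by simp
qed simp

lemma rel_step_0:
  assumes "v \<le> n" "W 0 v p q" "1 \<le> p" "1 \<le> q"
  shows "rel_step E dx dy p q a0 c0"
proof -
  obtain t s where ts: "1 \<le> t" "t \<le> n" "s + 2 \<le> \<alpha> t" "Xd t s \<le> p" "Yd t (s + 1) \<le> q"
    using corner_below[OF assms] by blast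
  then show ?thesis using rel_0[OF ts(1-3)] unfolding rel_step_def by metis
qed

lemma monomial_presentation: "monomial_presentation G (Suc n) dx dy W E"
proof
  show "verts G = {..<Suc n}" by (rule verts)
  show "W u v 0 0 \<longleftrightarrow> u = v" if "u < Suc n" "v < Suc n" for u v using W_zero that by simp
  show "W (tail G e) v (dx e + p) (dy e + q) \<longleftrightarrow> W (head G e) v p q" if "e \<in> arcs G" for e v p q
    by (rule W_step[OF that])
  show "0 < dx e + dy e" if "e \<in> arcs G" for e by (rule deg_pos[OF that])
  show "\<exists>e \<in> arcs G. tail G e = u \<and> dx e \<le> p \<and> dy e \<le> q"
    if uv: "u < Suc n" "v < Suc n" "W u v p q" "(p, q) \<noteq> (0, 0)" for u v p q
  proof (cases "u = 0")
    case True
    show ?thesis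
    proof (cases "p = 0")
      case False
      then show ?thesis using True arc_0 deg_0 by (intro bexI[of _ c0]) auto
    next
      case p: True
      then show ?thesis using True arc_0 deg_0 uv(4) by (intro bexI[of _ a0]) auto
    qed
  next
    case False
    then obtain s where "s < \<alpha> u" "Xd u s \<le> p" "Yd u s \<le> q" using arrow_below[of u v p q] uv by auto
    then show ?thesis using False uv arc_out[of u s] deg_out[of u s] by (intro bexI[of _ "out u s"]) auto
  qed
  show "(rel_step E dx dy p q)\<^sup>*\<^sup>* e f"
    if uv: "u < Suc n" "v < Suc n" "W u v p q" and ef: "e \<in> arcs G" "f \<in> arcs G" "tail G e = u" "tail G f = u"
      and deg: "dx e \<le> p" "dy e \<le> q" "dx f \<le> p" "dy f \<le> q" for u v p q e f
  proof (cases "u = 0")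
    case True
    then have "e \<in> {c0, a0}" "f \<in> {c0, a0}" using arcs_0 ef by blast+
    moreover have "rel_step E dx dy p q a0 c0" if "1 \<le> p" "1 \<le> q"
      using rel_step_0[of v p q] that uv True by simp
    ultimately show ?thesis using deg deg_0 rel_step_sym by auto
  next
    case False
    then have u: "1 \<le> u" "u \<le> n" using uv by auto
    then obtain s s' where s: "e = out u s" "s < \<alpha> u" "f = out u s'" "s' < \<alpha> u"
      using arcs_out[OF u] ef by blast
    show ?thesis
    proof (cases "s \<le> s'")
      case True
      then show ?thesis using rel_steps_out[OF u, of s p s' q] s deg deg_out[OF u] by simp
    next
      case False
      then show ?thesis using rel_steps_out[OF u, of s' p s q] s deg deg_out[OF u] rel_steps_sym by simp
    qed
  qed
qed (use rel_deg rel_parallel in blast)+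

end

section \<open>Continued fractions and the two series\<close>

text \<open>Continuants: \<open>hj_value \<alpha>s\<close> is the quotient of
  \<open>hj_num \<alpha>s\<close> by \<open>hj_num (tl \<alpha>s)\<close>, for which the empty list
  must have value 1.\<close>

fun hj_num :: "nat list \<Rightarrow> int" where
  "hj_num [] = 1"
| "hj_num [\<alpha>] = int \<alpha>"
| "hj_num (\<alpha> # \<beta> # \<alpha>s) = int \<alpha> * hj_num (\<beta> # \<alpha>s) - hj_num \<alpha>s"

lemma hj_num_less:
  assumes "\<alpha>s \<noteq> []" "\<forall>\<alpha> \<in> set \<alpha>s. \<alpha> \<ge> 2"
  shows "0 < hj_num (tl \<alpha>s) \<and> hj_num (tl \<alpha>s) < hj_num \<alpha>s"
  using assms
proof (induction \<alpha>s rule: hj_num.induct)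
  case (3 \<alpha> \<beta> \<alpha>s)
  then have *: "0 < hj_num \<alpha>s" "hj_num \<alpha>s < hj_num (\<beta> # \<alpha>s)" by auto
  have "2 * hj_num (\<beta> # \<alpha>s) \<le> int \<alpha> * hj_num (\<beta> # \<alpha>s)"
    using * "3.prems"(2) by (intro mult_right_mono) auto
  then show ?case using * unfolding hj_num.simps list.sel by linarith
qed auto

lemma coprime_hj_num: "\<alpha>s \<noteq> [] \<Longrightarrow> coprime (hj_num \<alpha>s) (hj_num (tl \<alpha>s))"
proof (induction \<alpha>s rule: hj_num.induct)
  case (3 \<alpha> \<beta> \<alpha>s)
  then have "coprime (hj_num (\<beta> # \<alpha>s)) (hj_num \<alpha>s)" by simp
  then have "gcd (int \<alpha> * hj_num (\<beta> # \<alpha>s) - hj_num \<alpha>s) (hj_num (\<beta> # \<alpha>s)) = 1"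
    by (metis coprime_iff_gcd_eq_1 gcd.commute gcd_diff2 gcd_mult_distrib_int gcd_add_mult mult.commute add_uminus_conv_diff gcd_neg2)
  then show ?case by (simp add: coprime_iff_gcd_eq_1)
qed auto

lemma hj_value_num:
  assumes "\<alpha>s \<noteq> []" "\<forall>\<alpha> \<in> set \<alpha>s. \<alpha> \<ge> 2"
  shows "hj_value \<alpha>s * of_int (hj_num (tl \<alpha>s)) = of_int (hj_num \<alpha>s)"
  using assms
proof (induction \<alpha>s rule: hj_num.induct)
  case (3 \<alpha> \<beta> \<alpha>s)
  have IH: "hj_value (\<beta> # \<alpha>s) * of_int (hj_num \<alpha>s) = of_int (hj_num (\<beta> # \<alpha>s))" using 3 by simp
  have v: "hj_value (\<beta> # \<alpha>s) > 1" using hj_value_gt_1[of "\<beta> # \<alpha>s"] 3 by simp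
  then have "1 / hj_value (\<beta> # \<alpha>s) * of_int (hj_num (\<beta> # \<alpha>s)) = of_int (hj_num \<alpha>s)"
    unfolding IH[symmetric] by simp
  then show ?case by (simp add: left_diff_distrib)
qed auto

text \<open>Neighbouring continuants are coprime, so two reduced fractions with positive terms
  represent the same number.\<close>

lemma hj_num_expansion:
  assumes "is_hj_expansion r a \<alpha>s" "coprime r a" "1 \<le> a"
  shows "hj_num \<alpha>s = int r" "hj_num (tl \<alpha>s) = int a"
proof -
  have ne: "\<alpha>s \<noteq> []" "\<forall>\<alpha> \<in> set \<alpha>s. \<alpha> \<ge> 2" "hj_value \<alpha>s = of_nat r / of_nat a"
    using assms(1) by (auto simp: is_hj_expansion_def)
  have "of_nat r / of_nat a * of_int (hj_num (tl \<alpha>s)) = (of_int (hj_num \<alpha>s) :: rat)"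
    using hj_value_num[OF ne(1,2)] ne(3) by simp
  then have "of_nat r * of_int (hj_num (tl \<alpha>s)) = of_int (hj_num \<alpha>s) * (of_nat a :: rat)"
    using assms(3) by (simp add: field_simps)
  then have "of_int (int r * hj_num (tl \<alpha>s)) = (of_int (hj_num \<alpha>s * int a) :: rat)" by simp
  then have eq: "int r * hj_num (tl \<alpha>s) = hj_num \<alpha>s * int a" by (simp only: of_int_eq_iff)
  note pos = hj_num_less[OF ne(1,2)]
  have "coprime (int r) (int a)" using assms(2) by simp
  moreover have "\<bar>int r\<bar> * \<bar>hj_num (tl \<alpha>s)\<bar> = \<bar>hj_num \<alpha>s\<bar> * \<bar>int a\<bar>" using eq pos by simp
  ultimately have "\<bar>int r\<bar> = \<bar>hj_num \<alpha>s\<bar> \<and> \<bar>hj_num (tl \<alpha>s)\<bar> = \<bar>int a\<bar>"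
    using coprime_hj_num[OF ne(1)] coprime_crossproduct_int[of "int r" "int a" "hj_num \<alpha>s" "hj_num (tl \<alpha>s)"]
    by (simp add: coprime_commute)
  then show "hj_num \<alpha>s = int r" "hj_num (tl \<alpha>s) = int a" using pos by auto
qed

text \<open>The value 0 beyond the end makes the recurrence hold up to \<open>t = n\<close>.\<close>

definition hj_I :: "nat list \<Rightarrow> nat \<Rightarrow> nat" where
  "hj_I \<alpha>s t = (if t \<le> length \<alpha>s then nat (hj_num (drop t \<alpha>s)) else 0)"

text \<open>By \<open>hj_J_less\<close> the truncated subtraction loses nothing in the range used,
  where all coefficients are at least 2.\<close>

fun hj_J :: "nat list \<Rightarrow> nat \<Rightarrow> nat" where
  "hj_J \<alpha>s 0 = 0"
| "hj_J \<alpha>s (Suc 0) = 1"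
| "hj_J \<alpha>s (Suc (Suc t)) = \<alpha>s ! t * hj_J \<alpha>s (Suc t) - hj_J \<alpha>s t"

lemma hj_J_less:
  assumes "\<forall>\<alpha> \<in> set \<alpha>s. \<alpha> \<ge> 2"
  shows "t \<le> length \<alpha>s \<Longrightarrow> hj_J \<alpha>s t < hj_J \<alpha>s (Suc t)"
proof (induction t)
  case (Suc t)
  have "2 * hj_J \<alpha>s (Suc t) \<le> \<alpha>s ! t * hj_J \<alpha>s (Suc t)"
    using assms Suc.prems by (intro mult_right_mono) auto
  moreover have "hj_J \<alpha>s t < hj_J \<alpha>s (Suc t)" using Suc by simp
  ultimately show ?case unfolding hj_J.simps by linarith
qed simp

lemma hj_series_hj:
  assumes "is_hj_expansion r a \<alpha>s" "coprime r a" "1 \<le> a"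
  shows "hj_series r a (hj_len \<alpha>s) (hj_coef \<alpha>s) (hj_I \<alpha>s) (hj_J \<alpha>s)"
proof
  have ne: "\<alpha>s \<noteq> []" "\<forall>\<alpha> \<in> set \<alpha>s. \<alpha> \<ge> 2" using assms(1) by (auto simp: is_hj_expansion_def)
  note num = hj_num_expansion[OF assms]
  show "1 \<le> hj_len \<alpha>s" using ne by (simp add: hj_len_def Suc_le_eq)
  show "2 \<le> hj_coef \<alpha>s t" if "1 \<le> t" "t \<le> hj_len \<alpha>s" for t
    using ne that by (simp add: hj_coef_def hj_len_def)
  show "hj_I \<alpha>s 0 = r" using num by (simp add: hj_I_def)
  show "hj_I \<alpha>s 1 = a" using num ne by (cases \<alpha>s) (auto simp: hj_I_def)
  show "hj_I \<alpha>s (hj_len \<alpha>s) = 1" "hj_I \<alpha>s (Suc (hj_len \<alpha>s)) = 0" by (simp_all add: hj_I_def hj_len_def)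
  show "coprime r a" by fact
  fix t assume t: "1 \<le> t" "t \<le> hj_len \<alpha>s"
  have d1: "drop (t - 1) \<alpha>s = hj_coef \<alpha>s t # drop t \<alpha>s"
    using t Cons_nth_drop_Suc[of "t - 1" \<alpha>s] by (simp add: hj_len_def hj_coef_def)
  have pos: "0 < hj_num (drop k \<alpha>s)" for k
    using hj_num_less[of "drop k \<alpha>s"] ne(2) by (cases "drop k \<alpha>s = []") (force dest: in_set_dropD)+
  show "hj_I \<alpha>s (t - 1) + hj_I \<alpha>s (t + 1) = hj_coef \<alpha>s t * hj_I \<alpha>s t"
  proof (cases "t = hj_len \<alpha>s")
    case True
    then have "drop t \<alpha>s = []" by (simp add: hj_len_def)
    then show ?thesis using True d1 by (simp add: hj_I_def hj_len_def)
  next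
    case False
    then have d2: "drop t \<alpha>s = \<alpha>s ! t # drop (Suc t) \<alpha>s"
      using t Cons_nth_drop_Suc[of t \<alpha>s] by (simp add: hj_len_def)
    have "hj_num (drop (t - 1) \<alpha>s) = int (hj_coef \<alpha>s t) * hj_num (drop t \<alpha>s) - hj_num (drop (Suc t) \<alpha>s)"
      unfolding d1 d2 by simp
    then have "int (hj_I \<alpha>s (t - 1) + hj_I \<alpha>s (t + 1)) = int (hj_coef \<alpha>s t * hj_I \<alpha>s t)"
      using t False le_trans[OF diff_le_self[of t 1] t(2)] pos[of t] pos[of "t - 1"] pos[of "Suc t"] by (simp add: hj_I_def hj_len_def)
    then show ?thesis by (simp only: of_nat_eq_iff)
  qed
  obtain k where k: "t = Suc k" using t by (cases t) auto
  have "hj_J \<alpha>s k < hj_J \<alpha>s (Suc k)" using hj_J_less[OF ne(2), of k] t k by (simp add: hj_len_def)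
  moreover have "1 * hj_J \<alpha>s (Suc k) \<le> \<alpha>s ! k * hj_J \<alpha>s (Suc k)"
  proof (rule mult_right_mono)
    have "\<alpha>s ! k \<in> set \<alpha>s" using t k by (simp add: hj_len_def)
    then show "1 \<le> \<alpha>s ! k" using ne(2) by fastforce
  qed simp
  ultimately have "hj_J \<alpha>s k \<le> \<alpha>s ! k * hj_J \<alpha>s (Suc k)" by linarith
  then show "hj_J \<alpha>s (t - 1) + hj_J \<alpha>s (t + 1) = hj_coef \<alpha>s t * hj_J \<alpha>s t"
    using k by (simp add: hj_coef_def)
qed simp_all

section \<open>The degrees of the arrows of the reconstruction algebra\<close>

text \<open>The monomials \<open>x\<^bsup>kdeg_x \<sigma>\<^esup> y\<^bsup>kdeg_y \<sigma>\<^esup>\<close> for \<open>0 \<le> \<sigma> \<le> \<gamma> + 2\<close> generate the invariant ring. For \<open>n \<ge> 2\<close> the arrow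
  \<open>k\<^sub>\<sigma>\<close> has degree \<open>(kdeg_x (\<sigma> + 1), kdeg_y \<sigma>)\<close>, so that \<open>A\<^sub>0\<^sub>l k\<^sub>\<sigma>\<close> is the generator
  with index \<open>\<sigma> + 1\<close> and \<open>C\<^sub>0\<^sub>l k\<^sub>\<sigma>\<close> the one with index \<open>\<sigma>\<close>, where \<open>l = l\<^sub>\<sigma>\<close>.\<close>

context
  fixes \<alpha>s :: "nat list"
begin

definition kdeg_x :: "nat \<Rightarrow> nat" where
  "kdeg_x \<sigma> = (\<Sum>\<tau> = \<sigma>..hj_gamma \<alpha>s + 1. hj_I \<alpha>s (ktail \<alpha>s \<tau>))"

definition kdeg_y :: "nat \<Rightarrow> nat" where
  "kdeg_y \<sigma> = (\<Sum>\<tau> < \<sigma>. hj_J \<alpha>s (ktail \<alpha>s \<tau>))"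

text \<open>The arrow from 0 to \<open>n\<close> has degree \<open>x\<close>, as
  \<open>I n = 1\<close>. For \<open>n = 1\<close> the arrows from 1 to 0 carry all monomials of
  total degree \<open>r - 1\<close>, in order.\<close>

fun arrow_x :: "arrow \<Rightarrow> nat" where
  "arrow_x (Cw i j) = (if i = 0 then 1 else hj_I \<alpha>s (i - 1) - hj_I \<alpha>s i)"
| "arrow_x (Acw i j) = 0"
| "arrow_x (Cw1 m) = hj_I \<alpha>s 0 - m"
| "arrow_x (Acw1 m) = 2 - m"
| "arrow_x (Ext s) = (if hj_len \<alpha>s = 1 then hj_I \<alpha>s 0 - 2 - s else kdeg_x (s + 1))"

fun arrow_y :: "arrow \<Rightarrow> nat" where
  "arrow_y (Cw i j) = 0"
| "arrow_y (Acw i j) = hj_J \<alpha>s (i + 1) - hj_J \<alpha>s i"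
| "arrow_y (Cw1 m) = m - 1"
| "arrow_y (Acw1 m) = m - 1"
| "arrow_y (Ext s) = (if hj_len \<alpha>s = 1 then s + 1 else kdeg_y s)"

text \<open>An offset: the extra arrows at \<open>t\<close> are those with indices from
  \<open>ext_count t + 1\<close> to \<open>ext_count (t + 1)\<close>. This replaces the maxima and
  minima in \<open>uidx\<close>, \<open>vidx\<close> and \<open>Vidx\<close>.\<close>

definition ext_count :: "nat \<Rightarrow> nat" where
  "ext_count t = (\<Sum>i = 1..<t. hj_coef \<alpha>s i - 2)"

text \<open>The order is such that the \<open>x\<close>-degree decreases and the \<open>y\<close>-degree increases with \<open>s\<close>.\<close>

definition out_arrow :: "nat \<Rightarrow> nat \<Rightarrow> arrow" where
  "out_arrow t s =
     (if hj_len \<alpha>s = 1 then (if s = 0 then Cw1 1 else if s = 1 then Cw1 2 else Ext (s - 1))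
      else if s = 0 then Cw t (t - 1) else if s = hj_coef \<alpha>s t - 1 then Acw t (acw_next \<alpha>s t)
      else Ext (ext_count t + s))"

end

lemma ext_count_1 [simp]: "ext_count \<alpha>s (Suc 0) = 0"
  by (simp add: ext_count_def)

lemma ext_count_Suc: "1 \<le> t \<Longrightarrow> ext_count \<alpha>s (Suc t) = ext_count \<alpha>s t + (hj_coef \<alpha>s t - 2)"
  by (simp add: ext_count_def)

lemma ext_count_last: "ext_count \<alpha>s (Suc (hj_len \<alpha>s)) = hj_gamma \<alpha>s"
  unfolding ext_count_def hj_gamma_def by (simp add: atLeastLessThanSuc_atLeastAtMost)

lemma ext_count_mono: "t \<le> t' \<Longrightarrow> ext_count \<alpha>s t \<le> ext_count \<alpha>s t'"
  unfolding ext_count_def by (intro sum_mono2) auto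

lemma ext_tails_less:
  assumes "1 \<le> t" "t \<le> Suc (hj_len \<alpha>s)" "1 \<le> \<sigma>" "\<sigma> \<le> hj_gamma \<alpha>s"
  shows "ext_tails \<alpha>s ! (\<sigma> - 1) < t \<longleftrightarrow> \<sigma> \<le> ext_count \<alpha>s t"
proof -
  let ?f = "\<lambda>i. replicate (hj_coef \<alpha>s i - 2) i"
  let ?A = "concat (map ?f [1..<t])" and ?B = "concat (map ?f [t..<Suc (hj_len \<alpha>s)])"
  have "[1..<Suc (hj_len \<alpha>s)] = [1..<t] @ [t..<Suc (hj_len \<alpha>s)]"
    using upt_add_eq_append[of 1 t "Suc (hj_len \<alpha>s) - t"] assms by simp
  then have split: "ext_tails \<alpha>s = ?A @ ?B" unfolding ext_tails_def by (simp del: upt_Suc)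
  have len: "length ?A = ext_count \<alpha>s t"
    unfolding ext_count_def length_concat
    by (simp add: comp_def, subst sum_list_distinct_conv_sum_set) auto
  have B: "\<sigma> - 1 - length ?A < length ?B" if "\<not> \<sigma> - 1 < length ?A"
  proof -
    have "length ?A + length ?B = hj_gamma \<alpha>s" using length_ext_tails[of \<alpha>s] split by simp
    then show ?thesis using that assms by linarith
  qed
  have A_mem: "x \<in> set ?A \<Longrightarrow> x < t" and B_mem: "x \<in> set ?B \<Longrightarrow> t \<le> x" for x
    by (auto simp del: upt_Suc split: if_splits)
  have "ext_tails \<alpha>s ! (\<sigma> - 1) < t \<longleftrightarrow> \<sigma> - 1 < length ?A"
  proof (cases "\<sigma> - 1 < length ?A")
    case True
    then show ?thesis using A_mem[OF nth_mem[OF True]] by (simp only: split nth_append if_True)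
  next
    case False
    then have "ext_tails \<alpha>s ! (\<sigma> - 1) = ?B ! (\<sigma> - 1 - length ?A)"
      by (simp only: split nth_append if_False)
    then show ?thesis using False B_mem[OF nth_mem[OF B[OF False]]] by simp
  qed
  then show ?thesis using len assms by linarith
qed

lemma ktail_less:
  assumes "2 \<le> t" "t \<le> hj_len \<alpha>s" "\<sigma> \<le> hj_gamma \<alpha>s + 1"
  shows "ktail \<alpha>s \<sigma> < t \<longleftrightarrow> \<sigma> \<le> ext_count \<alpha>s t"
proof -
  consider "\<sigma> = 0" | "\<sigma> = hj_gamma \<alpha>s + 1" | "1 \<le> \<sigma>" "\<sigma> \<le> hj_gamma \<alpha>s" using assms by linarith
  then show ?thesis
  proof cases
    case 1
    then show ?thesis using assms by (simp add: ktail_def karrow_def)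
  next
    case 2
    have "ext_count \<alpha>s t \<le> hj_gamma \<alpha>s"
      using ext_count_mono[of t "Suc (hj_len \<alpha>s)" \<alpha>s] ext_count_last assms by simp
    then show ?thesis using 2 assms by (simp add: ktail_def karrow_def)
  next
    case 3
    then show ?thesis using ext_tails_less[of t \<alpha>s \<sigma>] assms by (simp add: ktail_def karrow_def)
  qed
qed

context
  fixes r a :: nat and \<alpha>s :: "nat list"
  assumes expansion: "is_hj_expansion r a \<alpha>s" and cop: "coprime r a" and a: "1 \<le> a"
begin

interpretation S: hj_series r a "hj_len \<alpha>s" "hj_coef \<alpha>s" "hj_I \<alpha>s" "hj_J \<alpha>s"
  by (rule hj_series_hj[OF expansion cop a])

lemma expansion_props: "\<alpha>s \<noteq> []" "\<forall>\<alpha> \<in> set \<alpha>s. \<alpha> \<ge> 2"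
  using expansion by (auto simp: is_hj_expansion_def)

interpretation fin_digraph "recon_quiver \<alpha>s"
  by (rule fin_digraph_recon_quiver[OF expansion_props(1)])

abbreviation n where "n \<equiv> hj_len \<alpha>s"
abbreviation \<gamma> where "\<gamma> \<equiv> hj_gamma \<alpha>s"
abbreviation ax where "ax \<equiv> arrow_x \<alpha>s"
abbreviation ay where "ay \<equiv> arrow_y \<alpha>s"
abbreviation ka where "ka \<equiv> karrow \<alpha>s"
abbreviation kt where "kt \<equiv> ktail \<alpha>s"
abbreviation kx where "kx \<equiv> kdeg_x \<alpha>s"
abbreviation ky where "ky \<equiv> kdeg_y \<alpha>s"
abbreviation ec where "ec \<equiv> ext_count \<alpha>s"
abbreviation ou where "ou \<equiv> out_arrow \<alpha>s"

lemma rel_parallel: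
  "(x, y) \<in> recon_relations \<alpha>s \<Longrightarrow> x \<noteq> [] \<and> y \<noteq> [] \<and> (\<exists>i j. awalk i x j \<and> awalk i y j)"
  using recon_relations_parallel[OF expansion_props] unfolding parallel_walks_def[OF expansion_props] by blast

text \<open>Here \<open>a = 1\<close> and the single coefficient is \<open>r\<close>; the two arrows
  out of 0 carry \<open>x\<close> and \<open>y\<close>.\<close>

lemma hj_quiver_1:
  assumes n: "n = 1"
  shows "hj_quiver r a n (hj_coef \<alpha>s) (hj_I \<alpha>s) (hj_J \<alpha>s) (recon_quiver \<alpha>s) ax ay
    (recon_relations \<alpha>s) (Acw1 1) (Acw1 2) ou"
proof -
  have I: "hj_I \<alpha>s 0 = r" "hj_I \<alpha>s (Suc 0) = 1" using S.I0 S.In n by auto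
  have al: "hj_coef \<alpha>s (Suc 0) = r" using S.Irec[of 1] n S.ISn I by simp
  have r2: "2 \<le> r" using S.alpha[of 1] n al by simp
  have gam: "\<gamma> = r - 2" using n al by (simp add: hj_gamma_def)
  have X: "S.Xd 1 s = r - (s + 1)" and Y: "S.Yd 1 s = s" for s
    using I by (simp_all add: S.Xd_def S.Yd_def)
  have E: "recon_relations \<alpha>s = recon_relations_1 \<alpha>s" using n by (simp add: recon_relations_def)
  have tailE: "arrow_tail \<alpha>s (Ext s) = 1" if "1 \<le> s" "s \<le> r - 2" for s
    using arrow_tail_Ext[of s \<alpha>s] that n gam by (simp del: arrow_tail.simps)
  have arcs: "arcs (recon_quiver \<alpha>s) = {Acw1 1, Acw1 2, Cw1 1, Cw1 2} \<union> Ext ` {1..r - 2}"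
    using n gam by (auto simp: recon_quiver_def)
  show ?thesis
  proof
    show "verts (recon_quiver \<alpha>s) = {..<Suc n}" using n by auto
    show "{e \<in> arcs (recon_quiver \<alpha>s). tail (recon_quiver \<alpha>s) e = 0} = {Acw1 1, Acw1 2}"
      using tailE by (fastforce simp: arcs simp del: arrow_tail.simps(5))
    show "{e \<in> arcs (recon_quiver \<alpha>s). tail (recon_quiver \<alpha>s) e = t} = ou t ` {..<hj_coef \<alpha>s t}"
      if "1 \<le> t" "t \<le> n" for t
    proof -
      have t: "t = 1" using that n by simp
      have "ou 1 ` {..<r} = {Cw1 1, Cw1 2} \<union> Ext ` {1..r - 2}"
      proof
        show "ou 1 ` {..<r} \<subseteq> {Cw1 1, Cw1 2} \<union> Ext ` {1..r - 2}"
          using n by (auto simp: out_arrow_def intro!: imageI)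
        have "Ext s = ou 1 (s + 1) \<and> s + 1 < r" if "1 \<le> s" "s \<le> r - 2" for s
          using that n r2 by (auto simp: out_arrow_def)
        moreover have "Cw1 1 = ou 1 0" "Cw1 2 = ou 1 1" using n by (auto simp: out_arrow_def)
        ultimately show "{Cw1 1, Cw1 2} \<union> Ext ` {1..r - 2} \<subseteq> ou 1 ` {..<r}"
          using r2 by (auto intro!: imageI)
      qed
      moreover have "{e \<in> arcs (recon_quiver \<alpha>s). tail (recon_quiver \<alpha>s) e = 1} = {Cw1 1, Cw1 2} \<union> Ext ` {1..r - 2}"
        using tailE by (auto simp: arcs simp del: arrow_tail.simps(5))
      ultimately show ?thesis using t al by simp
    qed
    fix t s assume t: "1 \<le> t" "t \<le> n"
    then have t1: "t = 1" using n by simp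
    show "ax (ou t s) = S.Xd t s \<and> ay (ou t s) = S.Yd t s" if "s < hj_coef \<alpha>s t"
      using that n I unfolding t1 X Y by (auto simp: out_arrow_def)
    show "head (recon_quiver \<alpha>s) (ou t s) =
      (if s = 0 then t - 1 else if s = hj_coef \<alpha>s t - 1 then (if t = n then 0 else t + 1) else 0)"
      if "s < hj_coef \<alpha>s t"
      using n t1 by (auto simp: out_arrow_def)
    assume s: "s + 2 \<le> hj_coef \<alpha>s t"
    have s2: "s + 2 \<le> r" using s t1 al by simp
    \<comment> \<open>Numbered by \<open>ou\<close>, all relations read alike: arrow
      \<open>s + 1\<close> with \<open>x\<close> equals arrow \<open>s\<close> with
      \<open>y\<close>, in both orders of composition.\<close>
    have "([ou 1 (s + 1), Acw1 1], [ou 1 s, Acw1 2]) \<in> recon_relations \<alpha>s"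
      "([Acw1 1, ou 1 (s + 1)], [Acw1 2, ou 1 s]) \<in> recon_relations \<alpha>s"
    proof -
      have *: "([ou 1 (s + 1), Acw1 1], [ou 1 s, Acw1 2]) \<in> recon_relations \<alpha>s \<and>
        ([Acw1 1, ou 1 (s + 1)], [Acw1 2, ou 1 s]) \<in> recon_relations \<alpha>s"
      proof (cases "s \<le> 1")
        case True
        then have "s = 0 \<or> s = 1" by linarith
        then show ?thesis using s2 n al by (auto simp: E recon_relations_1_def out_arrow_def)
      next
        case False
        then have "ou 1 (s + 1) = Ext s" "ou 1 s = Ext (s - 1)" "s \<in> {2..r - 2}"
          using s2 n by (auto simp: out_arrow_def)
        moreover have "2 < hj_coef \<alpha>s 1" using s2 False al by simp
        ultimately show ?thesis unfolding E recon_relations_1_def using al by simp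
      qed
      then show "([ou 1 (s + 1), Acw1 1], [ou 1 s, Acw1 2]) \<in> recon_relations \<alpha>s"
        "([Acw1 1, ou 1 (s + 1)], [Acw1 2, ou 1 s]) \<in> recon_relations \<alpha>s" by auto
    qed
    moreover have "wdeg ax [ou 1 s, Acw1 2] = S.Xd t s" "wdeg ay [ou 1 s, Acw1 2] = S.Yd t (s + 1)"
      "wdeg ax [Acw1 2, ou 1 s] = S.Xd t s" "wdeg ay [Acw1 2, ou 1 s] = S.Yd t (s + 1)"
      using s2 n I unfolding t1 X Y by (auto simp: out_arrow_def)
    ultimately show
      "\<exists>x y. ((ou t s # x, ou t (s + 1) # y) \<in> recon_relations \<alpha>s \<or>
              (ou t (s + 1) # y, ou t s # x) \<in> recon_relations \<alpha>s) \<and>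
        wdeg ax (ou t s # x) = S.Xd t s \<and> wdeg ay (ou t s # x) = S.Yd t (s + 1)"
      "\<exists>x y. ((Acw1 2 # x, Acw1 1 # y) \<in> recon_relations \<alpha>s \<or>
              (Acw1 1 # y, Acw1 2 # x) \<in> recon_relations \<alpha>s) \<and>
        wdeg ax (Acw1 2 # x) = S.Xd t s \<and> wdeg ay (Acw1 2 # x) = S.Yd t (s + 1)"
      unfolding t1 by blast+
  next
    show "wdeg ax x = wdeg ax y \<and> wdeg ay x = wdeg ay y" if "(x, y) \<in> recon_relations \<alpha>s" for x y
      using that al n I r2 unfolding E recon_relations_1_def by (auto split: if_splits)
  qed (use rel_parallel n in auto)
qed

section \<open>Degrees of paths and arrows for at least two nonzero vertices\<close>

lemma cw_path_0:
  assumes "1 \<le> t" "t \<le> n"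
  shows "cw_path \<alpha>s 0 t = map (\<lambda>m. Cw (if m = 0 then 0 else Suc n - m) (n - m)) [0..<Suc n - t]"
proof -
  have it: "(cw_next \<alpha>s ^^ m) 0 = (if m = 0 then 0 else Suc n - m)" if "m \<le> Suc n" for m
    using that by (induction m) (auto simp: cw_next_def)
  have "(LEAST m. (cw_next \<alpha>s ^^ m) 0 = t) = Suc n - t"
  proof (rule Least_equality)
    show "(cw_next \<alpha>s ^^ (Suc n - t)) 0 = t" using it[of "Suc n - t"] assms by auto
    fix m assume *: "(cw_next \<alpha>s ^^ m) 0 = t"
    show "Suc n - t \<le> m"
    proof (cases "m \<le> Suc n")
      case True
      then show ?thesis using * it[OF True] assms by (auto split: if_splits)
    qed simp
  qed
  then show ?thesis
    unfolding cw_path_def using it by (auto simp del: funpow.simps)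
qed

lemma acw_path_0:
  assumes "1 \<le> t" "t \<le> n"
  shows "acw_path \<alpha>s 0 t = map (\<lambda>m. Acw m (Suc m)) [0..<t]"
proof -
  have it: "(acw_next \<alpha>s ^^ m) 0 = m" if "m \<le> n" for m
    using that by (induction m) (auto simp: acw_next_def)
  have "(LEAST m. (acw_next \<alpha>s ^^ m) 0 = t) = t"
  proof (rule Least_equality)
    show "(acw_next \<alpha>s ^^ t) 0 = t" using it assms by simp
    fix m assume *: "(acw_next \<alpha>s ^^ m) 0 = t"
    show "t \<le> m" using * it[of m] assms by (cases "m \<le> n") auto
  qed
  then show ?thesis
    unfolding acw_path_def using it assms by (auto simp del: funpow.simps)
qed

text \<open>The degrees telescope. The first arrow is recorded because the relations at vertex 0 are
  compared through it.\<close>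

lemma wdeg_cw_path:
  assumes "1 \<le> t" "t \<le> n"
  shows "wdeg ax (cw_path \<alpha>s 0 t) = hj_I \<alpha>s t" "wdeg ay (cw_path \<alpha>s 0 t) = 0"
    "\<exists>y. cw_path \<alpha>s 0 t = Cw 0 n # y"
proof -
  let ?f = "\<lambda>m. Cw (if m = 0 then 0 else Suc n - m) (n - m)"
  have "wdeg ax (map ?f [0..<k]) = hj_I \<alpha>s (Suc n - k)" if "1 \<le> k" "k \<le> n" for k
    using that
  proof (induction k rule: dec_induct)
    case base
    then show ?case using S.In by simp
  next
    case (step k)
    have "hj_I \<alpha>s (Suc n - k) \<le> hj_I \<alpha>s (n - k)" using S.I_le[of "n - k" "Suc n - k"] by simp
    then show ?case using step by simp
  qed
  from this[of "Suc n - t"] show "wdeg ax (cw_path \<alpha>s 0 t) = hj_I \<alpha>s t"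
    using assms by (simp add: cw_path_0)
  have "wdeg ay (map ?f [0..<k]) = 0" for k by (induction k) auto
  then show "wdeg ay (cw_path \<alpha>s 0 t) = 0" using assms by (simp only: cw_path_0)
  have "[0..<Suc n - t] = 0 # [1..<Suc n - t]" using assms by (simp add: upt_rec)
  then show "\<exists>y. cw_path \<alpha>s 0 t = Cw 0 n # y" using assms by (simp add: cw_path_0 del: upt_Suc)
qed

lemma wdeg_acw_path:
  assumes "1 \<le> t" "t \<le> n"
  shows "wdeg ax (acw_path \<alpha>s 0 t) = 0" "wdeg ay (acw_path \<alpha>s 0 t) = hj_J \<alpha>s t"
    "\<exists>x. acw_path \<alpha>s 0 t = Acw 0 1 # x"
proof -
  let ?f = "\<lambda>m. Acw m (Suc m)"
  have "wdeg ay (map ?f [0..<k]) = hj_J \<alpha>s k" if "k \<le> n" for k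
    using that
  proof (induction k)
    case (Suc k)
    then show ?case using S.J_less[of k] by simp
  qed simp
  then show "wdeg ay (acw_path \<alpha>s 0 t) = hj_J \<alpha>s t" using assms by (simp only: acw_path_0)
  have "wdeg ax (map ?f [0..<k]) = 0" for k by (induction k) auto
  then show "wdeg ax (acw_path \<alpha>s 0 t) = 0" using assms by (simp only: acw_path_0)
  have "[0..<t] = 0 # [1..<t]" using assms by (simp add: upt_rec)
  then show "\<exists>x. acw_path \<alpha>s 0 t = Acw 0 1 # x" using assms by (simp add: acw_path_0)
qed

lemma kdeg_x_Suc: "\<sigma> \<le> \<gamma> + 1 \<Longrightarrow> kx \<sigma> = hj_I \<alpha>s (kt \<sigma>) + kx (Suc \<sigma>)"
  unfolding kdeg_x_def by (rule sum.atLeast_Suc_atMost)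

lemma kdeg_y_Suc: "ky (Suc \<sigma>) = ky \<sigma> + hj_J \<alpha>s (kt \<sigma>)"
  unfolding kdeg_y_def by simp

context
  assumes n2: "2 \<le> n"
begin

lemma ktail_0: "kt 0 = 1" and ktail_last: "kt (Suc \<gamma>) = n"
  by (simp_all add: ktail_def karrow_def)

text \<open>The alternatives \<open>t = 1\<close> and \<open>t = n\<close> account for
  \<open>k_0\<close> and \<open>k_(\<gamma> + 1)\<close>, which are not extra arrows and so are not
  counted by \<open>ext_count\<close>.\<close>

lemma ktail_eq:
  assumes "1 \<le> t" "t \<le> n" "\<sigma> \<le> \<gamma> + 1"
  shows "kt \<sigma> = t \<longleftrightarrow> (t = 1 \<or> ec t < \<sigma>) \<and> (t = n \<or> \<sigma> \<le> ec (Suc t))"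
proof -
  have r: "1 \<le> kt \<sigma>" "kt \<sigma> \<le> n" using ktail_range[OF assms(3) expansion_props(1)] by auto
  have "\<not> kt \<sigma> < t \<longleftrightarrow> t = 1 \<or> ec t < \<sigma>"
    using ktail_less[of t \<alpha>s \<sigma>] assms r by (cases "t = 1") auto
  moreover have "kt \<sigma> < Suc t \<longleftrightarrow> t = n \<or> \<sigma> \<le> ec (Suc t)"
    using ktail_less[of "Suc t" \<alpha>s \<sigma>] assms r by (cases "t = n") auto
  ultimately show ?thesis by linarith
qed

lemma ext_count_le: "t \<le> Suc n \<Longrightarrow> ec t \<le> \<gamma>"
  using ext_count_mono[of t "Suc n" \<alpha>s] ext_count_last[of \<alpha>s] by simp

lemma ktail_ext_count:
  assumes "1 \<le> t" "t \<le> n" "1 \<le> s" "s \<le> hj_coef \<alpha>s t - 2"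
  shows "kt (ec t + s) = t" "ec t + s \<le> \<gamma>"
proof -
  show le: "ec t + s \<le> \<gamma>" using ext_count_le[of "Suc t"] ext_count_Suc[of t \<alpha>s] assms by simp
  have "ec t < ec t + s" "ec t + s \<le> ec (Suc t)"
    using ext_count_Suc[of t \<alpha>s] assms by auto
  then show "kt (ec t + s) = t" using ktail_eq[OF assms(1,2), of "ec t + s"] le by simp
qed

text \<open>The generators of the invariant ring that are divisible by \<open>xy\<close> are the least common multiples
  of the degrees of consecutive arrows at the vertices \<open>t \<ge> 1\<close>.\<close>

lemma kdeg_corner:
  assumes "1 \<le> t" "t \<le> n" "s + 2 \<le> hj_coef \<alpha>s t"
  shows "kx (ec t + s + 1) = S.Xd t s" "ky (ec t + s + 1) = S.Yd t (s + 1)"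
proof -
  have al: "2 \<le> hj_coef \<alpha>s t" if "1 \<le> t" "t \<le> n" for t using S.alpha that by simp
  have y1: "ky (ec t + s + 1) = S.Yd t (s + 1)"
    if t: "1 \<le> t" "t \<le> n" and base: "ky (ec t + 1) = S.Yd t 1" and s: "s + 2 \<le> hj_coef \<alpha>s t" for t s
    using s
  proof (induction s)
    case (Suc s)
    have "hj_J \<alpha>s (t - 1) < hj_J \<alpha>s t" using S.J_less[of "t - 1"] t by simp
    then have "hj_J \<alpha>s (t - 1) \<le> (s + 1) * hj_J \<alpha>s t" by (simp add: trans_le_add1)
    then have "S.Yd t (Suc s + 1) = S.Yd t (s + 1) + hj_J \<alpha>s t" unfolding S.Yd_def by simp
    moreover have "kt (ec t + (s + 1)) = t" using ktail_ext_count(1)[OF t, of "s + 1"] Suc.prems by simp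
    ultimately show ?case using Suc kdeg_y_Suc[of "ec t + s + 1"] by simp
  qed (use base in simp)
  have "ky (ec t + 1) = S.Yd t 1" if "1 \<le> t" "t \<le> n" for t
    using that
  proof (induction t rule: dec_induct)
    case base
    show ?case using kdeg_y_Suc[of 0] ktail_0 S.J0 S.J1 by (simp add: kdeg_y_def S.Yd_def)
  next
    case (step t)
    have al2: "hj_coef \<alpha>s t - 2 + 2 \<le> hj_coef \<alpha>s t" using al[of t] step by simp
    have "int (S.Yd t (hj_coef \<alpha>s t - 1)) = int (hj_J \<alpha>s (Suc t)) - int (hj_J \<alpha>s t)"
    proof -
      have t: "1 \<le> t" "t \<le> n" "1 \<le> hj_coef \<alpha>s t - 1" using step al[of t] by auto
      show ?thesis using S.int_Y(1)[OF t] S.Jrec_int[OF t(1,2)] al[OF t(1,2)]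
        by (simp add: of_nat_diff algebra_simps)
    qed
    \<comment> \<open>The last corner at \<open>t\<close> and the first at \<open>Suc t\<close> have
      the same index and degree, which carries the computation to the next vertex.\<close>
    then have "S.Yd t (hj_coef \<alpha>s t - 2 + 1) = S.Yd (Suc t) 1"
      using al[of t] step unfolding S.Yd_def[of "Suc t"] by (simp add: Suc_diff_Suc numeral_2_eq_2)
    then show ?case
      using y1[of t, OF _ _ _ al2] step ext_count_Suc[of t \<alpha>s] by simp
  qed
  then show "ky (ec t + s + 1) = S.Yd t (s + 1)" using y1 assms by blast
  \<comment> \<open>\<open>kdeg_x\<close> sums from its index up to the end, so the
    \<open>x\<close>-degrees are computed downwards: at each vertex from its last corner, and over
    the vertices from \<open>n\<close>.\<close>
  have x1: "kx (ec t + s + 1) = S.Xd t s"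
    if t: "1 \<le> t" "t \<le> n" and base: "kx (ec t + (hj_coef \<alpha>s t - 2) + 1) = S.Xd t (hj_coef \<alpha>s t - 2)"
      and s: "s \<le> hj_coef \<alpha>s t - 2" for t s
    using s
  proof (induction s rule: inc_induct)
    case (step s)
    have "int (S.Xd t s) = int (hj_I \<alpha>s t + S.Xd t (Suc s))"
    proof -
      have "s + 2 \<le> hj_coef \<alpha>s t" "Suc s + 2 \<le> hj_coef \<alpha>s t" using step by linarith+
      from S.int_X(1)[OF t this(1)] S.int_X(1)[OF t this(2)] show ?thesis by (simp add: algebra_simps)
    qed
    then have "S.Xd t s = hj_I \<alpha>s t + S.Xd t (Suc s)" by (simp only: of_nat_eq_iff)
    moreover have "kt (ec t + (s + 1)) = t" "ec t + (s + 1) \<le> \<gamma>"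
      using ktail_ext_count[OF t, of "s + 1"] step by simp_all
    ultimately show ?case using step kdeg_x_Suc[of "ec t + s + 1"] by simp
  qed (use base in simp)
  have X_last: "S.Xd t (hj_coef \<alpha>s t - 2) = hj_I \<alpha>s t - hj_I \<alpha>s (Suc t)" if "1 \<le> t" "t \<le> n" for t
  proof -
    have al2: "hj_coef \<alpha>s t - 2 + 2 \<le> hj_coef \<alpha>s t" using al[OF that] by simp
    have "int (S.Xd t (hj_coef \<alpha>s t - 2)) = int (hj_I \<alpha>s t) - int (hj_I \<alpha>s (Suc t))"
      using S.int_X(1)[OF that al2] S.Irec_int[OF that] al[OF that]
      by (simp add: of_nat_diff algebra_simps)
    then show ?thesis by linarith
  qed
  have xb: "kx (ec t + (hj_coef \<alpha>s t - 2) + 1) = S.Xd t (hj_coef \<alpha>s t - 2)" if "1 \<le> t" "t \<le> n" for t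
    using that(2,1)
  proof (induction t rule: inc_induct)
    case base
    have "ec n + (hj_coef \<alpha>s n - 2) = \<gamma>" using ext_count_Suc[of n \<alpha>s] ext_count_last[of \<alpha>s] base by simp
    then show ?case
      using X_last[of n] base S.In S.ISn kdeg_x_Suc[of "\<gamma> + 1"] ktail_last by (simp add: kdeg_x_def)
  next
    case (step t)
    have "kx (ec (Suc t) + 0 + 1) = S.Xd (Suc t) 0" using x1[of "Suc t" 0] step by simp
    then show ?case using X_last[of t] step ext_count_Suc[of t \<alpha>s] by (simp add: S.Xd_def)
  qed
  show "kx (ec t + s + 1) = S.Xd t s" using x1[OF assms(1,2) xb] assms by simp
qed

lemma n_ne_1: "n \<noteq> 1"
  using n2 by simp

lemma out_arrow_simps:
  assumes t: "1 \<le> t" "t \<le> n"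
  shows "ou t 0 = Cw t (t - 1)" "ou t (hj_coef \<alpha>s t - 1) = Acw t (acw_next \<alpha>s t)"
    "1 \<le> s \<Longrightarrow> s + 2 \<le> hj_coef \<alpha>s t \<Longrightarrow> ou t s = Ext (ec t + s)"
  using n_ne_1 S.alpha[OF t] by (auto simp: out_arrow_def)

lemma out_arrow_deg:
  assumes t: "1 \<le> t" "t \<le> n" and s: "s < hj_coef \<alpha>s t"
  shows "ax (ou t s) = S.Xd t s" "ay (ou t s) = S.Yd t s"
proof -
  consider "s = 0" | "s = hj_coef \<alpha>s t - 1" "s \<noteq> 0" | k where "s = Suc k" "s + 2 \<le> hj_coef \<alpha>s t"
    using s by (cases s) (auto, linarith)
  then have "ax (ou t s) = S.Xd t s \<and> ay (ou t s) = S.Yd t s"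
  proof cases
    case 1
    then show ?thesis using out_arrow_simps(1)[OF t] t by (simp add: S.Xd_def)
  next
    case 2
    have s1: "1 \<le> s" using 2 by simp
    have "int (S.Yd t s) = int (hj_J \<alpha>s (Suc t)) - int (hj_J \<alpha>s t)"
      using S.int_Y(1)[OF t s1] S.Jrec_int[OF t] S.alpha[OF t] 2 by (simp add: of_nat_diff algebra_simps)
    then show ?thesis using 2 out_arrow_simps(2)[OF t] S.X_last[OF t] by simp
  next
    case (3 k)
    then show ?thesis
      using out_arrow_simps(3)[OF t, of s] kdeg_corner[OF t, of s] kdeg_corner(2)[OF t, of k] n_ne_1 by simp
  qed
  then show "ax (ou t s) = S.Xd t s" "ay (ou t s) = S.Yd t s" by auto
qed

lemma karrow_deg:
  assumes "\<sigma> \<le> \<gamma> + 1"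
  shows "ax (ka \<sigma>) = kx (\<sigma> + 1)" "ay (ka \<sigma>) = ky \<sigma>"
proof -
  have al: "2 \<le> hj_coef \<alpha>s t" if "1 \<le> t" "t \<le> n" for t using S.alpha that by simp
  consider "\<sigma> = 0" | "\<sigma> = \<gamma> + 1" | "1 \<le> \<sigma>" "\<sigma> \<le> \<gamma>" using assms by linarith
  then have "ax (ka \<sigma>) = kx (\<sigma> + 1) \<and> ay (ka \<sigma>) = ky \<sigma>"
  proof cases
    case 1
    have "kx 1 = S.Xd 1 0" using kdeg_corner(1)[of 1 0] al[of 1] n2 by simp
    then show ?thesis using 1 by (simp add: karrow_def S.Xd_def kdeg_y_def)
  next
    case 2
    have nn: "1 \<le> n" "n \<le> n" using n2 by auto
    have "ec n + (hj_coef \<alpha>s n - 2) = \<gamma>" using ext_count_Suc[of n \<alpha>s] ext_count_last[of \<alpha>s] nn by simp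
    then have "ky (\<gamma> + 1) = S.Yd n (hj_coef \<alpha>s n - 1)"
      using kdeg_corner(2)[OF nn, of "hj_coef \<alpha>s n - 2"] al[OF nn] by (simp add: Suc_diff_Suc numeral_2_eq_2)
    also have "\<dots> = ay (ou n (hj_coef \<alpha>s n - 1))" using out_arrow_deg(2)[OF nn] al[OF nn] by simp
    finally show ?thesis using 2 out_arrow_simps(2)[OF nn] by (simp add: karrow_def kdeg_x_def)
  next
    case 3
    then show ?thesis using n_ne_1 by (simp add: karrow_def)
  qed
  then show "ax (ka \<sigma>) = kx (\<sigma> + 1)" "ay (ka \<sigma>) = ky \<sigma>" by auto
qed

text \<open>Among the \<open>k\<close>'s are the first arrow at vertex 1 and the last arrow at
  vertex \<open>n\<close>; at other vertices the two outer arrows are not, whence the side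
  conditions.\<close>

lemma karrow_out:
  assumes t: "1 \<le> t" "t \<le> n" and s: "s < hj_coef \<alpha>s t" "s = 0 \<Longrightarrow> t = 1" "s = hj_coef \<alpha>s t - 1 \<Longrightarrow> t = n"
  shows "ka (ec t + s) = ou t s"
proof -
  consider "s = 0" | "s = hj_coef \<alpha>s t - 1" "s \<noteq> 0" | "1 \<le> s" "s + 2 \<le> hj_coef \<alpha>s t"
    using s(1) by linarith
  then show ?thesis
  proof cases
    case 1
    then show ?thesis using s(2) out_arrow_simps(1)[OF t] by (simp add: karrow_def)
  next
    case 2
    then have "t = n" using s(3) by simp
    moreover have "ec n + (hj_coef \<alpha>s n - 2) = \<gamma>"
      using ext_count_Suc[of n \<alpha>s] ext_count_last[of \<alpha>s] n2 by simp
    ultimately have "ec t + s = \<gamma> + 1" using 2 S.alpha[OF t] by simp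
    then show ?thesis using 2 out_arrow_simps(2)[OF t] \<open>t = n\<close> by (simp add: karrow_def acw_next_def)
  next
    case 3
    have "ec t + s \<le> \<gamma>" using ktail_ext_count(2)[OF t, of s] 3 by simp
    then show ?thesis using 3 out_arrow_simps(3)[OF t, of s] by (simp add: karrow_def)
  qed
qed

text \<open>\<open>\<sigma>\<close> is the index of a generator of the invariant ring; both sides of
  each relation have the degree of one such generator.\<close>

definition corner :: "nat \<Rightarrow> arrow list \<Rightarrow> bool" where
  "corner \<sigma> x \<longleftrightarrow> wdeg ax x = kx \<sigma> \<and> wdeg ay x = ky \<sigma>"

lemma corner_A:
  assumes "\<sigma> \<le> \<gamma> + 1"
  shows "corner (\<sigma> + 1) ([ka \<sigma>] @ acw_path \<alpha>s 0 (kt \<sigma>))" "corner (\<sigma> + 1) (acw_path \<alpha>s 0 (kt \<sigma>) @ [ka \<sigma>])"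
  using ktail_range[OF assms expansion_props(1)] karrow_deg[OF assms] kdeg_y_Suc[of \<sigma>]
  by (auto simp: corner_def wdeg_acw_path)

lemma corner_C:
  assumes "\<sigma> \<le> \<gamma> + 1"
  shows "corner \<sigma> ([ka \<sigma>] @ cw_path \<alpha>s 0 (kt \<sigma>))" "corner \<sigma> (cw_path \<alpha>s 0 (kt \<sigma>) @ [ka \<sigma>])"
  using ktail_range[OF assms expansion_props(1)] karrow_deg[OF assms] kdeg_x_Suc[OF assms]
  by (auto simp: corner_def wdeg_cw_path)

lemma corner_left:
  assumes "1 \<le> t" "t \<le> n"
  shows "corner (ec t + 1) [Cw t (t - 1), Acw (t - 1) t]"
  using assms kdeg_corner[OF assms, of 0] S.alpha[OF assms]
  by (simp add: corner_def S.Xd_def S.Yd_def)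

lemma corner_right:
  assumes "1 \<le> t" "t \<le> n"
  shows "corner (ec (Suc t) + 1) [Acw t (acw_next \<alpha>s t), Cw (acw_next \<alpha>s t) t]"
proof -
  have al: "2 \<le> hj_coef \<alpha>s t" by (rule S.alpha[OF assms])
  then have al2: "hj_coef \<alpha>s t - 2 + 2 \<le> hj_coef \<alpha>s t" by simp
  have "ax (Cw (acw_next \<alpha>s t) t) = hj_I \<alpha>s t - hj_I \<alpha>s (Suc t)"
    using S.In S.ISn by (simp add: acw_next_def)
  moreover have "int (S.Xd t (hj_coef \<alpha>s t - 2)) = int (hj_I \<alpha>s t) - int (hj_I \<alpha>s (Suc t))"
    using S.int_X(1)[OF assms al2] S.Irec_int[OF assms] al
    by (simp add: of_nat_diff algebra_simps)
  ultimately have "ax (Cw (acw_next \<alpha>s t) t) = S.Xd t (hj_coef \<alpha>s t - 2)" by linarith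
  moreover have "ay (Acw t (acw_next \<alpha>s t)) = S.Yd t (hj_coef \<alpha>s t - 2 + 1)"
    using out_arrow_deg(2)[OF assms, of "hj_coef \<alpha>s t - 1"] out_arrow_simps(2)[OF assms] al
    by (simp add: Suc_diff_Suc numeral_2_eq_2)
  ultimately show ?thesis
    using kdeg_corner[OF assms, of "hj_coef \<alpha>s t - 2"] al ext_count_Suc[of t \<alpha>s] assms
    by (simp add: corner_def)
qed

lemma corner_last: "corner (\<gamma> + 1) [Cw 0 n, Acw n 0]"
proof -
  have "corner (\<gamma> + 1) [Acw n 0, Cw 0 n]"
    using corner_right[of n] n2 ext_count_last[of \<alpha>s] by (simp add: acw_next_def)
  moreover have "wdeg d [e, f] = wdeg d [f, e]" for d :: "arrow \<Rightarrow> nat" and e f by simp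
  ultimately show ?thesis unfolding corner_def by metis
qed

lemma Vidx_eq:
  assumes "2 \<le> t" "t \<le> n"
  shows "Vidx \<alpha>s t = ec t"
proof -
  have "{j \<in> {0..\<gamma> + 1}. kt j < t} = {0..ec t}"
    using ktail_less[OF assms] ext_count_le[of t] assms by auto
  moreover have "Max {0..ec t} = ec t" by (rule Max_eqI) auto
  ultimately show ?thesis using assms unfolding Vidx_def by simp
qed

lemma vidx_eq:
  assumes "2 \<le> t" "t \<le> n" "2 < hj_coef \<alpha>s t"
  shows "vidx \<alpha>s t = ec t + 1"
  unfolding vidx_def
proof (rule Min_eqI)
  have "1 \<le> t" and one: "1 \<le> hj_coef \<alpha>s t - 2" using assms by auto
  note kt = ktail_eq[OF \<open>1 \<le> t\<close> assms(2)]
  show "ec t + 1 \<le> j" if "j \<in> {j \<in> {0..\<gamma> + 1}. kt j = t}" for j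
    using that kt[of j] assms by auto
  show "ec t + 1 \<in> {j \<in> {0..\<gamma> + 1}. kt j = t}"
    using ktail_ext_count[OF \<open>1 \<le> t\<close> assms(2) order.refl one] by simp
qed simp

lemma uidx_eq:
  assumes "1 \<le> t" "t < n" "2 < hj_coef \<alpha>s t"
  shows "uidx \<alpha>s t = ec (Suc t)"
  unfolding uidx_def
proof (rule Max_eqI)
  note kt = ktail_eq[OF assms(1) less_imp_le[OF assms(2)]]
  have one: "1 \<le> hj_coef \<alpha>s t - 2" using assms by simp
  show "j \<le> ec (Suc t)" if "j \<in> {j \<in> {0..\<gamma> + 1}. kt j = t}" for j
    using that kt[of j] assms by auto
  show "ec (Suc t) \<in> {j \<in> {0..\<gamma> + 1}. kt j = t}"
    unfolding ext_count_Suc[OF assms(1)]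
    using ktail_ext_count[OF assms(1) less_imp_le[OF assms(2)] one order.refl] by simp
qed simp

lemma uidx_last: "uidx \<alpha>s n = \<gamma> + 1"
  unfolding uidx_def by (rule Max_eqI) (auto simp: ktail_last)

lemma cw_path_n: "cw_path \<alpha>s 0 n = [Cw 0 n]" and acw_path_1: "acw_path \<alpha>s 0 1 = [Acw 0 1]"
  using n2 by (simp_all add: cw_path_0 acw_path_0)

lemma relations_eq: "recon_relations \<alpha>s = step_first \<alpha>s \<union> (\<Union>t \<in> {1<..<n}. step_middle \<alpha>s t) \<union> step_last \<alpha>s"
  using n_ne_1 by (simp add: recon_relations_def)

lemma kt_between:
  assumes "1 \<le> t" "t \<le> n" "ec t + 1 \<le> \<sigma>" "\<sigma> \<le> ec (Suc t)"
  shows "kt \<sigma> = t" "\<sigma> \<le> \<gamma>"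
  using ktail_ext_count[of t "\<sigma> - ec t"] assms ext_count_Suc[of t \<alpha>s] by auto

text \<open>The common index is \<open>ec t + 1\<close> for the loop at \<open>t\<close> through
  \<open>t - 1\<close>, and \<open>s + 1\<close> for the relations between \<open>k_s\<close> and
  \<open>k_(s + 1)\<close>.\<close>

lemma relations_corner:
  assumes "(x, y) \<in> recon_relations \<alpha>s"
  shows "\<exists>\<sigma>. corner \<sigma> x \<and> corner \<sigma> y"
proof -
  have c2: "hj_coef \<alpha>s t = 2 \<or> 2 < hj_coef \<alpha>s t" if "1 \<le> t" "t \<le> n" for t using S.alpha[OF that] by linarith
  have pair: "\<exists>\<sigma>. corner \<sigma> ([ka s] @ acw_path \<alpha>s 0 t) \<and> corner \<sigma> ([ka (s + 1)] @ cw_path \<alpha>s 0 t)"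
    "\<exists>\<sigma>. corner \<sigma> (acw_path \<alpha>s 0 t @ [ka s]) \<and> corner \<sigma> (cw_path \<alpha>s 0 t @ [ka (s + 1)])"
    if "kt s = t" "kt (s + 1) = t" "s \<le> \<gamma>" for s t
    using corner_A[of s] corner_C[of "s + 1"] that by auto
  from assms consider "(x, y) \<in> step_first \<alpha>s"
    | t where "1 < t" "t < n" "(x, y) \<in> step_middle \<alpha>s t" | "(x, y) \<in> step_last \<alpha>s"
    unfolding relations_eq by auto
  then show ?thesis
  proof cases
    case 1
    have t: "1 \<le> (1::nat)" "1 \<le> n" "1 < n" using n2 by auto
    have L: "corner (ec 1 + 1) [Cw 1 0, Acw 0 1]" using corner_left[OF t(1,2)] by simp
    have R: "corner (ec 2 + 1) [Acw 1 2, Cw 2 1]"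
      using corner_right[OF t(1,2)] t(3) by (simp add: acw_next_def numeral_2_eq_2)
    show ?thesis
    proof (cases "hj_coef \<alpha>s 1 = 2")
      case True
      then have "ec 2 = ec 1" using ext_count_Suc[of 1 \<alpha>s] by (simp add: numeral_2_eq_2)
      then show ?thesis using 1 True L R by (auto simp: step_first_def)
    next
      case False
      have u: "uidx \<alpha>s 1 = ec 2" using uidx_eq[OF t(1,3)] False c2[OF t(1,2)] by (simp add: numeral_2_eq_2)
      have k: "kt s = 1 \<and> s \<le> \<gamma>" if "s \<le> ec 2" for s
        using that kt_between[OF t(1,2), of s] ktail_0 by (cases "s = 0") (auto simp: numeral_2_eq_2)
      have "corner (ec 2 + 1) ([ka (ec 2)] @ acw_path \<alpha>s 0 1)" using corner_A(1)[of "ec 2"] k[of "ec 2"] by simp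
      then show ?thesis
        using 1 False R u pair[of _ 1] k acw_path_1 by (fastforce simp: step_first_def)
    qed
  next
    case (2 t)
    then have t: "1 \<le> t" "t \<le> n" "2 \<le> t" by auto
    have L: "corner (ec t + 1) [Cw t (t - 1), Acw (t - 1) t]" by (rule corner_left[OF t(1,2)])
    have R: "corner (ec (Suc t) + 1) [Acw t (t + 1), Cw (t + 1) t]"
      using corner_right[OF t(1,2)] 2 by (simp add: acw_next_def)
    show ?thesis
    proof (cases "hj_coef \<alpha>s t = 2")
      case True
      then have "ec (Suc t) = ec t" using ext_count_Suc[OF t(1), of \<alpha>s] by simp
      then show ?thesis using 2 True L R by (auto simp: step_middle_def)
    next
      case False
      then have gt: "2 < hj_coef \<alpha>s t" using c2[OF t(1,2)] by simp
      note uv = uidx_eq[OF t(1) 2(2) gt] vidx_eq[OF t(3,2) gt] Vidx_eq[OF t(3,2)]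
      have k: "kt s = t \<and> s \<le> \<gamma>" if "ec t + 1 \<le> s" "s \<le> ec (Suc t)" for s
        using kt_between[OF t(1,2) that] by simp
      have k1: "ec t + 1 \<le> ec (Suc t)" using ext_count_Suc[OF t(1), of \<alpha>s] gt by simp
      have "corner (ec t + 1) ([ka (ec t + 1)] @ cw_path \<alpha>s 0 t)" "corner (ec t + 1) (cw_path \<alpha>s 0 t @ [ka (ec t + 1)])"
        using corner_C[of "ec t + 1"] k[of "ec t + 1"] k1 by auto
      moreover have "corner (ec t + 1) (acw_path \<alpha>s 0 (kt (ec t)) @ [ka (ec t)])"
        using corner_A(2)[of "ec t"] ext_count_le[of t] t by simp
      moreover have "corner (ec (Suc t) + 1) ([ka (ec (Suc t))] @ acw_path \<alpha>s 0 t)"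
        using corner_A(1)[of "ec (Suc t)"] k[of "ec (Suc t)"] k1 by auto
      moreover have "\<exists>\<sigma>. corner \<sigma> ([ka s] @ acw_path \<alpha>s 0 t) \<and> corner \<sigma> ([ka (s + 1)] @ cw_path \<alpha>s 0 t)"
        "\<exists>\<sigma>. corner \<sigma> (acw_path \<alpha>s 0 t @ [ka s]) \<and> corner \<sigma> (cw_path \<alpha>s 0 t @ [ka (s + 1)])"
        if "s \<in> {ec t + 1..<ec (Suc t)}" for s
        using pair[of s t] k[of s] k[of "s + 1"] that by auto
      ultimately show ?thesis
        using 2(3) False L R unfolding step_middle_def uv by auto
    qed
  next
    case 3
    have t: "1 \<le> n" "n \<le> n" "2 \<le> n" using n2 by auto
    have L: "corner (ec n + 1) [Cw n (n - 1), Acw (n - 1) n]" by (rule corner_left[OF t(1,2)])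
    have R: "corner (\<gamma> + 1) [Acw n 0, Cw 0 n]"
      using corner_right[OF t(1,2)] ext_count_last[of \<alpha>s] by (simp add: acw_next_def)
    have V: "corner (ec n + 1) (acw_path \<alpha>s 0 (kt (ec n)) @ [ka (ec n)])"
      using corner_A(2)[of "ec n"] ext_count_le[of n] by simp
    show ?thesis
    proof (cases "hj_coef \<alpha>s n = 2")
      case True
      then have "ec n = \<gamma>" using ext_count_Suc[OF t(1), of \<alpha>s] ext_count_last[of \<alpha>s] by simp
      then show ?thesis
        using 3 True L R V corner_last unfolding step_last_def Let_def Vidx_eq[OF t(3,2)] by auto
    next
      case False
      then have gt: "2 < hj_coef \<alpha>s n" using c2[OF t(1,2)] by simp
      note uv = uidx_last vidx_eq[OF t(3,2) gt] Vidx_eq[OF t(3,2)]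
      have k: "kt s = n" if "ec n + 1 \<le> s" "s \<le> \<gamma> + 1" for s
        using ktail_eq[OF t(1,2) that(2)] that n2 by simp
      have k1: "ec n + 1 \<le> \<gamma>" using ext_count_Suc[OF t(1), of \<alpha>s] ext_count_last[of \<alpha>s] gt by simp
      have "corner (ec n + 1) ([ka (ec n + 1)] @ [Cw 0 n])" "corner (ec n + 1) ([Cw 0 n] @ [ka (ec n + 1)])"
        using corner_C[of "ec n + 1"] k[of "ec n + 1"] k1 cw_path_n by auto
      moreover have "\<exists>\<sigma>. corner \<sigma> ([ka s] @ acw_path \<alpha>s 0 n) \<and> corner \<sigma> ([ka (s + 1)] @ [Cw 0 n])"
        "\<exists>\<sigma>. corner \<sigma> (acw_path \<alpha>s 0 n @ [ka s]) \<and> corner \<sigma> ([Cw 0 n] @ [ka (s + 1)])"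
        if "s \<in> {ec n + 1..<\<gamma> + 1}" for s
        using pair[of s n] k[of s] k[of "s + 1"] that cw_path_n by auto
      ultimately show ?thesis
        using 3 False L R V unfolding step_last_def Let_def uv by auto
    qed
  qed
qed

section \<open>Relations joining neighbouring arrows\<close>

lemma relation_loops:
  assumes "1 \<le> t" "t \<le> n" "hj_coef \<alpha>s t = 2"
  shows "([Cw t (t - 1), Acw (t - 1) t], [Acw t (acw_next \<alpha>s t), Cw (acw_next \<alpha>s t) t]) \<in> recon_relations \<alpha>s"
proof -
  consider "t = 1" | "1 < t" "t < n" | "t = n" using assms by linarith
  then show ?thesis
  proof cases
    case 1
    then show ?thesis using assms n2 unfolding relations_eq step_first_def
      by (auto simp: acw_next_def numeral_2_eq_2)
  next
    case 2
    then have "([Cw t (t - 1), Acw (t - 1) t], [Acw t (acw_next \<alpha>s t), Cw (acw_next \<alpha>s t) t]) \<in> step_middle \<alpha>s t"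
      using assms unfolding step_middle_def by (simp add: acw_next_def)
    then show ?thesis using 2 unfolding relations_eq by auto
  next
    case 3
    then show ?thesis using assms unfolding relations_eq step_last_def Let_def by (simp add: acw_next_def)
  qed
qed

lemma relation_left:
  assumes "2 \<le> t" "t \<le> n" "2 < hj_coef \<alpha>s t"
  shows "([Cw t (t - 1), Acw (t - 1) t], [ka (ec t + 1)] @ cw_path \<alpha>s 0 t) \<in> recon_relations \<alpha>s"
proof (cases "t = n")
  case True
  then show ?thesis using assms vidx_eq[OF assms] cw_path_n
    unfolding relations_eq step_last_def Let_def by simp
next
  case False
  have "([Cw t (t - 1), Acw (t - 1) t], [ka (ec t + 1)] @ cw_path \<alpha>s 0 t) \<in> step_middle \<alpha>s t"
    using assms vidx_eq[OF assms] unfolding step_middle_def by simp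
  then show ?thesis using False assms unfolding relations_eq by auto
qed

lemma relation_right:
  assumes "1 \<le> t" "t < n" "2 < hj_coef \<alpha>s t"
  shows "([ka (ec (Suc t))] @ acw_path \<alpha>s 0 t, [Acw t (t + 1), Cw (t + 1) t]) \<in> recon_relations \<alpha>s"
proof (cases "t = 1")
  case True
  then show ?thesis using assms uidx_eq[OF assms] acw_path_1
    unfolding relations_eq step_first_def by (simp add: numeral_2_eq_2)
next
  case False
  have "([ka (ec (Suc t))] @ acw_path \<alpha>s 0 t, [Acw t (t + 1), Cw (t + 1) t]) \<in> step_middle \<alpha>s t"
    using assms uidx_eq[OF assms] unfolding step_middle_def by simp
  then show ?thesis using False assms unfolding relations_eq by auto
qed

text \<open>Two neighbouring \<open>k\<close>'s with tail \<open>t\<close> force an extra arrow at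
  \<open>t\<close>, even if one of them is \<open>k_0\<close> or \<open>k_(\<gamma> + 1)\<close>. So
  the coefficient at \<open>t\<close> exceeds 2, and step \<open>t\<close> contains this
  pair.\<close>

lemma relation_same_tail:
  assumes "kt \<sigma> = t" "kt (\<sigma> + 1) = t" "\<sigma> \<le> \<gamma>"
  shows "([ka \<sigma>] @ acw_path \<alpha>s 0 t, [ka (\<sigma> + 1)] @ cw_path \<alpha>s 0 t) \<in> recon_relations \<alpha>s"
    "(acw_path \<alpha>s 0 t @ [ka \<sigma>], cw_path \<alpha>s 0 t @ [ka (\<sigma> + 1)]) \<in> recon_relations \<alpha>s"
proof -
  have t: "1 \<le> t" "t \<le> n" using ktail_range[of \<sigma> \<alpha>s] assms expansion_props(1) by auto
  have s: "\<sigma> \<le> \<gamma> + 1" "\<sigma> + 1 \<le> \<gamma> + 1" using assms by auto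
  have eq: "t = 1 \<or> ec t < \<sigma>" "t = n \<or> \<sigma> + 1 \<le> ec (Suc t)"
    using ktail_eq[OF t s(1)] ktail_eq[OF t s(2)] assms by auto
  have "ec t < ec (Suc t)"
  proof (cases "t = n")
    case True
    then show ?thesis using eq(1) n2 assms(3) ext_count_last[of \<alpha>s] by simp
  next
    case False
    then show ?thesis using eq by (cases "t = 1") auto
  qed
  then have gt: "2 < hj_coef \<alpha>s t" using ext_count_Suc[OF t(1), of \<alpha>s] by simp
  consider "t = 1" | "1 < t" "t < n" | "t = n" using t by linarith
  then have "([ka \<sigma>] @ acw_path \<alpha>s 0 t, [ka (\<sigma> + 1)] @ cw_path \<alpha>s 0 t) \<in> recon_relations \<alpha>s \<and>
    (acw_path \<alpha>s 0 t @ [ka \<sigma>], cw_path \<alpha>s 0 t @ [ka (\<sigma> + 1)]) \<in> recon_relations \<alpha>s"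
  proof cases
    case 1
    have "\<sigma> < uidx \<alpha>s 1" using uidx_eq[of 1] 1 gt eq n2 by simp
    then show ?thesis using 1 gt acw_path_1 unfolding relations_eq step_first_def by auto
  next
    case 2
    have "\<sigma> \<in> {vidx \<alpha>s t..<uidx \<alpha>s t}" using uidx_eq[of t] vidx_eq[of t] 2 gt eq by auto
    then have "([ka \<sigma>] @ acw_path \<alpha>s 0 t, [ka (\<sigma> + 1)] @ cw_path \<alpha>s 0 t) \<in> step_middle \<alpha>s t"
      "(acw_path \<alpha>s 0 t @ [ka \<sigma>], cw_path \<alpha>s 0 t @ [ka (\<sigma> + 1)]) \<in> step_middle \<alpha>s t"
      using gt unfolding step_middle_def by auto
    then show ?thesis using 2 unfolding relations_eq by auto
  next
    case 3
    have "\<sigma> \<in> {vidx \<alpha>s n..<uidx \<alpha>s n}" using uidx_last vidx_eq[of n] 3 gt eq n2 assms(3) by auto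
    then show ?thesis using 3 gt cw_path_n unfolding relations_eq step_last_def Let_def by auto
  qed
  then show "([ka \<sigma>] @ acw_path \<alpha>s 0 t, [ka (\<sigma> + 1)] @ cw_path \<alpha>s 0 t) \<in> recon_relations \<alpha>s"
    "(acw_path \<alpha>s 0 t @ [ka \<sigma>], cw_path \<alpha>s 0 t @ [ka (\<sigma> + 1)]) \<in> recon_relations \<alpha>s" by auto
qed

text \<open>If there is no extra arrow at \<open>t = n\<close>, then \<open>k_(ec t + 1)\<close> is
  the anticlockwise arrow to 0, and the last step has a separate relation for it.\<close>

lemma relation_new_tail:
  assumes "2 \<le> t" "t \<le> n" "t = n \<or> 2 < hj_coef \<alpha>s t"
  shows "(cw_path \<alpha>s 0 t @ [ka (ec t + 1)], acw_path \<alpha>s 0 (kt (ec t)) @ [ka (ec t)]) \<in> recon_relations \<alpha>s"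
proof (cases "t = n")
  case True
  show ?thesis
  proof (cases "hj_coef \<alpha>s n = 2")
    case c: True
    then have "ec n = \<gamma>" using ext_count_Suc[of n \<alpha>s] ext_count_last[of \<alpha>s] n2 by simp
    then show ?thesis using c True Vidx_eq[OF assms(1,2)] cw_path_n
      unfolding relations_eq step_last_def Let_def by (simp add: karrow_def)
  next
    case False
    then have "2 < hj_coef \<alpha>s n" using S.alpha[of n] n2 by simp
    then show ?thesis using True Vidx_eq[OF assms(1,2)] vidx_eq[of n] cw_path_n n2
      unfolding relations_eq step_last_def Let_def by simp
  qed
next
  case False
  then have "(cw_path \<alpha>s 0 t @ [ka (ec t + 1)], acw_path \<alpha>s 0 (kt (ec t)) @ [ka (ec t)]) \<in> step_middle \<alpha>s t"
    using assms Vidx_eq[OF assms(1,2)] vidx_eq[OF assms(1,2)] unfolding step_middle_def by simp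
  then show ?thesis using False assms unfolding relations_eq by auto
qed

text \<open>Neighbours are of four kinds: the two outer arrows when there is no extra arrow, the
  clockwise arrow and the first \<open>k\<close>, the last \<open>k\<close> and the anticlockwise
  arrow, or two \<open>k\<close>'s. When extra arrows are present, an outer arrow that is itself a
  \<open>k\<close> belongs to the last kind.\<close>

lemma relation_out:
  assumes t: "1 \<le> t" "t \<le> n" and s: "s + 2 \<le> hj_coef \<alpha>s t"
  shows "\<exists>x y. (ou t s # x, ou t (s + 1) # y) \<in> recon_relations \<alpha>s \<and> corner (ec t + s + 1) (ou t s # x)"
proof -
  note L = corner_left[OF t] and o0 = out_arrow_simps(1)[OF t] and ol = out_arrow_simps(2)[OF t]
  consider "hj_coef \<alpha>s t = 2" | "2 < hj_coef \<alpha>s t" "s = 0" "2 \<le> t"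
    | "2 < hj_coef \<alpha>s t" "s + 2 = hj_coef \<alpha>s t" "t < n"
    | "2 < hj_coef \<alpha>s t" "s = 0 \<longrightarrow> t = 1" "s + 2 = hj_coef \<alpha>s t \<longrightarrow> t = n"
    using s t by linarith
  then show ?thesis
  proof cases
    case 1
    then have "s = 0" "ou t (s + 1) = Acw t (acw_next \<alpha>s t)" using s ol by auto
    then show ?thesis using relation_loops[OF t 1] L o0 by auto
  next
    case 2
    have "ou t 1 = ka (ec t + 1)" using karrow_out[OF t, of 1] 2 by simp
    then show ?thesis using relation_left[OF 2(3) t(2) 2(1)] 2 L o0 by auto
  next
    case 3
    have "ou t (s + 1) = Acw t (t + 1)" using ol 3 by (simp add: acw_next_def flip: 3(2))
    moreover have "ec (Suc t) = ec t + s" using ext_count_Suc[OF t(1), of \<alpha>s] by (simp flip: 3(2))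
    moreover have "ka (ec t + s) = ou t s" using karrow_out[OF t, of s] 3 by simp
    moreover have "kt (ec t + s) = t" "ec t + s \<le> \<gamma>" using ktail_ext_count[OF t, of s] 3 by auto
    ultimately show ?thesis using relation_right[OF t(1) 3(3,1)] corner_A(1)[of "ec t + s"] by auto
  next
    case 4
    have s2: "s \<le> hj_coef \<alpha>s t - 2" using s by linarith
    have k: "kt (ec t + s) = t" "ec t + s \<le> \<gamma>"
      using ktail_ext_count[OF t _ s2] ktail_0 4 n2 by (cases "s = 0"; simp)+
    have k1: "kt (ec t + s + 1) = t"
    proof (cases "s + 2 = hj_coef \<alpha>s t")
      case True
      then have "t = n" using 4 by simp
      moreover have "ec t + s = ec (Suc t)" using ext_count_Suc[OF t(1), of \<alpha>s] True by linarith
      ultimately show ?thesis using ktail_last ext_count_last[of \<alpha>s] by simp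
    next
      case False
      then show ?thesis using ktail_ext_count(1)[OF t, of "s + 1"] s by simp
    qed
    have "ka (ec t + s) = ou t s" using karrow_out[OF t, of s] 4 s by auto
    moreover have "ka (ec t + s + 1) = ou t (s + 1)" using karrow_out[OF t, of "s + 1"] 4 s by auto
    ultimately show ?thesis
      using relation_same_tail(1)[OF k(1) k1 k(2)] corner_A(1)[of "ec t + s"] k by auto
  qed
qed

text \<open>The related paths are an anticlockwise path followed by \<open>k_\<sigma>\<close> and a
  clockwise path followed by \<open>k_(\<sigma> + 1)\<close>. Either the two \<open>k\<close>'s have
  the same tail, or the tail changes and the relation involving \<open>Vidx\<close> applies.\<close>

lemma relation_vertex_0:
  assumes "\<sigma> \<le> \<gamma>"
  shows "\<exists>x y. ((Acw 0 1 # x, Cw 0 n # y) \<in> recon_relations \<alpha>s \<or> (Cw 0 n # y, Acw 0 1 # x) \<in> recon_relations \<alpha>s) \<and>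
    corner (\<sigma> + 1) (Acw 0 1 # x)"
proof -
  have r: "1 \<le> kt \<sigma>" "kt \<sigma> \<le> n" "1 \<le> kt (\<sigma> + 1)" "kt (\<sigma> + 1) \<le> n"
    using ktail_range[of \<sigma> \<alpha>s] ktail_range[of "\<sigma> + 1" \<alpha>s] assms expansion_props(1) by auto
  let ?A = "acw_path \<alpha>s 0 (kt \<sigma>) @ [ka \<sigma>]" and ?C = "cw_path \<alpha>s 0 (kt (\<sigma> + 1)) @ [ka (\<sigma> + 1)]"
  have "(?A, ?C) \<in> recon_relations \<alpha>s \<or> (?C, ?A) \<in> recon_relations \<alpha>s"
  proof (cases "kt \<sigma> = kt (\<sigma> + 1)")
    case True
    then show ?thesis using relation_same_tail(2)[OF _ _ assms] by metis
  next
    case False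
    define t where "t = kt (\<sigma> + 1)"
    have lt: "kt \<sigma> < t"
      using False ktail_mono[of \<sigma> "\<sigma> + 1" \<alpha>s] assms expansion_props(1) by (simp add: t_def)
    then have t2: "2 \<le> t" "t \<le> n" using r t_def by auto
    \<comment> \<open>If the tail changes to \<open>t\<close>, then \<open>\<sigma>\<close> is the
      last index with tail below \<open>t\<close>, which is \<open>Vidx \<alpha>s t\<close>.\<close>
    have sig: "\<sigma> = ec t"
      using ktail_less[OF t2, of \<sigma>] ktail_less[OF t2, of "\<sigma> + 1"] lt assms t_def by auto
    have "kt (ec t + 1) = t" "ec t + 1 \<le> \<gamma> + 1" "1 \<le> t"
      unfolding sig[symmetric] using t2 assms by (simp_all add: t_def)
    then have "t = n \<or> ec t + 1 \<le> ec (Suc t)" using ktail_eq[of t "ec t + 1"] t2(2) by blast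
    then have g: "t = n \<or> 2 < hj_coef \<alpha>s t" using ext_count_Suc[of t \<alpha>s] t2 by linarith
    show ?thesis using relation_new_tail[OF t2 g, folded sig, unfolded t_def] by blast
  qed
  moreover obtain x where "acw_path \<alpha>s 0 (kt \<sigma>) = Acw 0 1 # x" using wdeg_acw_path(3)[OF r(1,2)] by blast
  moreover obtain y where "cw_path \<alpha>s 0 (kt (\<sigma> + 1)) = Cw 0 n # y" using wdeg_cw_path(3)[OF r(3,4)] by blast
  ultimately show ?thesis using corner_A(2)[of \<sigma>] assms by auto
qed

lemma hj_quiver_ge_2:
  "hj_quiver r a n (hj_coef \<alpha>s) (hj_I \<alpha>s) (hj_J \<alpha>s) (recon_quiver \<alpha>s) ax ay
    (recon_relations \<alpha>s) (Cw 0 n) (Acw 0 1) ou"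
proof
  have arcs: "e \<in> arcs (recon_quiver \<alpha>s) \<longleftrightarrow>
      (\<exists>i \<le> n. e = Cw i (cw_next \<alpha>s i) \<or> e = Acw i (acw_next \<alpha>s i)) \<or> (\<exists>s. 1 \<le> s \<and> s \<le> \<gamma> \<and> e = Ext s)" for e
    using n_ne_1 by (auto simp: recon_quiver_def)
  have tailE: "arrow_tail \<alpha>s (Ext s) = kt s" if "1 \<le> s" "s \<le> \<gamma>" for s
    using that by (simp add: ktail_def karrow_def)
  have tail0: "arrow_tail \<alpha>s (Ext s) \<noteq> 0" if "1 \<le> s" "s \<le> \<gamma>" for s
    using arrow_tail_Ext[OF that] by simp
  show "verts (recon_quiver \<alpha>s) = {..<Suc n}" by auto
  show "{e \<in> arcs (recon_quiver \<alpha>s). tail (recon_quiver \<alpha>s) e = 0} = {Cw 0 n, Acw 0 1}"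
    using n2 by (auto simp: arcs cw_next_def acw_next_def tail0 simp del: arrow_tail.simps(5))
  fix t s assume t: "1 \<le> t" "t \<le> n"
  note al = S.alpha[OF t]
  show "{e \<in> arcs (recon_quiver \<alpha>s). tail (recon_quiver \<alpha>s) e = t} = ou t ` {..<hj_coef \<alpha>s t}"
  proof safe
    fix e assume e: "e \<in> arcs (recon_quiver \<alpha>s)" "t = tail (recon_quiver \<alpha>s) e"
    have "\<exists>k < hj_coef \<alpha>s t. e = ou t k"
    proof -
      consider "e = Cw t (t - 1)" | "e = Acw t (acw_next \<alpha>s t)" | \<sigma> where "1 \<le> \<sigma>" "\<sigma> \<le> \<gamma>" "e = Ext \<sigma>" "kt \<sigma> = t"
        using e t tailE by (auto simp: arcs cw_next_def simp del: arrow_tail.simps(5))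
      then show ?thesis
      proof cases
        case 1
        then show ?thesis using out_arrow_simps(1)[OF t] al by (intro exI[of _ 0]) auto
      next
        case 2
        then show ?thesis using out_arrow_simps(2)[OF t] al by (intro exI[of _ "hj_coef \<alpha>s t - 1"]) auto
      next
        case (3 \<sigma>)
        then have "(t = 1 \<or> ec t < \<sigma>) \<and> (t = n \<or> \<sigma> \<le> ec (Suc t))" using ktail_eq[OF t, of \<sigma>] by simp
        then have "ec t < \<sigma>" "\<sigma> \<le> ec (Suc t)" using 3 ext_count_last[of \<alpha>s] by auto
        then show ?thesis
          using out_arrow_simps(3)[OF t, of "\<sigma> - ec t"] ext_count_Suc[OF t(1), of \<alpha>s] 3
          by (intro exI[of _ "\<sigma> - ec t"]) auto
      qed
    qed
    then show "e \<in> ou (tail (recon_quiver \<alpha>s) e) ` {..<hj_coef \<alpha>s (tail (recon_quiver \<alpha>s) e)}"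
      using e by auto
  next
    fix k assume k: "k < hj_coef \<alpha>s t"
    consider "k = 0" | "k = hj_coef \<alpha>s t - 1" | "1 \<le> k" "k + 2 \<le> hj_coef \<alpha>s t" using k by linarith
    then have "ou t k \<in> arcs (recon_quiver \<alpha>s) \<and> tail (recon_quiver \<alpha>s) (ou t k) = t"
    proof cases
      case 1
      then show ?thesis using out_arrow_simps(1)[OF t] t by (auto simp: arcs cw_next_def)
    next
      case 2
      then show ?thesis using out_arrow_simps(2)[OF t] t by (auto simp: arcs)
    next
      case 3
      then show ?thesis
        using out_arrow_simps(3)[OF t, of k] ktail_ext_count[OF t, of k] tailE[of "ec t + k"]
        by (auto simp: arcs simp del: arrow_tail.simps(5))
    qed
    then show "ou t k \<in> arcs (recon_quiver \<alpha>s)" "tail (recon_quiver \<alpha>s) (ou t k) = t" by auto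
  qed
  show "head (recon_quiver \<alpha>s) (ou t s) =
      (if s = 0 then t - 1 else if s = hj_coef \<alpha>s t - 1 then (if t = n then 0 else t + 1) else 0)"
    if "s < hj_coef \<alpha>s t"
    using n_ne_1 by (simp add: out_arrow_def acw_next_def)
  show "ax (ou t s) = S.Xd t s \<and> ay (ou t s) = S.Yd t s" if "s < hj_coef \<alpha>s t"
    using out_arrow_deg[OF t that] by simp
  assume s: "s + 2 \<le> hj_coef \<alpha>s t"
  show "\<exists>x y. ((ou t s # x, ou t (s + 1) # y) \<in> recon_relations \<alpha>s \<or>
              (ou t (s + 1) # y, ou t s # x) \<in> recon_relations \<alpha>s) \<and>
        wdeg ax (ou t s # x) = S.Xd t s \<and> wdeg ay (ou t s # x) = S.Yd t (s + 1)"
    using relation_out[OF t s] unfolding corner_def kdeg_corner[OF t s] by blast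
  \<comment> \<open>The corner \<open>(t, s)\<close> has generator index
    \<open>ec t + s + 1\<close>, so the relation at vertex 0 with that index serves it.\<close>
  have "ec t + s \<le> \<gamma>"
    using ext_count_Suc[OF t(1), of \<alpha>s] ext_count_le[of "Suc t"] t s by simp
  from relation_vertex_0[OF this] show
      "\<exists>x y. ((Acw 0 1 # x, Cw 0 n # y) \<in> recon_relations \<alpha>s \<or>
              (Cw 0 n # y, Acw 0 1 # x) \<in> recon_relations \<alpha>s) \<and>
        wdeg ax (Acw 0 1 # x) = S.Xd t s \<and> wdeg ay (Acw 0 1 # x) = S.Yd t (s + 1)"
    unfolding corner_def kdeg_corner[OF t s] by blast
next
  show "wdeg ax x = wdeg ax y \<and> wdeg ay x = wdeg ay y" if "(x, y) \<in> recon_relations \<alpha>s" for x y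
    using relations_corner[OF that] unfolding corner_def by auto
qed (use rel_parallel S.J0 S.J1 in auto)

end

lemma monomial_presentation_recon:
  "monomial_presentation (recon_quiver \<alpha>s) (Suc n) ax ay S.W (recon_relations \<alpha>s)"
proof (cases "n = 1")
  case True
  show ?thesis by (rule hj_quiver.monomial_presentation[OF hj_quiver_1[OF True]])
next
  case False
  then have n2: "2 \<le> n" using S.n by simp
  show ?thesis by (rule hj_quiver.monomial_presentation[OF hj_quiver_ge_2[OF n2]])
qed

lemma W_iff: "S.W u v p q \<longleftrightarrow> int r dvd int p + int a * int q + int (hj_I \<alpha>s u) - int (hj_I \<alpha>s v)"
  unfolding S.W_def S.lat_def by (simp add: algebra_simps)

end

theorem corollary3p26:
  fixes r a :: nat and \<epsilon> :: complex
  assumes "r > a" and "a \<ge> 1" and "coprime r a"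
    and "primitive_root_of_unity r \<epsilon>"
  shows "(\<exists>\<phi> \<in> ring_iso (centre_ring (reconstruction_algebra r a))
                        (invariant_ring (group_1ra \<epsilon> a)).
            \<forall>c. \<phi> (recon_scalar r a c) = polyC c)
       \<and> finite_over_centre (reconstruction_algebra r a)
       \<and> noetherian (reconstruction_algebra r a)
       \<and> PI_ring (reconstruction_algebra r a)"
proof -
  define \<alpha>s where "\<alpha>s = hj_expansion r a"
  have expansion: "is_hj_expansion r a \<alpha>s"
    unfolding \<alpha>s_def by (rule is_hj_expansion_hj_expansion[OF assms(1,2)])
  let ?W = "hj_series.W r a (hj_I \<alpha>s)" and ?N = "Suc (hj_len \<alpha>s)"
  interpret M: monomial_presentation "recon_quiver \<alpha>s" ?N "arrow_x \<alpha>s" "arrow_y \<alpha>s" ?W "recon_relations \<alpha>s"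
    by (rule monomial_presentation_recon[OF expansion assms(3,2)])
  have A: "reconstruction_algebra r a =
      path_algebra (recon_quiver \<alpha>s) Quot relation_ideal (recon_quiver \<alpha>s) (recon_relations \<alpha>s)"
    by (simp add: reconstruction_algebra_def recon_ideal_def \<alpha>s_def)
  interpret GM: graded_matrix_ring "reconstruction_algebra r a" M.quot_rep ?N r a "\<lambda>t. int (hj_I \<alpha>s t)" ?W
  proof (intro graded_matrix_ring.intro graded_matrix_ring_axioms.intro)
    show "ring (reconstruction_algebra r a)" by (rule ring_reconstruction_algebra[OF assms(1,2)])
    show "M.quot_rep \<in> ring_iso (reconstruction_algebra r a)
        (ring_mat TYPE(complex poly poly) ?N () \<lparr>carrier := graded_mats ?N ?W\<rparr>)"
      unfolding A by (rule M.quot_rep_iso)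
    show "?W u v p q \<longleftrightarrow> int r dvd int p + int a * int q + int (hj_I \<alpha>s u) - int (hj_I \<alpha>s v)" for u v p q
      by (rule W_iff[OF expansion assms(3,2)])
  qed (use assms in auto)
  \<comment> \<open>This makes the isomorphism one of algebras over the complex numbers and not
    merely of rings.\<close>
  have "M.quot_rep (recon_scalar r a c) $$ (0, 0) = polyC c" for c
  proof -
    have "M.quot_rep (recon_scalar r a c) = M.rep (path_scalar (recon_quiver \<alpha>s) c)"
      unfolding recon_scalar_def \<alpha>s_def[symmetric] recon_ideal_def
      by (rule M.quot_rep_coset) (rule M.path_scalar_closed)
    then show ?thesis by (simp add: M.rep_index M.ent_path_scalar bimonom_def polyC_def monom_0)
  qed
  moreover have "invariant_ring (group_1ra \<epsilon> a) = ring_of_type_algebra\<lparr>carrier := invariant_polys r a\<rparr>"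
    unfolding invariant_ring_def invariants_eq[OF assms(4)] ..
  ultimately show ?thesis using GM.centre_iso GM.finiteness by metis
qed

end
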